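(* Assume that there exist $c_\star,c_\dagger>0$ such that for all $w\in Y_h$ and $r\in B_h$ we have $$\|w''\|\le c_\star\|w\|_\star,\qquad\|r'\|\le c_\dagger\|r\|_\dagger.$$ Then there exists a constant $c_{\rm ed}>0$ such that for the uniquely defined iterates $(y_k,b_k)_{k=0,1,\dots}$ of the gradient descent scheme described in the context we have $$E_{\delta,\varepsilon,h}[y_K,b_K]+\big(1-c_{\rm ed}\,\tau\,\delta^{-1}h^{-1}\big)\,\tau\sum_{k=1}^K\big(\|d_ty_k\|_\star^2+\|d_tb_k\|_\dagger^2\big)\le E_{\delta,\varepsilon,h}[y_0,b_0].$$ Moreover, if $2c_{\rm ed}\tau\le\delta h$, we have, with a constant $c_{\rm ul}>0$, that $$\big\|\mathcal{I}_h^{1,0}|b_k|^2-1\big\|_{L^\infty(0,L)}+\big\|\mathcal{I}_h^{1,0}|y_k'|^2-1\big\|_{L^\infty(0,L)}\le c_{\rm ul}\,\tau\,e_0,$$ with $e_0=E_{\delta,\varepsilon,h}[y_0,b_0]$.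
   Context: Let $L>0$ and $\|\cdot\|$, $(\cdot,\cdot)$ be the $L^2(0,L)$ norm and inner product. $\mathcal{T}_h$ is a quasiuniform partition (minimal element length $\ge c\,h$) $0=x_0<\dots<x_N=L$ of $(0,L)$ with maximal element length $h$. $\mathcal{S}^{p,k}(\mathcal{T}_h)$ is the space of $C^k$ functions on $[0,L]$ that are polynomials of degree at most $p$ on each element; $\mathcal{I}_h^{1,0}$ is the nodal interpolation operator onto $\mathcal{S}^{1,0}(\mathcal{T}_h)$. Set $Y_h=\mathcal{S}^{3,1}(\mathcal{T}_h)^3$, $B_h=\mathcal{S}^{1,0}(\mathcal{T}_h)^3$, with inner products $(\cdot,\cdot)_\star$ on $Y_h$ and $(\cdot,\cdot)_\dagger$ on $B_h$ and induced norms $\|\cdot\|_\star$, $\|\cdot\|_\dagger$. Boundary conditions are separated: $L_{\rm bc}^1[y]=\ell_{\rm bc}^1$, $L_{\rm bc}^2[b]=\ell_{\rm bc}^2$ with bounded linear operators depending only on the values of $y,y'$, respectively $b$, at $0$ and $L$. On each element $T=[x_{j-1},x_j]$, $\mathcal{A}v|_T=|T|^{-1}\int_Tv\,dx$ and $\mathcal{M}r|_T=\frac12(r(x_{j-1})+r(x_j))$. For $\delta>0$ a function $|\cdot|_\delta\in C^2(\mathbb{R};\mathbb{R}_{\ge0})$ is given such that $|x|_\delta\ge c_0\delta$, $\big|(|\cdot|_\delta)'\big|\le c_1$, $\big|(|\cdot|_\delta)''\big|\le c_2\delta^{-1}$, $\big||x|_\delta-|x|\big|\le c_{\rm uni}\delta$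 for all $x\in\mathbb{R}$, with constants independent of $\delta$. For $r,s\ge0$ set $\psi_\delta(r,s)=|r-s|_\delta+\dfrac{4s^2}{r+s+|r-s|_\delta}$, with partial derivatives $\psi_{\delta,1}'$ and $\psi_{\delta,2}'$ with respect to $r$ and $s$. For $\varepsilon=(\varepsilon_1,\varepsilon_2)$, $\varepsilon_1,\varepsilon_2>0$, let $$P_\varepsilon[y,b]=\frac1{2\varepsilon_1}\int_0^L\mathcal{I}_h^{1,0}\big[(y'\cdot b)^2\big]dx+\frac1{2\varepsilon_2}\int_0^L(\mathcal{M}y'\cdot b')^2dx,$$ $$E_{\delta,\varepsilon,h}[y,b]=\frac12\int_0^L|y''|^2+5|b'|^2+\psi_\delta(|\mathcal{A}y''|^2,|b'|^2)\,dx+P_\varepsilon[y,b],$$ and let $\delta_yP_\varepsilon[y,b;w]$, $\delta_bP_\varepsilon[y,b;r]$ be the variational derivatives of $P_\varepsilon$ with respect to $y$ in direction $w$ and with respect to $b$ in direction $r$. Gradient descent scheme: choose $\tau>0$ and $(y_0,b_0)\in Y_h\times B_h$ with $L_{\rm bc}^1[y_0]=\ell_{\rm bc}^1$, $L_{\rm bc}^2[b_0]=\ell_{\rm bc}^2$ and $|y_0'(x_j)|=|b_0(x_j)|=1$ at all nodes. Write $d_ta_k=(a_k-a_{k-1})/\tau$. For $k=1,2,\dots$: (1) Compute $y_k\in Y_h$ such that $d_ty_k'\cdot y_{k-1}'=0$ at all nodes, $L_{\rm bc}^1[d_ty_k]=0$, and $$(d_ty_k,w)_\star+(y_k'',w'')+\delta_yP_\varepsilon[y_k,b_{k-1};w]=-\big(\psi_{\delta,1}'(|\mathcal{A}y_{k-1}''|^2,|b_{k-1}'|^2)\mathcal{A}y_{k-1}'',\mathcal{A}w''\big)$$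 for all $w\in Y_h$ with $w'\cdot y_{k-1}'=0$ at all nodes and $L_{\rm bc}^1[w]=0$. (2) Compute $b_k\in B_h$ such that $d_tb_k\cdot b_{k-1}=0$ at all nodes, $L_{\rm bc}^2[d_tb_k]=0$, and $$(d_tb_k,r)_\dagger+5(b_k',r')+\delta_bP_\varepsilon[y_k,b_k;r]=-\big(\psi_{\delta,2}'(|\mathcal{A}y_{k-1}''|^2,|b_{k-1}'|^2)b_{k-1}',r'\big)$$ for all $r\in B_h$ with $r\cdot b_{k-1}=0$ at all nodes and $L_{\rm bc}^2[r]=0$. (3) Stop if $\|d_ty_k\|_\star+\|d_tb_k\|_\dagger\le\varepsilon_{\rm stop}$ for a given tolerance; otherwise continue with $k+1$.
   Formalization: c_ed depends monotonically on the energy: on e_0 if c_ed τ ≤ δh, otherwise on the largest energy of the iterates before K; c_ul depends on a constant C with ‖w'‖ ≤ C‖w‖_⋆, ‖r‖ ≤ C‖r‖_† under homogeneous boundary conditions. Without these dependences the uniform bounds fail. *)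

theory Defs
  imports "HOL-Analysis.Analysis" "HOL-Computational_Algebra.Polynomial"
begin

type_synonym vec3 = "real ^ 3"

subsection \<open>Partitions\<close>

text \<open>A partition \<open>0 = x\<^sub>0 < \<dots> < x\<^sub>N = L\<close>; the values \<open>node m j\<close> with \<open>j > nel m\<close> are irrelevant.\<close>

record mesh =
  nel :: nat
  node :: "nat \<Rightarrow> real"

definition is_partition :: "real \<Rightarrow> mesh \<Rightarrow> bool" where
  "is_partition L m \<longleftrightarrow> 0 < nel m \<and> node m 0 = 0 \<and> node m (nel m) = L \<and>
     (\<forall>j<nel m. node m j < node m (Suc j))"

definition len :: "mesh \<Rightarrow> real" where
  "len m = node m (nel m)"

definition dom :: "mesh \<Rightarrow> real set" where
  "dom m = {0..len m}"

definition elem :: "mesh \<Rightarrow> nat \<Rightarrow> real set" where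
  "elem m j = {node m (j - 1)..node m j}"

definition elem_length :: "mesh \<Rightarrow> nat \<Rightarrow> real" where
  "elem_length m j = node m j - node m (j - 1)"

definition mesh_size :: "mesh \<Rightarrow> real" where
  "mesh_size m = Max (elem_length m ` {1..nel m})"

definition quasiuniform :: "real \<Rightarrow> mesh \<Rightarrow> bool" where
  "quasiuniform c m \<longleftrightarrow> (\<forall>j\<in>{1..nel m}. c * mesh_size m \<le> elem_length m j)"

text \<open>The index of the element containing \<open>u\<close>; at an interior node the left element is
  selected, which does not affect integrals.\<close>

definition elem_of :: "mesh \<Rightarrow> real \<Rightarrow> nat" where
  "elem_of m u = (LEAST j. 1 \<le> j \<and> u \<le> node m j)"


subsection \<open>Derivatives, norms, averages\<close>

text \<open>Derivative relative to \<open>[0,L]\<close>, hence one-sided at the end points.  For a second derivative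
  of a piecewise polynomial \<open>C\<^sup>1\<close> function, \<open>D m (D m y)\<close> has unspecified values at the finitely
  many interior nodes where \<open>D m y\<close> has a kink; it is only used under integrals.\<close>

definition D :: "mesh \<Rightarrow> (real \<Rightarrow> 'a::real_normed_vector) \<Rightarrow> real \<Rightarrow> 'a" where
  "D m f u = vector_derivative f (at u within dom m)"

definition L2_inner :: "mesh \<Rightarrow> (real \<Rightarrow> 'a::real_inner) \<Rightarrow> (real \<Rightarrow> 'a) \<Rightarrow> real" where
  "L2_inner m f g = integral (dom m) (\<lambda>u. f u \<bullet> g u)"

definition L2_norm :: "mesh \<Rightarrow> (real \<Rightarrow> 'a::real_inner) \<Rightarrow> real" where
  "L2_norm m f = sqrt (L2_inner m f f)"

definition Linf_norm :: "mesh \<Rightarrow> (real \<Rightarrow> 'a::real_normed_vector) \<Rightarrow> real" where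
  "Linf_norm m f = Inf {C. 0 \<le> C \<and> (AE u in lebesgue_on {0<..<len m}. norm (f u) \<le> C)}"

definition Aop :: "mesh \<Rightarrow> (real \<Rightarrow> vec3) \<Rightarrow> real \<Rightarrow> vec3" where
  "Aop m v u = (let j = elem_of m u in (1 / elem_length m j) *\<^sub>R integral (elem m j) v)"

definition Mop :: "mesh \<Rightarrow> (real \<Rightarrow> vec3) \<Rightarrow> real \<Rightarrow> vec3" where
  "Mop m r u = (let j = elem_of m u in (1/2) *\<^sub>R (r (node m (j - 1)) + r (node m j)))"


subsection \<open>Finite element spaces\<close>

definition C_k :: "mesh \<Rightarrow> nat \<Rightarrow> (real \<Rightarrow> real) \<Rightarrow> bool" where
  "C_k m k f \<longleftrightarrow> (\<forall>i<k. (D m ^^ i) f differentiable_on dom m) \<and>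
     continuous_on (dom m) ((D m ^^ k) f)"

text \<open>Functions on \<open>[0,L]\<close> are represented by functions on the real line that vanish
  outside \<open>[0,L]\<close>, so that equality of functions is equality on \<open>[0,L]\<close>.\<close>

definition Spl :: "mesh \<Rightarrow> nat \<Rightarrow> nat \<Rightarrow> (real \<Rightarrow> real) set" where
  "Spl m p k = {f. (\<forall>u. u \<notin> dom m \<longrightarrow> f u = 0) \<and> C_k m k f \<and>
     (\<forall>j\<in>{1..nel m}. \<exists>q. degree q \<le> p \<and> (\<forall>u\<in>elem m j. f u = poly q u))}"

definition Yh :: "mesh \<Rightarrow> (real \<Rightarrow> vec3) set" where
  "Yh m = {y. \<forall>i. (\<lambda>u. y u $ i) \<in> Spl m 3 1}"

definition Bh :: "mesh \<Rightarrow> (real \<Rightarrow> vec3) set" where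
  "Bh m = {b. \<forall>i. (\<lambda>u. b u $ i) \<in> Spl m 1 0}"

definition interp :: "mesh \<Rightarrow> (real \<Rightarrow> real) \<Rightarrow> real \<Rightarrow> real" where
  "interp m f = (THE g. g \<in> Spl m 1 0 \<and> (\<forall>j\<le>nel m. g (node m j) = f (node m j)))"

definition inner_product_on ::
    "(real \<Rightarrow> vec3) set \<Rightarrow> ((real \<Rightarrow> vec3) \<Rightarrow> (real \<Rightarrow> vec3) \<Rightarrow> real) \<Rightarrow> bool" where
  "inner_product_on V ip \<longleftrightarrow>
     (\<forall>v\<in>V. \<forall>w\<in>V. ip v w = ip w v) \<and>
     (\<forall>u\<in>V. \<forall>v\<in>V. \<forall>w\<in>V. ip (\<lambda>s. u s + v s) w = ip u w + ip v w) \<and>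
     (\<forall>a. \<forall>v\<in>V. \<forall>w\<in>V. ip (\<lambda>s. a *\<^sub>R v s) w = a * ip v w) \<and>
     (\<forall>v\<in>V. v \<noteq> (\<lambda>s. 0) \<longrightarrow> 0 < ip v v)"

definition ip_norm ::
    "((real \<Rightarrow> vec3) \<Rightarrow> (real \<Rightarrow> vec3) \<Rightarrow> real) \<Rightarrow> (real \<Rightarrow> vec3) \<Rightarrow> real" where
  "ip_norm ip v = sqrt (ip v v)"


subsection \<open>Boundary conditions\<close>

text \<open>The boundary operators are a linear map applied to the boundary values
  \<open>(y(0), y(L), y'(0), y'(L))\<close> and \<open>(b(0), b(L))\<close>, respectively.\<close>

definition bc1 :: "mesh \<Rightarrow> (vec3 \<times> vec3 \<times> vec3 \<times> vec3 \<Rightarrow> 'm) \<Rightarrow> (real \<Rightarrow> vec3) \<Rightarrow> 'm" where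
  "bc1 m \<Lambda> y = \<Lambda> (y 0, y (len m), D m y 0, D m y (len m))"

definition bc2 :: "mesh \<Rightarrow> (vec3 \<times> vec3 \<Rightarrow> 'n) \<Rightarrow> (real \<Rightarrow> vec3) \<Rightarrow> 'n" where
  "bc2 m \<Lambda> b = \<Lambda> (b 0, b (len m))"


subsection \<open>Energies\<close>

definition regularized_abs ::
    "real \<Rightarrow> real \<Rightarrow> real \<Rightarrow> real \<Rightarrow> real \<Rightarrow> (real \<Rightarrow> real) \<Rightarrow> bool" where
  "regularized_abs c0 c1 c2 cuni \<delta> \<phi> \<longleftrightarrow>
     (\<forall>x. 0 \<le> \<phi> x) \<and>
     (\<exists>\<phi>' \<phi>''. (\<forall>x. (\<phi> has_real_derivative \<phi>' x) (at x)) \<and>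
        (\<forall>x. (\<phi>' has_real_derivative \<phi>'' x) (at x)) \<and> continuous_on UNIV \<phi>'' \<and>
        (\<forall>x. c0 * \<delta> \<le> \<phi> x \<and> \<bar>\<phi>' x\<bar> \<le> c1 \<and> \<bar>\<phi>'' x\<bar> \<le> c2 / \<delta> \<and>
             \<bar>\<phi> x - \<bar>x\<bar>\<bar> \<le> cuni * \<delta>))"

definition psi :: "(real \<Rightarrow> real) \<Rightarrow> real \<Rightarrow> real \<Rightarrow> real" where
  "psi \<phi> r s = \<phi> (r - s) + 4 * s\<^sup>2 / (r + s + \<phi> (r - s))"

text \<open>The defining formula of \<open>psi\<close> is smooth in a neighbourhood of the closed quadrant, so at
  \<open>r = 0\<close> or \<open>s = 0\<close> the two-sided derivative below is the one-sided one.\<close>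

definition psi_1 :: "(real \<Rightarrow> real) \<Rightarrow> real \<Rightarrow> real \<Rightarrow> real" where
  "psi_1 \<phi> r s = deriv (\<lambda>\<rho>. psi \<phi> \<rho> s) r"

definition psi_2 :: "(real \<Rightarrow> real) \<Rightarrow> real \<Rightarrow> real \<Rightarrow> real" where
  "psi_2 \<phi> r s = deriv (\<lambda>\<sigma>. psi \<phi> r \<sigma>) s"

definition P_eps ::
    "mesh \<Rightarrow> real \<Rightarrow> real \<Rightarrow> (real \<Rightarrow> vec3) \<Rightarrow> (real \<Rightarrow> vec3) \<Rightarrow> real" where
  "P_eps m \<epsilon>1 \<epsilon>2 y b =
     1 / (2 * \<epsilon>1) * integral (dom m) (interp m (\<lambda>u. (D m y u \<bullet> b u)\<^sup>2)) +
     1 / (2 * \<epsilon>2) * integral (dom m) (\<lambda>u. (Mop m (D m y) u \<bullet> D m b u)\<^sup>2)"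

definition energy ::
    "mesh \<Rightarrow> (real \<Rightarrow> real) \<Rightarrow> real \<Rightarrow> real \<Rightarrow> (real \<Rightarrow> vec3) \<Rightarrow> (real \<Rightarrow> vec3) \<Rightarrow> real" where
  "energy m \<phi> \<epsilon>1 \<epsilon>2 y b =
     1 / 2 * integral (dom m) (\<lambda>u. (norm (D m (D m y) u))\<^sup>2 + 5 * (norm (D m b u))\<^sup>2 +
        psi \<phi> ((norm (Aop m (D m (D m y)) u))\<^sup>2) ((norm (D m b u))\<^sup>2)) +
     P_eps m \<epsilon>1 \<epsilon>2 y b"

definition dP_y ::
    "mesh \<Rightarrow> real \<Rightarrow> real \<Rightarrow> (real \<Rightarrow> vec3) \<Rightarrow> (real \<Rightarrow> vec3) \<Rightarrow> (real \<Rightarrow> vec3) \<Rightarrow> real" where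
  "dP_y m \<epsilon>1 \<epsilon>2 y b w = deriv (\<lambda>t. P_eps m \<epsilon>1 \<epsilon>2 (\<lambda>u. y u + t *\<^sub>R w u) b) 0"

definition dP_b ::
    "mesh \<Rightarrow> real \<Rightarrow> real \<Rightarrow> (real \<Rightarrow> vec3) \<Rightarrow> (real \<Rightarrow> vec3) \<Rightarrow> (real \<Rightarrow> vec3) \<Rightarrow> real" where
  "dP_b m \<epsilon>1 \<epsilon>2 y b r = deriv (\<lambda>t. P_eps m \<epsilon>1 \<epsilon>2 y (\<lambda>u. b u + t *\<^sub>R r u)) 0"


subsection \<open>The gradient descent scheme\<close>

definition dt :: "real \<Rightarrow> (nat \<Rightarrow> real \<Rightarrow> vec3) \<Rightarrow> nat \<Rightarrow> real \<Rightarrow> vec3" where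
  "dt \<tau> a k u = (1 / \<tau>) *\<^sub>R (a k u - a (k - 1) u)"

definition tangent_Y ::
    "mesh \<Rightarrow> (vec3 \<times> vec3 \<times> vec3 \<times> vec3 \<Rightarrow> 'm::zero) \<Rightarrow> (real \<Rightarrow> vec3) \<Rightarrow> (real \<Rightarrow> vec3) set" where
  "tangent_Y m \<Lambda>1 y =
     {w \<in> Yh m. (\<forall>j\<le>nel m. D m w (node m j) \<bullet> D m y (node m j) = 0) \<and> bc1 m \<Lambda>1 w = 0}"

definition tangent_B ::
    "mesh \<Rightarrow> (vec3 \<times> vec3 \<Rightarrow> 'n::zero) \<Rightarrow> (real \<Rightarrow> vec3) \<Rightarrow> (real \<Rightarrow> vec3) set" where
  "tangent_B m \<Lambda>2 b =
     {r \<in> Bh m. (\<forall>j\<le>nel m. r (node m j) \<bullet> b (node m j) = 0) \<and> bc2 m \<Lambda>2 r = 0}"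

definition y_step where
  "y_step m \<phi> \<epsilon>1 \<epsilon>2 ipS \<Lambda>1 \<tau> y b k \<longleftrightarrow>
     y k \<in> Yh m \<and> dt \<tau> y k \<in> tangent_Y m \<Lambda>1 (y (k - 1)) \<and>
     (\<forall>w \<in> tangent_Y m \<Lambda>1 (y (k - 1)).
        ipS (dt \<tau> y k) w + L2_inner m (D m (D m (y k))) (D m (D m w)) +
          dP_y m \<epsilon>1 \<epsilon>2 (y k) (b (k - 1)) w
        = - L2_inner m
             (\<lambda>u. psi_1 \<phi> ((norm (Aop m (D m (D m (y (k - 1)))) u))\<^sup>2) ((norm (D m (b (k - 1)) u))\<^sup>2)
                    *\<^sub>R Aop m (D m (D m (y (k - 1)))) u)
             (Aop m (D m (D m w))))"

definition b_step where
  "b_step m \<phi> \<epsilon>1 \<epsilon>2 ipD \<Lambda>2 \<tau> y b k \<longleftrightarrow>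
     b k \<in> Bh m \<and> dt \<tau> b k \<in> tangent_B m \<Lambda>2 (b (k - 1)) \<and>
     (\<forall>r \<in> tangent_B m \<Lambda>2 (b (k - 1)).
        ipD (dt \<tau> b k) r + 5 * L2_inner m (D m (b k)) (D m r) +
          dP_b m \<epsilon>1 \<epsilon>2 (y k) (b k) r
        = - L2_inner m
             (\<lambda>u. psi_2 \<phi> ((norm (Aop m (D m (D m (y (k - 1)))) u))\<^sup>2) ((norm (D m (b (k - 1)) u))\<^sup>2)
                    *\<^sub>R D m (b (k - 1)) u)
             (D m r))"

definition admissible_init where
  "admissible_init m \<Lambda>1 l1 \<Lambda>2 l2 y0 b0 \<longleftrightarrow>
     y0 \<in> Yh m \<and> b0 \<in> Bh m \<and> bc1 m \<Lambda>1 y0 = l1 \<and> bc2 m \<Lambda>2 b0 = l2 \<and>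
     (\<forall>j\<le>nel m. norm (D m y0 (node m j)) = 1 \<and> norm (b0 (node m j)) = 1)"

text \<open>The full infinite sequence of iterates; the stopping test merely truncates it.\<close>

definition iterates where
  "iterates m \<phi> \<epsilon>1 \<epsilon>2 ipS ipD \<Lambda>1 \<Lambda>2 \<tau> y0 b0 y b \<longleftrightarrow>
     y 0 = y0 \<and> b 0 = b0 \<and>
     (\<forall>k\<ge>1. y_step m \<phi> \<epsilon>1 \<epsilon>2 ipS \<Lambda>1 \<tau> y b k \<and> b_step m \<phi> \<epsilon>1 \<epsilon>2 ipD \<Lambda>2 \<tau> y b k)"

text \<open>Inequality of the energy estimate after \<open>K\<close> steps, with constant \<open>ced\<close>.\<close>

definition energy_estimate where
  "energy_estimate m \<phi> \<epsilon>1 \<epsilon>2 ipS ipD \<delta> \<tau> ced y b K \<longleftrightarrow>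
     energy m \<phi> \<epsilon>1 \<epsilon>2 (y K) (b K) +
       (1 - ced * \<tau> * (1 / \<delta>) * (1 / mesh_size m)) * \<tau> *
         (\<Sum>k = 1..K. (ip_norm ipS (dt \<tau> y k))\<^sup>2 + (ip_norm ipD (dt \<tau> b k))\<^sup>2)
     \<le> energy m \<phi> \<epsilon>1 \<epsilon>2 (y 0) (b 0)"

text \<open>Lower-order control of the increments, which bounds on \<open>w''\<close> and \<open>r'\<close> alone do not
  give.  For a given partition and given inner products some \<open>C\<close> always exists, since the spaces
  are finite-dimensional.  When the homogeneous boundary conditions give Poincare inequalities,
  or the inner products dominate the full \<open>H\<^sup>2\<close> and \<open>H\<^sup>1\<close> norms, \<open>C\<close> does not depend on the
  partition.\<close>

definition low_order_control where
  "low_order_control m ipS ipD \<Lambda>1 \<Lambda>2 C \<longleftrightarrow>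
     (\<forall>w\<in>Yh m. bc1 m \<Lambda>1 w = 0 \<longrightarrow> L2_norm m (D m w) \<le> C * ip_norm ipS w) \<and>
     (\<forall>r\<in>Bh m. bc2 m \<Lambda>2 r = 0 \<longrightarrow> L2_norm m r \<le> C * ip_norm ipD r)"

end

theory Submission
  imports Defs
begin

text \<open>The quadratic (bending and penalty) part of the energy is treated implicitly and is
  convex in \<open>y\<close> and in \<open>b\<close> separately, so testing with the increments
  gives dissipation \<open>\<tau> (|d\<^sub>t y|\<^sup>2 + |d\<^sub>t b|\<^sup>2)\<close> up to the Taylor remainder of the explicit
  \<open>\<psi>\<close>-term.  That term only sees the elementwise constants \<open>\<A> y''\<close> and \<open>b'\<close>, and its
  remainder is bounded by \<open>C (1 + (|\<A> y''|\<^sup>2 + |b'|\<^sup>2) / \<delta>)\<close> times the squared increment, evaluated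
  at the old iterate only.  The inverse estimate \<open>h |\<A> y''|\<^sup>2 \<le> C E\<close> and the lower bound
  \<open>\<delta> \<le> C E\<close> turn this into \<open>C E / (\<delta> h)\<close>.  The nodal constraints are violated by
  \<open>\<tau>\<^sup>2 \<Sum> |d\<^sub>t b|\<^sup>2\<close> (Pythagoras), which the dissipation and a Sobolev inequality control.\<close>

section \<open>Linear problems on finite-dimensional function spaces\<close>

text \<open>The obstacle is that no bound on the iterates is known in advance, while the Hessian of
  the explicit density grows with them. Hence the constant is a monotone function \<open>ced\<close>
  of an energy bound rather than a number. Keeping the new iterate out of the remainder is what
  avoids circularity: under the step size condition the bound by the initial energy passes from one
  iterate to the next, and without that condition the largest energy reached before the last step
  takes its place. The penalty is quadratic in each argument but not jointly convex. This does no
  harm, since the \<open>y\<close>-step freezes the old \<open>b\<close> and the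
  \<open>b\<close>-step already uses the new \<open>y\<close>, so that the value of the penalty at
  the pair (new \<open>y\<close>, old \<open>b\<close>) cancels when the two steps are added. The
  explicit terms of both steps, in contrast, are frozen at the same old pair; tested with the two
  increments they add up to the full differential of the \<open>psi\<close> term, which is what a
  joint Taylor expansion in both variables requires.\<close>

definition fsubspace :: "('a \<Rightarrow> 'b::real_vector) set \<Rightarrow> bool" where
  "fsubspace V \<longleftrightarrow> (\<lambda>s. 0) \<in> V \<and> (\<forall>u\<in>V. \<forall>v\<in>V. (\<lambda>s. u s + v s) \<in> V) \<and>
     (\<forall>a. \<forall>v\<in>V. (\<lambda>s. a *\<^sub>R v s) \<in> V)"

definition linear_fun_on :: "('a \<Rightarrow> 'b::real_vector) set \<Rightarrow> (('a \<Rightarrow> 'b) \<Rightarrow> real) \<Rightarrow> bool" where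
  "linear_fun_on V l \<longleftrightarrow> (\<forall>u\<in>V. \<forall>v\<in>V. l (\<lambda>s. u s + v s) = l u + l v) \<and>
     (\<forall>a. \<forall>v\<in>V. l (\<lambda>s. a *\<^sub>R v s) = a * l v)"

definition sym_form_on ::
    "('a \<Rightarrow> 'b::real_vector) set \<Rightarrow> (('a \<Rightarrow> 'b) \<Rightarrow> ('a \<Rightarrow> 'b) \<Rightarrow> real) \<Rightarrow> bool" where
  "sym_form_on V B \<longleftrightarrow> (\<forall>u\<in>V. \<forall>v\<in>V. B u v = B v u) \<and> (\<forall>u\<in>V. linear_fun_on V (B u))"

lemma fsubspaceD:
  assumes "fsubspace V"
  shows "(\<lambda>s. 0) \<in> V" "u \<in> V \<Longrightarrow> v \<in> V \<Longrightarrow> (\<lambda>s. u s + v s) \<in> V"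
    "v \<in> V \<Longrightarrow> (\<lambda>s. a *\<^sub>R v s) \<in> V"
  using assms unfolding fsubspace_def by auto

lemma fsubspace_lincomb:
  assumes "fsubspace V" "u \<in> V" "v \<in> V"
  shows "(\<lambda>s. u s + a *\<^sub>R v s) \<in> V"
  using fsubspaceD(2)[OF assms(1,2) fsubspaceD(3)[OF assms(1,3)]] .

lemma linear_fun_onD:
  assumes "linear_fun_on V l"
  shows "u \<in> V \<Longrightarrow> v \<in> V \<Longrightarrow> l (\<lambda>s. u s + v s) = l u + l v"
    "v \<in> V \<Longrightarrow> l (\<lambda>s. a *\<^sub>R v s) = a * l v"
  using assms unfolding linear_fun_on_def by simp_all

lemma linear_fun_on_lincomb:
  assumes "fsubspace V" "linear_fun_on V l" "u \<in> V" "v \<in> V"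
  shows "l (\<lambda>s. u s + a *\<^sub>R v s) = l u + a * l v"
proof -
  have "l (\<lambda>s. u s + a *\<^sub>R v s) = l u + l (\<lambda>s. a *\<^sub>R v s)"
    by (rule linear_fun_onD(1)[OF assms(2,3) fsubspaceD(3)[OF assms(1,4)]])
  then show ?thesis using linear_fun_onD(2)[OF assms(2,4)] by simp
qed

lemma linear_fun_on_zero:
  assumes "fsubspace V" "linear_fun_on V l"
  shows "l (\<lambda>s. 0) = 0"
proof -
  have "l (\<lambda>s. 0 *\<^sub>R (0::'b)) = 0 * l (\<lambda>s. 0)"
    by (rule linear_fun_onD(2)[OF assms(2) fsubspaceD(1)[OF assms(1)]])
  then show ?thesis by simp
qed

lemma linear_fun_on_subset: "linear_fun_on V l \<Longrightarrow> W \<subseteq> V \<Longrightarrow> linear_fun_on W l"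
  unfolding linear_fun_on_def by blast

lemma sym_form_on_subset: "sym_form_on V B \<Longrightarrow> W \<subseteq> V \<Longrightarrow> sym_form_on W B"
  unfolding sym_form_on_def using linear_fun_on_subset by blast

lemma sym_form_on_lincomb:
  assumes "fsubspace V" "sym_form_on V B" "u \<in> V" "v \<in> V" "w \<in> V"
  shows "B w (\<lambda>s. u s + a *\<^sub>R v s) = B w u + a * B w v"
    "B (\<lambda>s. u s + a *\<^sub>R v s) w = B u w + a * B v w"
proof -
  show 1: "B w (\<lambda>s. u s + a *\<^sub>R v s) = B w u + a * B w v"
    using assms linear_fun_on_lincomb unfolding sym_form_on_def by blast
  have "B (\<lambda>s. u s + a *\<^sub>R v s) w = B w (\<lambda>s. u s + a *\<^sub>R v s)"
    "B w u = B u w" "B w v = B v w"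
    using assms fsubspace_lincomb[OF assms(1,3,4)] unfolding sym_form_on_def by blast+
  then show "B (\<lambda>s. u s + a *\<^sub>R v s) w = B u w + a * B v w" using 1 by simp
qed

lemma sym_form_on_square:
  assumes "fsubspace V" "sym_form_on V B" "u \<in> V" "v \<in> V"
  shows "B (\<lambda>s. u s + a *\<^sub>R v s) (\<lambda>s. u s + a *\<^sub>R v s) = B u u + 2 * a * B u v + a\<^sup>2 * B v v"
proof -
  have "B v u = B u v" using assms unfolding sym_form_on_def by blast
  then show ?thesis
    using assms fsubspace_lincomb[OF assms(1,3,4)]
    by (simp add: sym_form_on_lincomb power2_eq_square algebra_simps)
qed

text \<open>Induction over a finite separating family of functionals: splitting off the kernel of one
  functional amounts to a Gram-Schmidt step, so no notion of dimension is needed.\<close>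

lemma
  fixes V :: "('a \<Rightarrow> 'b::real_vector) set"
  assumes "finite \<N>" "fsubspace V" "sym_form_on V a" "\<forall>v\<in>V. v \<noteq> (\<lambda>s. 0) \<longrightarrow> 0 < a v v"
    "\<forall>N\<in>\<N>. linear_fun_on V N" "\<forall>v\<in>V. (\<forall>N\<in>\<N>. N v = 0) \<longrightarrow> v = (\<lambda>s. 0)"
  shows finite_dim_riesz: "linear_fun_on V l \<Longrightarrow> \<exists>d\<in>V. \<forall>v\<in>V. a d v = l v"
    and finite_dim_quadratic_bound:
      "\<lbrakk>\<forall>u\<in>V. \<forall>v\<in>V. Q (\<lambda>s. u s + v s) \<le> 2 * Q u + 2 * Q v;
        \<forall>t. \<forall>v\<in>V. Q (\<lambda>s. t *\<^sub>R v s) = t\<^sup>2 * Q v\<rbrakk> \<Longrightarrow> \<exists>C\<ge>0. \<forall>v\<in>V. Q v \<le> C * a v v"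
proof -
  \<comment> \<open>Both claims share one induction, generalized over \<open>l\<close> and
    \<open>Q\<close> because \<open>V\<close> shrinks: the Riesz claim on the kernel of
    \<open>N\<close> supplies the projection behind the complement vector \<open>e\<close>, and the
    bound on \<open>Q\<close> uses the same \<open>e\<close>.\<close>
  have "(\<forall>l. linear_fun_on V l \<longrightarrow> (\<exists>d\<in>V. \<forall>v\<in>V. a d v = l v)) \<and>
     (\<forall>Q. (\<forall>u\<in>V. \<forall>v\<in>V. Q (\<lambda>s. u s + v s) \<le> 2 * Q u + 2 * Q v) \<longrightarrow>
          (\<forall>t. \<forall>v\<in>V. Q (\<lambda>s. t *\<^sub>R v s) = t\<^sup>2 * Q v) \<longrightarrow> (\<exists>C\<ge>0. \<forall>v\<in>V. Q v \<le> C * a v v))"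
    using assms
  proof (induction \<N> arbitrary: V rule: finite_induct)
    case empty
    have z: "(\<lambda>s. 0) \<in> V" using fsubspaceD(1)[OF empty(1)] .
    have 0: "v = (\<lambda>s. 0)" if "v \<in> V" for v using empty that by simp
    have f: "linear_fun_on V (a (\<lambda>s. 0))" using empty(2) z unfolding sym_form_on_def by blast
    show ?case
    proof (intro conjI allI impI)
      fix l assume l: "linear_fun_on V l"
      have "a (\<lambda>s. 0) v = l v" if "v \<in> V" for v
        using 0[OF that] linear_fun_on_zero[OF empty(1) l] linear_fun_on_zero[OF empty(1) f] by simp
      then show "\<exists>d\<in>V. \<forall>v\<in>V. a d v = l v" using z by blast
    next
      fix Q :: "('a \<Rightarrow> 'b) \<Rightarrow> real"
      assume "\<forall>t. \<forall>v\<in>V. Q (\<lambda>s. t *\<^sub>R v s) = t\<^sup>2 * Q v"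
      from bspec[OF spec[OF this, of 0] z]
      have "Q (\<lambda>s. 0 *\<^sub>R (0::'b)) = 0\<^sup>2 * Q (\<lambda>s. 0)" .
      then have "\<forall>v\<in>V. Q v \<le> 0 * a v v" using 0 by auto
      then show "\<exists>C\<ge>0. \<forall>v\<in>V. Q v \<le> C * a v v" by blast
    qed
  next
    case (insert N \<N>)
    define V' where "V' = {v\<in>V. N v = 0}"
    have sub: "fsubspace V" and form: "sym_form_on V a" and lin: "linear_fun_on V N"
      using insert by auto
    have V'V: "V' \<subseteq> V" unfolding V'_def by blast
    have sub': "fsubspace V'"
      using sub lin linear_fun_on_zero[OF sub lin]
      unfolding fsubspace_def V'_def linear_fun_on_def by simp
    have IH: "(\<forall>l. linear_fun_on V' l \<longrightarrow> (\<exists>d\<in>V'. \<forall>v\<in>V'. a d v = l v)) \<and>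
     (\<forall>Q. (\<forall>u\<in>V'. \<forall>v\<in>V'. Q (\<lambda>s. u s + v s) \<le> 2 * Q u + 2 * Q v) \<longrightarrow>
          (\<forall>t. \<forall>v\<in>V'. Q (\<lambda>s. t *\<^sub>R v s) = t\<^sup>2 * Q v) \<longrightarrow> (\<exists>C\<ge>0. \<forall>v\<in>V'. Q v \<le> C * a v v))"
    proof (rule insert.IH[OF sub' sym_form_on_subset[OF form V'V]])
      show "\<forall>v\<in>V'. v \<noteq> (\<lambda>s. 0) \<longrightarrow> 0 < a v v" using insert.prems V'V by blast
      show "\<forall>N\<in>\<N>. linear_fun_on V' N"
        using insert.prems linear_fun_on_subset[OF _ V'V] by blast
      show "\<forall>v\<in>V'. (\<forall>N\<in>\<N>. N v = 0) \<longrightarrow> v = (\<lambda>s. 0)"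
        using insert.prems unfolding V'_def by simp
    qed
    show ?case
    proof (cases "V' = V")
      case True
      then show ?thesis using IH by simp
    next
      case False
      then obtain u where u: "u \<in> V" "N u \<noteq> 0" unfolding V'_def by blast
      \<comment> \<open>The projection of \<open>u\<close> onto the kernel \<open>V'\<close> is the
        Riesz representative \<open>p\<close> of \<open>a u\<close> on \<open>V'\<close>; then
        \<open>u - p\<close> spans the orthogonal complement.\<close>
      have "linear_fun_on V' (a u)"
        using form u V'V linear_fun_on_subset unfolding sym_form_on_def by blast
      then obtain p where p: "p \<in> V'" "\<forall>v\<in>V'. a p v = a u v" using IH by blast
      have pV: "p \<in> V" "N p = 0" using p V'_def by auto
      define e where "e = (\<lambda>s. u s + (-1) *\<^sub>R p s)"
      have e: "e \<in> V" unfolding e_def by (rule fsubspace_lincomb[OF sub u(1) pV(1)])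
      have Ne: "N e = N u"
        unfolding e_def using linear_fun_on_lincomb[OF sub lin u(1) pV(1), of "-1"] pV by simp
      have orth: "a e v = 0" if "v \<in> V'" for v
        unfolding e_def using sym_form_on_lincomb(2)[OF sub form u(1) pV(1) subsetD[OF V'V that], of "-1"] p(2) that by simp
      have orth': "a v e = 0" if "v \<in> V'" for v
        using orth[OF that] form e V'V that unfolding sym_form_on_def by auto
      have "e \<noteq> (\<lambda>s. 0)" using Ne u linear_fun_on_zero[OF sub lin] by auto
      then have ae: "a e e > 0" using e insert.prems by blast
      have split: "\<exists>w\<in>V'. \<exists>t. v = (\<lambda>s. w s + t *\<^sub>R e s)" if "v \<in> V" for v
      proof -
        define t where "t = N v / N e"
        have "(\<lambda>s. v s + (-t) *\<^sub>R e s) \<in> V'"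
          unfolding V'_def using fsubspace_lincomb[OF sub that e, of "-t"] u Ne
            linear_fun_on_lincomb[OF sub lin that e, of "-t"] by (simp add: t_def)
        moreover have "v = (\<lambda>s. (v s + (-t) *\<^sub>R e s) + t *\<^sub>R e s)" by auto
        ultimately show ?thesis by (intro bexI[where x = "\<lambda>s. v s + (-t) *\<^sub>R e s"] exI[where x = t])
      qed
      show ?thesis
      proof (intro conjI allI impI)
        fix l assume l: "linear_fun_on V l"
        obtain d where d: "d \<in> V'" "\<forall>v\<in>V'. a d v = l v"
          using IH linear_fun_on_subset[OF l V'V] by blast
        have dV: "d \<in> V" using d V'V by blast
        \<comment> \<open>The coefficient of \<open>e\<close> is forced by testing with
          \<open>e\<close>; orthogonality to \<open>V'\<close> decouples it from
          \<open>d\<close>.\<close>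
        let ?d = "\<lambda>s. d s + (l e / a e e) *\<^sub>R e s"
        have "a ?d v = l v" if "v \<in> V" for v
        proof -
          obtain w t where w: "w \<in> V'" "v = (\<lambda>s. w s + t *\<^sub>R e s)"
            using split[OF \<open>v \<in> V\<close>] by (elim bexE exE)
          have wV: "w \<in> V" using w V'V by blast
          have "a ?d v = a d v + (l e / a e e) * a e v"
            by (rule sym_form_on_lincomb(2)[OF sub form dV e that])
          also have "a d v = a d w + t * a d e"
            unfolding w by (rule sym_form_on_lincomb(1)[OF sub form wV e dV])
          also have "a e v = a e w + t * a e e"
            unfolding w by (rule sym_form_on_lincomb(1)[OF sub form wV e e])
          also have "l v = l w + t * l e"
            unfolding w by (rule linear_fun_on_lincomb[OF sub l wV e])
          ultimately show ?thesis
            using d w orth orth' ae linear_fun_on_lincomb[OF sub l wV e, of t] by simp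
        qed
        then show "\<exists>d\<in>V. \<forall>v\<in>V. a d v = l v" using fsubspace_lincomb[OF sub dV e] by blast
      next
        fix Q :: "('a \<Rightarrow> 'b) \<Rightarrow> real"
        assume Q: "\<forall>u\<in>V. \<forall>v\<in>V. Q (\<lambda>s. u s + v s) \<le> 2 * Q u + 2 * Q v"
          "\<forall>t. \<forall>v\<in>V. Q (\<lambda>s. t *\<^sub>R v s) = t\<^sup>2 * Q v"
        have "(\<forall>u\<in>V'. \<forall>v\<in>V'. Q (\<lambda>s. u s + v s) \<le> 2 * Q u + 2 * Q v)"
          "(\<forall>t. \<forall>v\<in>V'. Q (\<lambda>s. t *\<^sub>R v s) = t\<^sup>2 * Q v)"
          using Q V'V by (meson subsetD)+
        then obtain C where C: "C \<ge> 0" "\<forall>v\<in>V'. Q v \<le> C * a v v" using IH by blast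
        \<comment> \<open>From \<open>Q (w + t e) \<le> 2 Q w + 2 t^2 Q e\<close>: the first summand
          of \<open>M\<close> pays for \<open>w\<close>, the second for \<open>e\<close>, since
          \<open>a w w\<close> and \<open>t^2 a e e\<close> add up to \<open>a v v\<close>.\<close>
        define M where "M = 2 * C + 2 * \<bar>Q e\<bar> / a e e"
        have M0: "M \<ge> 0" using C ae unfolding M_def by auto
        have "Q v \<le> M * a v v" if "v \<in> V" for v
        proof -
          obtain w t where w: "w \<in> V'" "v = (\<lambda>s. w s + t *\<^sub>R e s)"
            using split[OF \<open>v \<in> V\<close>] by (elim bexE exE)
          have wV: "w \<in> V" using w V'V by blast
          have aw: "a w w \<ge> 0"
            using insert.prems wV linear_fun_on_zero[OF sub, of "a w"] form
            unfolding sym_form_on_def by (metis order.order_iff_strict)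
          have "a v v = a w w + t\<^sup>2 * a e e"
            unfolding w using sym_form_on_square[OF sub form wV e] orth'[OF w(1)] by simp
          moreover have "Q v \<le> 2 * Q w + 2 * (t\<^sup>2 * Q e)"
            unfolding w using Q wV e fsubspaceD(3)[OF sub e] by metis
          moreover have "2 * Q w \<le> M * a w w"
          proof -
            have "2 * Q w \<le> 2 * C * a w w" using C w by auto
            also have "\<dots> \<le> M * a w w" unfolding M_def using ae aw by (intro mult_right_mono) auto
            finally show ?thesis .
          qed
          moreover have "2 * (t\<^sup>2 * Q e) \<le> M * (t\<^sup>2 * a e e)"
          proof -
            have "2 * (t\<^sup>2 * Q e) \<le> t\<^sup>2 * (2 * \<bar>Q e\<bar>)" by (simp add: mult_left_mono)
            also have "\<dots> \<le> t\<^sup>2 * (M * a e e)"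
              using ae C unfolding M_def by (intro mult_left_mono) (auto simp: field_simps)
            finally show ?thesis by (simp add: mult_ac)
          qed
          ultimately show ?thesis by (simp add: algebra_simps)
        qed
        then show "\<exists>C\<ge>0. \<forall>v\<in>V. Q v \<le> C * a v v" using M0 by blast
      qed
    qed
  qed
  then show "linear_fun_on V l \<Longrightarrow> \<exists>d\<in>V. \<forall>v\<in>V. a d v = l v"
    "\<lbrakk>\<forall>u\<in>V. \<forall>v\<in>V. Q (\<lambda>s. u s + v s) \<le> 2 * Q u + 2 * Q v;
        \<forall>t. \<forall>v\<in>V. Q (\<lambda>s. t *\<^sub>R v s) = t\<^sup>2 * Q v\<rbrakk> \<Longrightarrow> \<exists>C\<ge>0. \<forall>v\<in>V. Q v \<le> C * a v v"
    by blast+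
qed

text \<open>Writing \<open>u = u0 + \<tau> d\<close> leaves a linear problem for \<open>d\<close> in
  \<open>V\<close> with the form \<open>ip + \<tau> B\<close>, which is positive definite for every
  \<open>\<tau> > 0\<close>. The larger space \<open>W\<close> is there because \<open>u0\<close>
  and \<open>u\<close> need not satisfy the homogeneous constraints that define
  \<open>V\<close>.\<close>

lemma implicit_step:
  fixes W :: "('a \<Rightarrow> 'b::real_vector) set"
  assumes fin: "finite \<N>" "\<forall>N\<in>\<N>. linear_fun_on W N"
      "\<forall>v\<in>W. (\<forall>N\<in>\<N>. N v = 0) \<longrightarrow> v = (\<lambda>s. 0)"
    and W: "fsubspace W" and V: "fsubspace V" "V \<subseteq> W"
    and ip: "sym_form_on W ip" "\<forall>v\<in>W. v \<noteq> (\<lambda>s. 0) \<longrightarrow> 0 < ip v v"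
    and B: "sym_form_on W B" "\<forall>v\<in>W. 0 \<le> B v v"
    and F: "linear_fun_on V F" and \<tau>: "\<tau> > 0" and u0: "u0 \<in> W"
  shows "\<exists>!u. u \<in> W \<and> (\<lambda>s. (1 / \<tau>) *\<^sub>R (u s - u0 s)) \<in> V \<and>
    (\<forall>v\<in>V. ip (\<lambda>s. (1 / \<tau>) *\<^sub>R (u s - u0 s)) v + B u v = F v)"
proof -
  define a where "a = (\<lambda>u v. ip u v + \<tau> * B u v)"
  define l where "l = (\<lambda>v. F v - B u0 v)"
  have linB: "linear_fun_on V (B u)" "linear_fun_on V (ip u)" if "u \<in> W" for u
    using B ip that linear_fun_on_subset[OF _ V(2)] unfolding sym_form_on_def by blast+
  have "sym_form_on V a"
    unfolding sym_form_on_def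
  proof safe
    fix u v assume "u \<in> V" "v \<in> V"
    then show "a u v = a v u" using B ip V unfolding a_def sym_form_on_def by (simp add: subset_iff)
  next
    fix u assume "u \<in> V"
    then have "linear_fun_on V (B u)" "linear_fun_on V (ip u)" using linB V by blast+
    then show "linear_fun_on V (a u)" unfolding a_def linear_fun_on_def by (simp add: algebra_simps)
  qed
  note symA = this
  have pos: "\<forall>v\<in>V. v \<noteq> (\<lambda>s. 0) \<longrightarrow> 0 < a v v"
    unfolding a_def using ip(2) B(2) V \<tau> by (auto simp: subset_iff intro!: add_pos_nonneg)
  have "linear_fun_on V l"
    using F linB[OF u0] unfolding l_def linear_fun_on_def by (simp add: algebra_simps)
  then obtain d where d: "d \<in> V" "\<forall>v\<in>V. a d v = l v"
    using finite_dim_riesz[OF fin(1) V(1) symA pos, of l] fin V linear_fun_on_subset by blast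
  define u where "u = (\<lambda>s. u0 s + \<tau> *\<^sub>R d s)"
  have uW: "u \<in> W" unfolding u_def using fsubspace_lincomb[OF W u0] d V by blast
  have ud: "(\<lambda>s. (1 / \<tau>) *\<^sub>R (u s - u0 s)) = d" unfolding u_def using \<tau> by auto
  have eq: "ip d v + B (\<lambda>s. u0 s + \<tau> *\<^sub>R d s) v = a d v + B u0 v" if "v \<in> V" "d \<in> V" for v d
    using sym_form_on_lincomb(2)[OF W B(1) u0, of d v \<tau>] subsetD[OF V(2)] that unfolding a_def by simp
  show ?thesis
  proof (rule ex1I[of _ u])
    have "ip d v + B u v = F v" if "v \<in> V" for v
      using eq[OF that d(1)] d(2) that unfolding u_def l_def by simp
    then show "u \<in> W \<and> (\<lambda>s. (1 / \<tau>) *\<^sub>R (u s - u0 s)) \<in> V \<and>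
    (\<forall>v\<in>V. ip (\<lambda>s. (1 / \<tau>) *\<^sub>R (u s - u0 s)) v + B u v = F v)"
      using uW d unfolding ud by blast
  next
    fix z assume z: "z \<in> W \<and> (\<lambda>s. (1 / \<tau>) *\<^sub>R (z s - u0 s)) \<in> V \<and>
    (\<forall>v\<in>V. ip (\<lambda>s. (1 / \<tau>) *\<^sub>R (z s - u0 s)) v + B z v = F v)"
    define f where "f = (\<lambda>s. (1 / \<tau>) *\<^sub>R (z s - u0 s))"
    have zf: "z = (\<lambda>s. u0 s + \<tau> *\<^sub>R f s)" unfolding f_def using \<tau> by auto
    have f: "f \<in> V" using z unfolding f_def by blast
    have af: "a f v = l v" if "v \<in> V" for v
    proof -
      have "ip f v + B z v = F v" using z that unfolding f_def by blast
      then show ?thesis using eq[OF that f] unfolding zf l_def by simp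
    qed
    \<comment> \<open>Two solutions have increments representing the same functional, so their
      difference is orthogonal to itself.\<close>
    define g where "g = (\<lambda>s. f s + (-1) *\<^sub>R d s)"
    have g: "g \<in> V" unfolding g_def by (rule fsubspace_lincomb[OF V(1) f d(1)])
    have "a g g = a f g + (-1) * a d g"
      using sym_form_on_lincomb(2)[OF V(1) symA f d(1) g, of "-1"] unfolding g_def .
    then have "a g g = 0" using af[OF g] d g by simp
    then have g0: "g = (\<lambda>s. 0)" using pos g by force
    have "f s = d s" for s using fun_cong[OF g0, of s] unfolding g_def by simp
    then show "z = u" unfolding zf u_def by simp
  qed
qed

lemma fsubspaceI:
  assumes "(\<lambda>s. 0) \<in> V" "\<And>u v a. u \<in> V \<Longrightarrow> v \<in> V \<Longrightarrow> (\<lambda>s. u s + a *\<^sub>R v s) \<in> V"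
  shows "fsubspace V"
  unfolding fsubspace_def
  using assms(1) assms(2)[where a = 1] assms(2)[OF assms(1)] by simp

lemma linear_fun_onI:
  assumes V: "fsubspace V"
    and lin: "\<And>u v a. u \<in> V \<Longrightarrow> v \<in> V \<Longrightarrow> l (\<lambda>s. u s + a *\<^sub>R v s) = l u + a * l v"
  shows "linear_fun_on V l"
proof -
  note z = fsubspaceD(1)[OF V]
  have "l (\<lambda>s. 0) = 0" using lin[OF z z, of 1] by simp
  then show ?thesis
    unfolding linear_fun_on_def using lin[where a = 1] lin[OF z] by simp
qed

lemma sym_form_on_add:
  "sym_form_on V A \<Longrightarrow> sym_form_on V B \<Longrightarrow> sym_form_on V (\<lambda>u v. A u v + B u v)"
  unfolding sym_form_on_def linear_fun_on_def by (simp add: algebra_simps)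

lemma sym_form_on_mult:
  "sym_form_on V A \<Longrightarrow> sym_form_on V (\<lambda>u v. c * A u v)"
  unfolding sym_form_on_def linear_fun_on_def by (simp add: algebra_simps)

lemma inner_product_on_form:
  assumes V: "fsubspace V" and ip: "inner_product_on V ip"
  shows "sym_form_on V ip" "\<forall>v\<in>V. v \<noteq> (\<lambda>s. 0) \<longrightarrow> 0 < ip v v" "\<And>v. v \<in> V \<Longrightarrow> 0 \<le> ip v v"
proof -
  have sym: "ip u v = ip v u" if "u \<in> V" "v \<in> V" for u v
    using ip that unfolding inner_product_on_def by blast
  have add: "ip (\<lambda>s. v s + w s) u = ip v u + ip w u" if "u \<in> V" "v \<in> V" "w \<in> V" for u v w
    using ip that unfolding inner_product_on_def by simp
  have scale: "ip (\<lambda>s. a *\<^sub>R v s) u = a * ip v u" if "u \<in> V" "v \<in> V" for a u v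
    using ip that unfolding inner_product_on_def by simp
  show f: "sym_form_on V ip"
    unfolding sym_form_on_def linear_fun_on_def
  proof (intro conjI ballI allI)
    fix u v w a assume *: "u \<in> V" "v \<in> V" "w \<in> V"
    have "(\<lambda>s. v s + w s) \<in> V" using fsubspaceD(2)[OF V *(2,3)] .
    then show "ip u (\<lambda>s. v s + w s) = ip u v + ip u w"
      using sym[OF *(1)] add[OF *] * by simp
  next
    fix u v a assume *: "u \<in> V" "v \<in> V"
    show "ip u v = ip v u" by (rule sym[OF *])
    have "(\<lambda>s. a *\<^sub>R v s) \<in> V" using fsubspaceD(3)[OF V *(2)] .
    then show "ip u (\<lambda>s. a *\<^sub>R v s) = a * ip u v"
      using sym[OF *(1)] scale[OF *] * by simp
  qed
  show p: "\<forall>v\<in>V. v \<noteq> (\<lambda>s. 0) \<longrightarrow> 0 < ip v v"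
    using ip unfolding inner_product_on_def by blast
  show "0 \<le> ip v v" if v: "v \<in> V" for v
  proof (cases "v = (\<lambda>s. 0)")
    case True
    have "linear_fun_on V (ip v)" using f v unfolding sym_form_on_def by blast
    then show ?thesis using linear_fun_on_zero[OF V] True by (metis order_refl)
  next
    case False
    then show ?thesis using p v by (meson less_imp_le)
  qed
qed

section \<open>Quadratic functionals: derivative and increment\<close>

text \<open>Along a line in \<open>V\<close> the functional is a quadratic polynomial in
  \<open>t\<close>, whose linear coefficient is the polar form. This turns the variational
  derivatives of the penalty into bilinear forms.\<close>

lemma deriv_quadratic:
  assumes V: "fsubspace V" "sym_form_on V B" "u \<in> V" "w \<in> V"
    and P: "\<And>v. v \<in> V \<Longrightarrow> P v = 1 / 2 * B v v"
  shows "deriv (\<lambda>t. P (\<lambda>s. u s + t *\<^sub>R w s)) 0 = B u w"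
proof -
  have "P (\<lambda>s. u s + t *\<^sub>R w s) = 1 / 2 * B u u + t * B u w + 1 / 2 * t\<^sup>2 * B w w" for t
    using P[OF fsubspace_lincomb[OF V(1,3,4)], of t] sym_form_on_square[OF V, of t]
    by (simp add: algebra_simps)
  then have "(\<lambda>t. P (\<lambda>s. u s + t *\<^sub>R w s)) = (\<lambda>t. 1 / 2 * B u u + t * B u w + 1 / 2 * t\<^sup>2 * B w w)"
    by (rule ext)
  moreover have "((\<lambda>t. 1 / 2 * B u u + t * B u w + 1 / 2 * t\<^sup>2 * B w w) has_real_derivative B u w) (at 0)"
    by (auto intro!: derivative_eq_intros)
  ultimately show ?thesis by (simp add: DERIV_imp_deriv)
qed

text \<open>The gain of implicit treatment: the two sides differ by exactly half of
  \<open>\<tau>^2 B d d\<close>, which is nonnegative. No condition on \<open>\<tau>\<close> arises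
  from the quadratic part.\<close>

lemma sym_form_increment_le:
  assumes V: "fsubspace V" "sym_form_on V B" and pos: "\<And>v. v \<in> V \<Longrightarrow> 0 \<le> B v v"
    and u: "u \<in> V" and d: "d \<in> V" and u': "u' = (\<lambda>s. u s + \<tau> *\<^sub>R d s)"
  shows "1 / 2 * B u' u' - 1 / 2 * B u u \<le> \<tau> * B u' d"
proof -
  have "B d u = B u d" using V u d unfolding sym_form_on_def by blast
  moreover have "B u' d = B u d + \<tau> * B d d"
    unfolding u' by (rule sym_form_on_lincomb(2)[OF V u d d])
  moreover have "B u' u' = B u u + 2 * \<tau> * B u d + \<tau>\<^sup>2 * B d d"
    unfolding u' by (rule sym_form_on_square[OF V u d])
  moreover have "0 \<le> \<tau>\<^sup>2 * B d d" using pos[OF d] by simp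
  ultimately show ?thesis by (simp add: power2_eq_square algebra_simps)
qed

section \<open>Taylor remainder of the regularized density\<close>

text \<open>Bound of the first directional derivative: \<open>c1\<close> from
  \<open>\<phi>'\<close>, 8 from the term linear in the quotient \<open>z\<close> of
  \<open>denom\<close>, and \<open>4 (1 + c1)\<close> from the term quadratic in
  \<open>z\<close>.\<close>

definition psi_lip :: "real \<Rightarrow> real" where
  "psi_lip c1 = 5 * c1 + 12"

text \<open>After division by \<open>\<delta>\<close>, a bound from above for the second directional
  derivative: the first summand stems from \<open>\<phi>''\<close>, the second from the completed
  square in \<open>line''\<close>, where \<open>1 / c0\<close> comes from the reciprocal
  denominator.\<close>

definition psi_hess :: "real \<Rightarrow> real \<Rightarrow> real \<Rightarrow> real" where
  "psi_hess c0 c1 c2 = 5 * c2 + 8 * (2 + c1)\<^sup>2 / c0"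

locale regularized =
  fixes \<phi> \<phi>' \<phi>'' :: "real \<Rightarrow> real" and c0 c1 c2 \<delta> :: real
  assumes deriv1: "(\<phi> has_real_derivative \<phi>' x) (at x)"
    and deriv2: "(\<phi>' has_real_derivative \<phi>'' x) (at x)"
    and lower: "c0 * \<delta> \<le> \<phi> x"
    and bound1: "\<bar>\<phi>' x\<bar> \<le> c1" and bound2: "\<bar>\<phi>'' x\<bar> \<le> c2 / \<delta>"
    and pos: "c0 > 0" "c1 > 0" "c2 > 0" "\<delta> > 0"
begin

lemma phi_pos: "\<phi> x > 0"
  using lower[of x] pos by (smt (verit) mult_pos_pos)

text \<open>The derivatives of \<open>psi\<close> involve its fraction only through the reciprocal
  of the denominator and the quotient of \<open>s\<close> by it. The quotient stays in
  \<open>[0, 1]\<close>, so large arguments do no harm; the reciprocal costs one factor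
  \<open>1 / \<delta>\<close>.\<close>

lemma denom:
  assumes "r \<ge> 0" "s \<ge> 0"
  shows "r + s + \<phi> (r - s) > 0" "1 / (r + s + \<phi> (r - s)) \<le> 1 / (c0 * \<delta>)"
    "0 \<le> s / (r + s + \<phi> (r - s))" "s / (r + s + \<phi> (r - s)) \<le> 1"
proof -
  show D: "r + s + \<phi> (r - s) > 0" using assms phi_pos[of "r-s"] by linarith
  show "1 / (r + s + \<phi> (r - s)) \<le> 1 / (c0 * \<delta>)"
    using assms lower[of "r-s"] pos D by (intro divide_left_mono) (auto intro!: mult_pos_pos)
  show "0 \<le> s / (r + s + \<phi> (r - s))" "s / (r + s + \<phi> (r - s)) \<le> 1"
    using assms D phi_pos[of "r-s"] by auto
qed

lemma psi_ge: "r \<ge> 0 \<Longrightarrow> s \<ge> 0 \<Longrightarrow> c0 * \<delta> \<le> psi \<phi> r s"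
  unfolding psi_def using lower[of "r-s"] denom(1)[of r s]
  by (smt (verit) divide_nonneg_pos zero_le_power2)

text \<open>First derivative of \<open>psi\<close> at \<open>(r, s)\<close> in the direction
  \<open>(a, b)\<close>, arranged so that the bounded quotient of \<open>denom\<close>
  appears.\<close>

definition line' :: "real \<Rightarrow> real \<Rightarrow> real \<Rightarrow> real \<Rightarrow> real" where
  "line' a b r s = \<phi>' (r - s) * (a - b) + 8 * (s / (r + s + \<phi> (r - s))) * b
     - 4 * (s / (r + s + \<phi> (r - s)))\<^sup>2 * (a + b + \<phi>' (r - s) * (a - b))"

text \<open>Second derivative in the same direction. With \<open>E\<close> the denominator,
  \<open>E1\<close> and \<open>E2\<close> its first two derivatives and \<open>z = s / E\<close>,
  the fraction \<open>4 s^2 / E\<close> contributes \<open>8 (b - z E1)^2 / E - 4 z^2 E2\<close>,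
  and \<open>E2\<close> is the \<open>\<phi>''\<close> term.\<close>

definition line'' :: "real \<Rightarrow> real \<Rightarrow> real \<Rightarrow> real \<Rightarrow> real" where
  "line'' a b r s = \<phi>'' (r - s) * (a - b)\<^sup>2 * (1 - 4 * (s / (r + s + \<phi> (r - s)))\<^sup>2)
     + 8 * (1 / (r + s + \<phi> (r - s))) *
       (b - (s / (r + s + \<phi> (r - s))) * (a + b + \<phi>' (r - s) * (a - b)))\<^sup>2"

text \<open>Nonnegativity is asked only at the parameter \<open>t\<close> itself: it makes the
  denominator nonzero there, which suffices for a two-sided derivative. Boundary points of the
  quadrant are thereby included.\<close>

lemma psi_line_deriv:
  assumes "r + t * a \<ge> 0" "s + t * b \<ge> 0"
  shows "((\<lambda>t. psi \<phi> (r + t * a) (s + t * b)) has_real_derivative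
      line' a b (r + t * a) (s + t * b)) (at t)"
    "((\<lambda>t. line' a b (r + t * a) (s + t * b)) has_real_derivative
      line'' a b (r + t * a) (s + t * b)) (at t)"
proof -
  define x where "x = (\<lambda>t. (r + t * a) - (s + t * b))"
  define E where "E = (\<lambda>t. (r + t * a) + (s + t * b) + \<phi> (x t))"
  have x: "(x has_real_derivative (a - b)) (at t)"
    unfolding x_def by (auto intro!: derivative_eq_intros)
  note p = DERIV_chain2[OF deriv1 x] and p' = DERIV_chain2[OF deriv2 x]
  have E: "(E has_real_derivative (a + b + \<phi>' (x t) * (a - b))) (at t)"
    unfolding E_def by (rule derivative_eq_intros p refl | simp)+
  have E0: "E t > 0" unfolding E_def x_def using denom(1)[OF assms] by simp
  have s: "((\<lambda>t. s + t * b) has_real_derivative b) (at t)"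
    by (auto intro!: derivative_eq_intros)
  have psi_eq: "(\<lambda>t. psi \<phi> (r + t * a) (s + t * b)) = (\<lambda>t. \<phi> (x t) + 4 * (s + t * b)\<^sup>2 / E t)"
    by (simp add: psi_def x_def E_def)
  have line'_eq: "line' a b (r + t * a) (s + t * b) = \<phi>' (x t) * (a - b) + 8 * ((s + t * b) / E t) * b
     - 4 * ((s + t * b) / E t)\<^sup>2 * (a + b + \<phi>' (x t) * (a - b))" for t
    by (simp add: line'_def x_def E_def)
  have line''_eq: "line'' a b (r + t * a) (s + t * b) = \<phi>'' (x t) * (a - b)\<^sup>2 * (1 - 4 * ((s + t * b) / E t)\<^sup>2)
     + 8 * (1 / E t) * (b - ((s + t * b) / E t) * (a + b + \<phi>' (x t) * (a - b)))\<^sup>2" for t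
    by (simp add: line''_def x_def E_def)
  define e k k' where "e = E t" and "k = \<phi>' (x t)" and "k' = \<phi>'' (x t)"
  have e0: "e > 0" using E0 unfolding e_def .
  show "((\<lambda>t. psi \<phi> (r + t * a) (s + t * b)) has_real_derivative
      line' a b (r + t * a) (s + t * b)) (at t)"
    unfolding psi_eq line'_eq
    by (rule derivative_eq_intros p E s refl | use E0 in simp; fail)+
      (unfold e_def[symmetric] k_def[symmetric], use e0 in \<open>simp add: field_simps power2_eq_square\<close>)
  show "((\<lambda>t. line' a b (r + t * a) (s + t * b)) has_real_derivative
      line'' a b (r + t * a) (s + t * b)) (at t)"
    unfolding line'_eq line''_eq
    by (rule derivative_eq_intros p p' E s refl | use E0 in simp; fail)+
      (unfold e_def[symmetric] k_def[symmetric] k'_def[symmetric],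
        use e0 in \<open>simp add: field_simps power2_eq_square\<close>)
qed

abbreviation "K1 \<equiv> psi_lip c1"
abbreviation "K2 \<equiv> psi_hess c0 c1 c2"

lemma line'_bound:
  assumes "r \<ge> 0" "s \<ge> 0"
  shows "\<bar>line' a b r s\<bar> \<le> K1 * (\<bar>a\<bar> + \<bar>b\<bar>)"
proof -
  define z where "z = s / (r + s + \<phi> (r - s))"
  define n where "n = \<bar>a\<bar> + \<bar>b\<bar>"
  have z: "0 \<le> z" "z \<le> 1" using denom[OF assms] unfolding z_def by auto
  have z2: "0 \<le> z\<^sup>2" "z\<^sup>2 \<le> 1" using z by (auto simp: power_le_one)
  have 1: "\<bar>\<phi>' (r - s) * (a - b)\<bar> \<le> c1 * n"
    unfolding abs_mult n_def using bound1 pos by (intro mult_mono) auto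
  have 2: "\<bar>8 * z * b\<bar> \<le> 8 * n"
  proof -
    have "\<bar>8 * z * b\<bar> = 8 * (z * \<bar>b\<bar>)" using z by (simp add: abs_mult)
    also have "\<dots> \<le> 8 * (1 * n)" unfolding n_def using z by (intro mult_left_mono mult_mono) auto
    finally show ?thesis by simp
  qed
  have 3: "\<bar>4 * z\<^sup>2 * (a + b + \<phi>' (r - s) * (a - b))\<bar> \<le> 4 * ((1 + c1) * n)"
  proof -
    have "\<bar>a + b + \<phi>' (r - s) * (a - b)\<bar> \<le> (1 + c1) * n"
      using 1 unfolding n_def by (auto simp: algebra_simps)
    then have "z\<^sup>2 * \<bar>a + b + \<phi>' (r - s) * (a - b)\<bar> \<le> 1 * ((1 + c1) * n)"
      using z2 by (intro mult_mono) auto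
    then show ?thesis using z2 by (simp add: abs_mult)
  qed
  show ?thesis
    unfolding line'_def z_def[symmetric] n_def[symmetric] psi_lip_def
    using 1 2 3 by (simp add: algebra_simps)
qed

text \<open>Only a bound from above is needed, because the energy estimate requires a one-sided
  remainder.\<close>

lemma line''_bound:
  assumes "r \<ge> 0" "s \<ge> 0"
  shows "line'' a b r s \<le> K2 / \<delta> * (\<bar>a\<bar> + \<bar>b\<bar>)\<^sup>2"
proof -
  define z where "z = s / (r + s + \<phi> (r - s))"
  define n where "n = \<bar>a\<bar> + \<bar>b\<bar>"
  have z: "0 \<le> z" "z \<le> 1" using denom[OF assms] unfolding z_def by auto
  have z2: "0 \<le> z\<^sup>2" "z\<^sup>2 \<le> 1" using z by (auto simp: power_le_one)
  have ab: "(a - b)\<^sup>2 \<le> n\<^sup>2" unfolding n_def by (intro power2_le_iff_abs_le[THEN iffD2]) auto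
  have "\<phi>'' (r - s) * (a - b)\<^sup>2 * (1 - 4 * z\<^sup>2) \<le> \<bar>\<phi>'' (r - s)\<bar> * (a - b)\<^sup>2 * \<bar>1 - 4 * z\<^sup>2\<bar>"
    using abs_ge_self[of "\<phi>'' (r - s) * (a - b)\<^sup>2 * (1 - 4 * z\<^sup>2)"] by (simp add: abs_mult)
  also have "\<dots> \<le> (c2 / \<delta>) * n\<^sup>2 * 5"
  proof -
    have "\<bar>1 - 4 * z\<^sup>2\<bar> \<le> 5" using z2 unfolding abs_le_iff by linarith
    then show ?thesis using ab bound2 pos by (intro mult_mono) auto
  qed
  finally have 1: "\<phi>'' (r - s) * (a - b)\<^sup>2 * (1 - 4 * z\<^sup>2) \<le> 5 * c2 / \<delta> * n\<^sup>2" by (simp add: mult_ac)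
  have p: "\<bar>\<phi>' (r - s) * (a - b)\<bar> \<le> c1 * n"
    unfolding abs_mult n_def using bound1 pos by (intro mult_mono) auto
  have "\<bar>a + b + \<phi>' (r - s) * (a - b)\<bar> \<le> (1 + c1) * n"
    using p unfolding n_def by (auto simp: algebra_simps)
  then have "z * \<bar>a + b + \<phi>' (r - s) * (a - b)\<bar> \<le> 1 * ((1 + c1) * n)"
    using z by (intro mult_mono) auto
  then have "\<bar>z * (a + b + \<phi>' (r - s) * (a - b))\<bar> \<le> (1 + c1) * n" using z by (simp add: abs_mult)
  moreover have "\<bar>b\<bar> \<le> n" "(2 + c1) * n = n + (1 + c1) * n"
    unfolding n_def by (auto simp: algebra_simps)
  ultimately have "\<bar>b - z * (a + b + \<phi>' (r - s) * (a - b))\<bar> \<le> (2 + c1) * n"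
    by linarith
  then have sq: "(b - z * (a + b + \<phi>' (r - s) * (a - b)))\<^sup>2 \<le> ((2 + c1) * n)\<^sup>2"
    using pos by (intro power2_le_iff_abs_le[THEN iffD2]) (auto simp: n_def)
  have "8 * (1 / (r + s + \<phi> (r - s))) * (b - z * (a + b + \<phi>' (r - s) * (a - b)))\<^sup>2
      \<le> 8 * (1 / (c0 * \<delta>)) * ((2 + c1) * n)\<^sup>2"
    using denom[OF assms] sq pos by (intro mult_mono) auto
  also have "\<dots> = 8 * (2 + c1)\<^sup>2 / c0 / \<delta> * n\<^sup>2" by (simp add: power_mult_distrib)
  finally show ?thesis
    unfolding line''_def z_def[symmetric] n_def[symmetric] psi_hess_def
    using 1 by (simp add: add_divide_distrib algebra_simps)
qed

lemma psi_1_line: "r \<ge> 0 \<Longrightarrow> s \<ge> 0 \<Longrightarrow> psi_1 \<phi> r s = line' 1 0 r s"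
  and psi_2_line: "r \<ge> 0 \<Longrightarrow> s \<ge> 0 \<Longrightarrow> psi_2 \<phi> r s = line' 0 1 r s"
proof -
  assume rs: "r \<ge> 0" "s \<ge> 0"
  have "((\<lambda>t. psi \<phi> t s) has_real_derivative line' 1 0 r s) (at r)"
    using psi_line_deriv(1)[of 0 r 1 s 0] rs by simp
  then show "psi_1 \<phi> r s = line' 1 0 r s" unfolding psi_1_def by (rule DERIV_imp_deriv)
  have "((\<lambda>t. psi \<phi> r t) has_real_derivative line' 0 1 r s) (at s)"
    using psi_line_deriv(1)[of r s 0 0 1] rs by simp
  then show "psi_2 \<phi> r s = line' 0 1 r s" unfolding psi_2_def by (rule DERIV_imp_deriv)
qed

lemma line'_split: "line' a b r s = a * line' 1 0 r s + b * line' 0 1 r s"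
  unfolding line'_def by (simp add: algebra_simps)

text \<open>The quadrant is convex, so the whole segment stays where the derivative formulas hold
  and the mean value theorem applies.\<close>

lemma psi_increment:
  assumes "r \<ge> 0" "s \<ge> 0" "r + a \<ge> 0" "s + b \<ge> 0"
  shows "psi \<phi> (r + a) (s + b) - psi \<phi> r s \<le> K1 * (\<bar>a\<bar> + \<bar>b\<bar>)"
    "psi \<phi> (r + a) (s + b) - psi \<phi> r s - psi_1 \<phi> r s * a - psi_2 \<phi> r s * b
       \<le> K2 / \<delta> * (\<bar>a\<bar> + \<bar>b\<bar>)\<^sup>2"
proof -
  have seg: "r + t * a \<ge> 0 \<and> s + t * b \<ge> 0" if "0 \<le> t" "t \<le> 1" for t
  proof -
    have "r + t * a = (1 - t) * r + t * (r + a)" "s + t * b = (1 - t) * s + t * (s + b)"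
      by (auto simp: algebra_simps)
    then show ?thesis using assms that by auto
  qed
  have d1: "((\<lambda>t. psi \<phi> (r + t * a) (s + t * b)) has_real_derivative
      line' a b (r + t * a) (s + t * b)) (at t)" if "0 \<le> t" "t \<le> 1" for t
    using psi_line_deriv(1) seg[OF that] by blast
  have d2: "((\<lambda>t. line' a b (r + t * a) (s + t * b)) has_real_derivative
      line'' a b (r + t * a) (s + t * b)) (at t)" if "0 \<le> t" "t \<le> 1" for t
    using psi_line_deriv(2) seg[OF that] by blast
  obtain z where z: "0 < z" "z < 1" "psi \<phi> (r + 1 * a) (s + 1 * b) - psi \<phi> (r + 0 * a) (s + 0 * b)
      = (1 - 0) * line' a b (r + z * a) (s + z * b)"
    using MVT2[of 0 1, OF _ d1] by auto
  have z': "psi \<phi> (r + a) (s + b) - psi \<phi> r s = line' a b (r + z * a) (s + z * b)"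
    using z(3) by simp
  then show "psi \<phi> (r + a) (s + b) - psi \<phi> r s \<le> K1 * (\<bar>a\<bar> + \<bar>b\<bar>)"
    using line'_bound seg[of z] z by (metis abs_le_D1 less_imp_le)
  \<comment> \<open>The second mean value step runs on \<open>[0, z]\<close> and produces the factor
    \<open>z \<le> 1\<close>; the factor 1/2 of Taylor's formula is given away.\<close>
  have dz: "((\<lambda>t. line' a b (r + t * a) (s + t * b)) has_real_derivative
      line'' a b (r + t * a) (s + t * b)) (at t)" if "0 \<le> t" "t \<le> z" for t
    using d2 that z by force
  obtain x where x: "0 < x" "x < z" "line' a b (r + z * a) (s + z * b) - line' a b (r + 0 * a) (s + 0 * b)
      = (z - 0) * line'' a b (r + x * a) (s + x * b)"
    using MVT2[of 0 z, OF z(1) dz] by auto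
  have K: "0 \<le> K2 / \<delta> * (\<bar>a\<bar> + \<bar>b\<bar>)\<^sup>2" using pos unfolding psi_hess_def by simp
  have "line'' a b (r + x * a) (s + x * b) \<le> K2 / \<delta> * (\<bar>a\<bar> + \<bar>b\<bar>)\<^sup>2"
    using line''_bound seg[of x] x z by force
  then have "z * line'' a b (r + x * a) (s + x * b) \<le> z * (K2 / \<delta> * (\<bar>a\<bar> + \<bar>b\<bar>)\<^sup>2)"
    using z by (intro mult_left_mono) auto
  also have "\<dots> \<le> 1 * (K2 / \<delta> * (\<bar>a\<bar> + \<bar>b\<bar>)\<^sup>2)" using z K by (intro mult_right_mono) auto
  finally have "z * line'' a b (r + x * a) (s + x * b) \<le> K2 / \<delta> * (\<bar>a\<bar> + \<bar>b\<bar>)\<^sup>2" by simp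
  then have "line' a b (r + z * a) (s + z * b) - line' a b r s \<le> K2 / \<delta> * (\<bar>a\<bar> + \<bar>b\<bar>)\<^sup>2"
    using x(3) by simp
  moreover have "line' a b r s = psi_1 \<phi> r s * a + psi_2 \<phi> r s * b"
    using line'_split[of a b r s] psi_1_line psi_2_line assms by simp
  ultimately show "psi \<phi> (r + a) (s + b) - psi \<phi> r s - psi_1 \<phi> r s * a - psi_2 \<phi> r s * b
       \<le> K2 / \<delta> * (\<bar>a\<bar> + \<bar>b\<bar>)\<^sup>2"
    unfolding z' by linarith
qed

text \<open>The Hessian of \<open>psi \<phi> |p|\<^sup>2 |q|\<^sup>2\<close> is only controlled by \<open>(|p|\<^sup>2 + |q|\<^sup>2) / \<delta>\<close>.  An increment
  that dominates \<open>(p, q)\<close> is therefore treated by the Lipschitz bound instead, so that the final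
  point does not enter the estimate.\<close>

lemma psi_remainder:
  fixes p q dp dq :: "'a::real_inner"
  defines "r \<equiv> (norm p)\<^sup>2" and "s \<equiv> (norm q)\<^sup>2"
  shows "1/2 * psi \<phi> ((norm (p + dp))\<^sup>2) ((norm (q + dq))\<^sup>2) - 1/2 * psi \<phi> r s
      - psi_1 \<phi> r s * (p \<bullet> dp) - psi_2 \<phi> r s * (q \<bullet> dq)
    \<le> (3 * K1 + 5 * K2) * (1 + (r + s) / \<delta>) * ((norm dp)\<^sup>2 + (norm dq)\<^sup>2)"
proof -
  define d where "d = (norm dp)\<^sup>2 + (norm dq)\<^sup>2"
  define M where "M = r + s"
  \<comment> \<open>\<open>a\<close> and \<open>b\<close> are the increments of the squared norms
    \<open>r\<close> and \<open>s\<close>; \<open>X\<close> collects the Cauchy-Schwarz bounds of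
    their linear parts.\<close>
  define a where "a = 2 * (p \<bullet> dp) + (norm dp)\<^sup>2"
  define b where "b = 2 * (q \<bullet> dq) + (norm dq)\<^sup>2"
  define X where "X = norm p * norm dp + norm q * norm dq"
  have ra: "(norm (p + dp))\<^sup>2 = r + a" and sb: "(norm (q + dq))\<^sup>2 = s + b"
    unfolding r_def s_def a_def b_def power2_norm_eq_inner
    by (auto simp: inner_add inner_commute)
  have nn: "r \<ge> 0" "s \<ge> 0" "r + a \<ge> 0" "s + b \<ge> 0" "d \<ge> 0" "M \<ge> 0" "X \<ge> 0"
    unfolding M_def d_def X_def using ra sb
    by (simp_all add: r_def s_def) (metis zero_le_power2)+
  have KK: "K1 \<ge> 0" "K2 \<ge> 0" using pos unfolding psi_lip_def psi_hess_def by auto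
  have cs: "\<bar>p \<bullet> dp\<bar> \<le> norm p * norm dp" "\<bar>q \<bullet> dq\<bar> \<le> norm q * norm dq"
    by (rule Cauchy_Schwarz_ineq2)+
  have n: "\<bar>a\<bar> + \<bar>b\<bar> \<le> 2 * X + d"
    unfolding a_def b_def X_def d_def using cs
    by (smt (verit) zero_le_power2)
  have XM: "2 * X \<le> M + d"
    unfolding X_def M_def d_def r_def s_def
    using sum_squares_bound[of "norm p" "norm dp"] sum_squares_bound[of "norm q" "norm dq"] by simp
  \<comment> \<open>Lagrange's identity for the vectors \<open>(|p|, |q|)\<close> and
    \<open>(|dp|, |dq|)\<close>.\<close>
  have X2: "X\<^sup>2 \<le> M * d"
  proof -
    have "M * d - X\<^sup>2 = (norm p * norm dq - norm q * norm dp)\<^sup>2"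
      unfolding X_def M_def d_def r_def s_def by (simp add: power2_eq_square algebra_simps)
    then show ?thesis by (smt (verit) zero_le_power2)
  qed
  have psi1: "\<bar>psi_1 \<phi> r s\<bar> \<le> K1" "\<bar>psi_2 \<phi> r s\<bar> \<le> K1"
    using line'_bound[OF nn(1,2), of 1 0] line'_bound[OF nn(1,2), of 0 1]
      psi_1_line[OF nn(1,2)] psi_2_line[OF nn(1,2)] by auto
  have Md: "0 \<le> M * d / \<delta>" using nn pos by auto
  have goal: "1/2 * psi \<phi> (r + a) (s + b) - 1/2 * psi \<phi> r s
      - psi_1 \<phi> r s * (p \<bullet> dp) - psi_2 \<phi> r s * (q \<bullet> dq) \<le> 3 * (K1 * d) + 5 * (K2 * (M * d / \<delta>))"
  proof (cases "d \<le> M")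
    \<comment> \<open>For \<open>d \<le> M\<close> both \<open>X^2\<close> and \<open>d^2\<close>
      are at most \<open>M d\<close>, so the quadratic remainder has the desired form.\<close>
    case True
    have "(\<bar>a\<bar> + \<bar>b\<bar>)\<^sup>2 \<le> (2 * X + d)\<^sup>2" using n by (intro power_mono) auto
    also have "\<dots> = 4 * X\<^sup>2 + 4 * (X * d) + d\<^sup>2" by (simp add: power2_eq_square algebra_simps)
    also have "\<dots> \<le> 6 * X\<^sup>2 + 3 * d\<^sup>2" using sum_squares_bound[of X d] by simp
    also have "\<dots> \<le> 9 * (M * d)"
      using X2 mult_right_mono[OF True nn(5)] by (simp add: power2_eq_square)
    finally have n2: "(\<bar>a\<bar> + \<bar>b\<bar>)\<^sup>2 \<le> 9 * (M * d)" .
    have "K2 / \<delta> * (\<bar>a\<bar> + \<bar>b\<bar>)\<^sup>2 \<le> 9 * (K2 * (M * d / \<delta>))"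
      using mult_left_mono[OF n2, of "K2 / \<delta>"] KK pos by (simp add: mult_ac)
    then have "psi \<phi> (r + a) (s + b) - psi \<phi> r s - psi_1 \<phi> r s * a - psi_2 \<phi> r s * b
       \<le> 9 * (K2 * (M * d / \<delta>))"
      using psi_increment(2)[OF nn(1-4)] by linarith
    \<comment> \<open>The squares \<open>|dp|^2\<close> and \<open>|dq|^2\<close> belong to
      \<open>a\<close> and \<open>b\<close> but not to the linear terms of the claim; bounded first
      derivatives absorb them.\<close>
    moreover have "psi_1 \<phi> r s * (norm dp)\<^sup>2 + psi_2 \<phi> r s * (norm dq)\<^sup>2 \<le> K1 * d"
      unfolding d_def distrib_left using psi1 by (intro add_mono mult_right_mono) auto
    moreover have "psi_1 \<phi> r s * a + psi_2 \<phi> r s * b = 2 * (psi_1 \<phi> r s * (p \<bullet> dp)) + 2 * (psi_2 \<phi> r s * (q \<bullet> dq))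
       + (psi_1 \<phi> r s * (norm dp)\<^sup>2 + psi_2 \<phi> r s * (norm dq)\<^sup>2)"
      unfolding a_def b_def by (simp add: algebra_simps)
    moreover have "0 \<le> K1 * d" "0 \<le> K2 * (M * d / \<delta>)"
      using KK nn mult_nonneg_nonneg[OF KK(2) Md] by auto
    moreover have "1/2 * x - 1/2 * x' - P - Q \<le> 3 * Y + 5 * Z"
      if "x - x' - A - B \<le> 9 * Z" "W \<le> Y" "A + B = 2 * P + 2 * Q + W" "0 \<le> Y" "0 \<le> Z"
      for x x' A B P Q W Y Z :: real
      using that by linarith
    ultimately show ?thesis by blast
  next
    \<comment> \<open>For \<open>M < d\<close> also \<open>X \<le> d\<close>, hence increment and
      linear terms are each of order \<open>d\<close> by the Lipschitz bound.\<close>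
    case False
    have n3: "\<bar>a\<bar> + \<bar>b\<bar> \<le> 3 * d" using n XM False by linarith
    have "psi \<phi> (r + a) (s + b) - psi \<phi> r s \<le> K1 * (3 * d)"
      using psi_increment(1)[OF nn(1-4)] mult_left_mono[OF n3 KK(1)] by linarith
    moreover have "\<bar>psi_1 \<phi> r s * (p \<bullet> dp)\<bar> + \<bar>psi_2 \<phi> r s * (q \<bullet> dq)\<bar> \<le> K1 * d"
    proof -
      have "\<bar>psi_1 \<phi> r s * (p \<bullet> dp)\<bar> + \<bar>psi_2 \<phi> r s * (q \<bullet> dq)\<bar> \<le> K1 * (norm p * norm dp) + K1 * (norm q * norm dq)"
        unfolding abs_mult using psi1 cs KK by (intro add_mono mult_mono) auto
      also have "\<dots> = K1 * X" unfolding X_def by (simp add: algebra_simps)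
      also have "\<dots> \<le> K1 * d" using XM False KK by (intro mult_left_mono) auto
      finally show ?thesis .
    qed
    moreover have "0 \<le> K1 * d" "0 \<le> K2 * (M * d / \<delta>)"
      using KK nn mult_nonneg_nonneg[OF KK(2) Md] by auto
    ultimately show ?thesis by linarith
  qed
  \<comment> \<open>Adding nonnegative cross terms gives the product form in which a single factor
    depends on the old point.\<close>
  also have "3 * (K1 * d) + 5 * (K2 * (M * d / \<delta>)) \<le> (3 * K1 + 5 * K2) * (1 + M / \<delta>) * d"
  proof -
    have "(3 * K1 + 5 * K2) * (1 + M / \<delta>) * d = 3 * (K1 * d) + 5 * (K2 * (M * d / \<delta>))
        + 5 * (K2 * d) + 3 * (K1 * (M * d / \<delta>))"
      by (simp add: algebra_simps)
    then show ?thesis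
      using mult_nonneg_nonneg[OF KK(2) nn(5)] mult_nonneg_nonneg[OF KK(1) Md] by linarith
  qed
  finally show ?thesis unfolding ra sb M_def d_def .
qed

end

section \<open>Functions on a partition\<close>

lemma has_vector_derivative_cart:
  fixes f :: "real \<Rightarrow> real ^ 'n"
  assumes "\<And>i. ((\<lambda>u. f u $ i) has_vector_derivative f' $ i) (at x within S)"
  shows "(f has_vector_derivative f') (at x within S)"
  unfolding has_vector_derivative_def
proof (subst has_derivative_componentwise_within, intro ballI)
  fix b :: "real ^ 'n" assume "b \<in> Basis"
  then obtain i where b: "b = axis i 1" by (auto simp: Basis_vec_def)
  show "((\<lambda>x. f x \<bullet> b) has_derivative (\<lambda>x. x *\<^sub>R f' \<bullet> b)) (at x within S)"
    using assms[of i] unfolding has_vector_derivative_def b by (simp add: inner_axis)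
qed

text \<open>Integrate \<open>|g - v|^2 \<ge> 0\<close>, where \<open>v\<close> is the mean value of
  \<open>g\<close>.\<close>

lemma norm_integral_square_le:
  fixes g :: "real \<Rightarrow> 'a::euclidean_space"
  assumes "a \<le> b" "g integrable_on {a..b}" "(\<lambda>u. (norm (g u))\<^sup>2) integrable_on {a..b}"
  shows "(norm (integral {a..b} g))\<^sup>2 \<le> (b - a) * integral {a..b} (\<lambda>u. (norm (g u))\<^sup>2)"
proof (cases "a = b")
  case False
  then have ab: "a < b" using assms by simp
  define I where "I = integral {a..b} g"
  define v where "v = (1 / (b - a)) *\<^sub>R I"
  have 1: "((\<lambda>u. g u \<bullet> v) has_integral I \<bullet> v) {a..b}"
    unfolding I_def
    using has_integral_linear[OF integrable_integral[OF assms(2)] bounded_linear_inner_left[of v]]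
    by (simp add: o_def)
  have c: "((\<lambda>u. (norm v)\<^sup>2) has_integral (b - a) * (norm v)\<^sup>2) {a..b}"
    using has_integral_const_real[of "(norm v)\<^sup>2" a b] ab by simp
  have "((\<lambda>u. (norm (g u))\<^sup>2 - 2 * (g u \<bullet> v) + (norm v)\<^sup>2) has_integral
      (integral {a..b} (\<lambda>u. (norm (g u))\<^sup>2) - 2 * (I \<bullet> v) + (b - a) * (norm v)\<^sup>2)) {a..b}"
    by (intro has_integral_add has_integral_diff has_integral_mult_right 1 c
        integrable_integral assms)
  moreover have "(norm (g u))\<^sup>2 - 2 * (g u \<bullet> v) + (norm v)\<^sup>2 = (norm (g u - v))\<^sup>2" for u
    unfolding power2_norm_eq_inner by (simp add: inner_diff inner_commute)
  ultimately have "0 \<le> integral {a..b} (\<lambda>u. (norm (g u))\<^sup>2) - 2 * (I \<bullet> v) + (b - a) * (norm v)\<^sup>2"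
    using ab by (simp add: has_integral_nonneg)
  moreover have "I \<bullet> v = (norm I)\<^sup>2 / (b - a)" "(b - a) * (norm v)\<^sup>2 = (norm I)\<^sup>2 / (b - a)"
    using ab unfolding v_def
    by (simp add: power2_norm_eq_inner, simp add: power_divide, simp add: power2_eq_square)
  ultimately have "(norm I)\<^sup>2 / (b - a) \<le> integral {a..b} (\<lambda>u. (norm (g u))\<^sup>2)" by simp
  then show ?thesis unfolding I_def using ab by (simp add: field_simps)
qed simp

lemma poly_degree_le_1:
  fixes q :: "'a::comm_ring_1 poly"
  assumes "degree q \<le> 1"
  shows "q = [:coeff q 0, coeff q 1:]"
proof (rule poly_eqI)
  fix n
  show "coeff q n = coeff [:coeff q 0, coeff q 1:] n"
  proof (cases "n \<le> 1")
    case True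
    then have "n = 0 \<or> n = 1" by auto
    then show ?thesis by auto
  next
    case False
    then show ?thesis using assms by (auto simp: coeff_eq_0 coeff_pCons split: nat.splits)
  qed
qed

lemma poly_eq_0_if_many_zeros:
  fixes q :: "'a::{comm_ring_1,ring_no_zero_divisors} poly"
  assumes "degree q \<le> p" "inj_on x {..p}" "\<And>i. i \<le> p \<Longrightarrow> poly q (x i) = 0"
  shows "q = 0"
proof (rule ccontr)
  assume q: "q \<noteq> 0"
  have "p + 1 = card (x ` {..p})" using assms(2) by (simp add: card_image)
  also have "\<dots> \<le> card {z. poly q z = 0}"
    using assms(3) poly_roots_finite[OF q] by (intro card_mono) auto
  also have "\<dots> \<le> degree q" by (rule card_poly_roots_bound[OF q])
  finally show False using assms(1) by simp
qed

locale mesh_partition =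
  fixes m :: mesh and L :: real
  assumes part: "is_partition L m"
begin

abbreviation N where "N \<equiv> nel m"
abbreviation X where "X \<equiv> node m"
abbreviation l where "l \<equiv> elem_length m"

lemma N_pos: "0 < N" and node_0: "X 0 = 0" and node_N: "X N = L"
  and node_Suc: "j < N \<Longrightarrow> X j < X (Suc j)"
  using part unfolding is_partition_def by auto

lemma node_strict: "i < j \<Longrightarrow> j \<le> N \<Longrightarrow> X i < X j"
proof (induction j)
  case (Suc j)
  then show ?case using node_Suc[of j] by (cases "i = j") fastforce+
qed simp

lemma node_mono: "i \<le> j \<Longrightarrow> j \<le> N \<Longrightarrow> X i \<le> X j"
  using node_strict[of i j] by (cases "i = j") auto

lemma len_eq: "len m = L" unfolding len_def by (rule node_N)

lemma dom_eq: "dom m = {0..L}" unfolding dom_def len_eq ..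

lemma L_pos: "0 < L" using node_strict[of 0 N] N_pos node_0 node_N by simp

lemma node_in_dom: "j \<le> N \<Longrightarrow> X j \<in> dom m"
  using node_mono[of 0 j] node_mono[of j N] node_0 node_N unfolding dom_eq by auto

lemma elem_length_pos: "j \<in> {1..N} \<Longrightarrow> 0 < l j"
  unfolding elem_length_def using node_strict[of "j - 1" j] by auto

lemma elem_subset: "j \<in> {1..N} \<Longrightarrow> elem m j \<subseteq> dom m"
  using node_in_dom[of j] node_in_dom[of "j - 1"] unfolding elem_def dom_eq by force

lemma elem_of_eq:
  assumes "j \<in> {1..N}" "X (j - 1) < u" "u \<le> X j"
  shows "elem_of m u = j"
  unfolding elem_of_def
proof (rule Least_equality)
  show "1 \<le> j \<and> u \<le> X j" using assms by simp
  fix i assume i: "1 \<le> i \<and> u \<le> X i"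
  show "j \<le> i"
  proof (rule ccontr)
    assume "\<not> j \<le> i"
    then have "X i \<le> X (j - 1)" using assms by (intro node_mono) auto
    then show False using i assms by simp
  qed
qed

lemma dom_elem:
  assumes "u \<in> dom m"
  obtains j where "j \<in> {1..N}" "u \<in> elem m j"
proof -
  define j where "j = (LEAST j. 1 \<le> j \<and> u \<le> X j)"
  have "1 \<le> N \<and> u \<le> X N" using assms N_pos node_N unfolding dom_eq by simp
  note j = LeastI[of "\<lambda>j. 1 \<le> j \<and> u \<le> X j", OF this, folded j_def]
    and jN = Least_le[of "\<lambda>j. 1 \<le> j \<and> u \<le> X j", OF this, folded j_def]
  have "X (j - 1) \<le> u"
  proof (cases "j = 1")
    case True
    then show ?thesis using assms node_0 unfolding dom_eq by simp
  next
    case False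
    then have "\<not> (1 \<le> j - 1 \<and> u \<le> X (j - 1))"
      using j not_less_Least[of "j - 1" "\<lambda>j. 1 \<le> j \<and> u \<le> X j"] unfolding j_def[symmetric] by simp
    moreover have "1 \<le> j - 1" using j False by linarith
    ultimately show ?thesis by linarith
  qed
  then show ?thesis using that[of j] j jN unfolding elem_def by simp
qed

lemma off_nodes_elem:
  assumes "u \<in> dom m - X ` {..N}"
  obtains j where "j \<in> {1..N}" "X (j - 1) < u" "u < X j"
proof -
  obtain j where j: "j \<in> {1..N}" "u \<in> elem m j" using assms dom_elem by blast
  have "u \<noteq> X j" "u \<noteq> X (j - 1)" using assms j by auto
  then show ?thesis using that[of j] j unfolding elem_def by auto
qed

lemma interior_elem: "X (j - 1) < u \<Longrightarrow> u < X j \<Longrightarrow> u \<in> elem m j"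
  unfolding elem_def by simp

lemma sum_elem_length: "(\<Sum>j = 1..N. l j) = L"
proof -
  have "(\<Sum>j = 1..n. l j) = X n - X 0" for n
    by (induction n) (auto simp: elem_length_def)
  then show ?thesis using node_0 node_N by simp
qed

lemma elem_length_le_mesh_size: "j \<in> {1..N} \<Longrightarrow> l j \<le> mesh_size m"
  unfolding mesh_size_def by (intro Max_ge) auto

lemma mesh_size_pos: "0 < mesh_size m"
  using elem_length_le_mesh_size[of 1] elem_length_pos[of 1] N_pos by force

lemma mesh_size_le: "mesh_size m \<le> L"
proof -
  have "l j \<le> L" if "j \<in> {1..N}" for j
    using that sum_elem_length elem_length_pos member_le_sum[of j "{1..N}" l] by force
  then show ?thesis unfolding mesh_size_def using N_pos by (subst Max_le_iff) auto
qed

subsection \<open>Integration over the partition\<close>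

lemma has_integral_elems:
  fixes f :: "real \<Rightarrow> 'a::banach"
  assumes "\<And>j. j \<in> {1..N} \<Longrightarrow> (f has_integral I j) (elem m j)"
  shows "(f has_integral (\<Sum>j = 1..N. I j)) (dom m)"
proof -
  have "n \<le> N \<Longrightarrow> (f has_integral (\<Sum>j = 1..n. I j)) {X 0..X n}" for n
  proof (induction n)
    case (Suc n)
    then show ?case
      using has_integral_combine[of "X 0" "X n" "X (Suc n)" f "\<Sum>j = 1..n. I j" "I (Suc n)"]
        assms[of "Suc n"] node_mono[of 0 n] node_mono[of n "Suc n"] unfolding elem_def by simp
  qed (simp add: has_integral_refl)
  then show ?thesis unfolding dom_eq using node_0 node_N by force
qed

lemma has_integral_elem_cong:
  assumes "(g has_integral I) (elem m j)" "\<And>u. X (j - 1) < u \<Longrightarrow> u < X j \<Longrightarrow> f u = g u"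
  shows "(f has_integral I) (elem m j)"
  using assms
  by (intro has_integral_spike_finite[of "{X (j - 1), X j}" "elem m j" f g]) (auto simp: elem_def)

lemma has_integral_piecewise_const:
  fixes f :: "real \<Rightarrow> 'a::banach"
  assumes "\<And>j u. j \<in> {1..N} \<Longrightarrow> X (j - 1) < u \<Longrightarrow> u < X j \<Longrightarrow> f u = c j"
  shows "(f has_integral (\<Sum>j = 1..N. l j *\<^sub>R c j)) (dom m)"
proof (rule has_integral_elems)
  fix j assume j: "j \<in> {1..N}"
  have "((\<lambda>u. c j) has_integral l j *\<^sub>R c j) (elem m j)"
    using has_integral_const_real[of "c j" "X (j - 1)" "X j"] elem_length_pos[OF j]
    unfolding elem_def elem_length_def by simp
  then show "(f has_integral l j *\<^sub>R c j) (elem m j)"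
    by (rule has_integral_elem_cong) (use assms[OF j] in auto)
qed

text \<open>Piecewise continuity up to the ends of each element, with arbitrary values at the nodes,
  because second derivatives of splines and first derivatives of \<open>Bh\<close> functions have
  unspecified values at kinks.\<close>

definition pc :: "(real \<Rightarrow> 'a::topological_space) \<Rightarrow> bool" where
  "pc f \<longleftrightarrow> (\<forall>j\<in>{1..N}. \<exists>g. continuous_on (elem m j) g \<and>
     (\<forall>u. X (j - 1) < u \<longrightarrow> u < X j \<longrightarrow> f u = g u))"

lemma pc_integrable_elem:
  fixes f :: "real \<Rightarrow> 'a::banach"
  assumes "pc f" "j \<in> {1..N}"
  shows "f integrable_on elem m j"
proof -
  obtain g where g: "continuous_on (elem m j) g" "\<And>u. X (j - 1) < u \<Longrightarrow> u < X j \<Longrightarrow> f u = g u"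
    using assms unfolding pc_def by blast
  have "(g has_integral integral (elem m j) g) (elem m j)"
    using g(1) integrable_continuous_real unfolding elem_def by blast
  from has_integral_elem_cong[OF this g(2)] show ?thesis by blast
qed

lemma integral_elems:
  fixes f :: "real \<Rightarrow> 'a::banach"
  assumes "pc f"
  shows "integral (dom m) f = (\<Sum>j = 1..N. integral (elem m j) f)"
  by (intro integral_unique has_integral_elems integrable_integral pc_integrable_elem[OF assms])

lemma pc_integrable:
  fixes f :: "real \<Rightarrow> 'a::banach"
  assumes "pc f"
  shows "f integrable_on dom m"
  using has_integral_elems[OF integrable_integral[OF pc_integrable_elem[OF assms]]] by blast

lemma pc_compose2:
  assumes "pc f" "pc g"
    "\<And>(S :: real set) f g. continuous_on S f \<Longrightarrow> continuous_on S g \<Longrightarrow> continuous_on S (\<lambda>u. h (f u) (g u))"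
  shows "pc (\<lambda>u. h (f u) (g u))"
  unfolding pc_def
proof
  fix j assume j: "j \<in> {1..N}"
  obtain f' where f: "continuous_on (elem m j) f'" "\<And>u. X (j - 1) < u \<Longrightarrow> u < X j \<Longrightarrow> f u = f' u"
    using assms(1) j unfolding pc_def by blast
  obtain g' where g: "continuous_on (elem m j) g'" "\<And>u. X (j - 1) < u \<Longrightarrow> u < X j \<Longrightarrow> g u = g' u"
    using assms(2) j unfolding pc_def by blast
  show "\<exists>k. continuous_on (elem m j) k \<and>
      (\<forall>u. X (j - 1) < u \<longrightarrow> u < X j \<longrightarrow> h (f u) (g u) = k u)"
    using assms(3)[OF f(1) g(1)] f(2) g(2) by (intro exI[of _ "\<lambda>u. h (f' u) (g' u)"]) simp
qed

lemma pc_continuous: "continuous_on (dom m) f \<Longrightarrow> pc f"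
  unfolding pc_def using continuous_on_subset elem_subset by blast

lemma pc_inner:
  fixes f g :: "real \<Rightarrow> 'a::real_inner"
  shows "pc f \<Longrightarrow> pc g \<Longrightarrow> pc (\<lambda>u. f u \<bullet> g u)"
  by (rule pc_compose2) (auto intro: continuous_on_inner)

lemma integral_cong_off_nodes:
  assumes "\<And>u. u \<in> dom m - X ` {..N} \<Longrightarrow> f u = g u"
  shows "integral (dom m) f = integral (dom m) g"
  by (rule integral_spike[of "X ` {..N}"]) (use assms in \<open>auto simp: negligible_finite\<close>)

lemma L2_inner_cong:
  assumes "\<And>u. u \<in> dom m - X ` {..N} \<Longrightarrow> f u = f' u"
    "\<And>u. u \<in> dom m - X ` {..N} \<Longrightarrow> g u = g' u"
  shows "L2_inner m f g = L2_inner m f' g'"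
  unfolding L2_inner_def by (rule integral_cong_off_nodes) (use assms in simp)

lemma L2_inner_commute: "L2_inner m f g = L2_inner m g f"
  unfolding L2_inner_def by (simp add: inner_commute)

lemma L2_inner_add_right:
  fixes f g h :: "real \<Rightarrow> 'a::real_inner"
  assumes "pc f" "pc g" "pc h"
  shows "L2_inner m f (\<lambda>u. g u + h u) = L2_inner m f g + L2_inner m f h"
  unfolding L2_inner_def inner_add_right
  by (rule integral_add) (intro pc_integrable pc_inner assms)+

lemma L2_inner_scaleR_right: "L2_inner m f (\<lambda>u. a *\<^sub>R g u) = a * L2_inner m f g"
  unfolding L2_inner_def by simp

lemma L2_inner_nonneg: "pc f \<Longrightarrow> 0 \<le> L2_inner m f f"
  unfolding L2_inner_def by (intro integral_nonneg pc_integrable pc_inner) auto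

lemma L2_norm_square: "pc f \<Longrightarrow> (L2_norm m f)\<^sup>2 = L2_inner m f f"
  unfolding L2_norm_def using L2_inner_nonneg by simp

lemma L2_norm_square_integral: "pc f \<Longrightarrow> (L2_norm m f)\<^sup>2 = integral (dom m) (\<lambda>u. (norm (f u))\<^sup>2)"
  by (simp add: L2_norm_square L2_inner_def power2_norm_eq_inner)

text \<open>Expand \<open>|f - g|^2 \<ge> 0\<close>. This is the weakened parallelogram law that
  \<open>finite_dim_quadratic_bound\<close> asks of \<open>Q\<close>.\<close>

lemma L2_inner_add_le:
  fixes f g :: "real \<Rightarrow> 'a::real_inner"
  assumes "pc f" "pc g"
  shows "L2_inner m (\<lambda>u. f u + g u) (\<lambda>u. f u + g u) \<le> 2 * L2_inner m f f + 2 * L2_inner m g g"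
proof -
  have sum: "pc (\<lambda>u. f u + g u)" using assms by (rule pc_compose2) (auto intro: continuous_on_add)
  have "L2_inner m (\<lambda>u. f u + g u) (\<lambda>u. f u + g u)
      \<le> integral (dom m) (\<lambda>u. 2 * (f u \<bullet> f u) + 2 * (g u \<bullet> g u))"
    unfolding L2_inner_def
  proof (rule integral_le)
    show "(\<lambda>u. (f u + g u) \<bullet> (f u + g u)) integrable_on dom m"
      by (intro pc_integrable pc_inner sum)
    show "(\<lambda>u. 2 * (f u \<bullet> f u) + 2 * (g u \<bullet> g u)) integrable_on dom m"
      by (intro integrable_add integrable_on_mult_right pc_integrable pc_inner assms)
    fix u
    have "0 \<le> (f u - g u) \<bullet> (f u - g u)" by simp
    then show "(f u + g u) \<bullet> (f u + g u) \<le> 2 * (f u \<bullet> f u) + 2 * (g u \<bullet> g u)"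
      by (simp add: inner_add inner_diff inner_commute)
  qed
  also have "\<dots> = 2 * L2_inner m f f + 2 * L2_inner m g g"
    unfolding L2_inner_def
    by (subst integral_add) (auto intro!: integrable_on_mult_right pc_integrable pc_inner assms)
  finally show ?thesis .
qed

subsection \<open>Piecewise polynomial vector fields\<close>

text \<open>Neighbouring closed elements share a node, so continuity is implied. The degree is left
  open in order to treat \<open>b\<close> and \<open>y'\<close> alike.\<close>

definition pwp :: "(real \<Rightarrow> vec3) \<Rightarrow> bool" where
  "pwp f \<longleftrightarrow> (\<forall>j\<in>{1..N}. \<exists>q. \<forall>u\<in>elem m j. f u = (\<chi> i. poly (q i) u))"

text \<open>The mean of the derivative over an element: \<open>\<A> y''\<close> for
  \<open>f = y'\<close>, and the constant \<open>b'\<close> for \<open>f = b\<close> in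
  \<open>Bh\<close>. All values entering \<open>psi\<close> are slopes.\<close>

definition slope :: "(real \<Rightarrow> vec3) \<Rightarrow> nat \<Rightarrow> vec3" where
  "slope f j = (1 / l j) *\<^sub>R (f (X j) - f (X (j - 1)))"

lemma pwp_continuous:
  assumes "pwp f"
  shows "continuous_on (dom m) f"
proof -
  have "continuous_on (elem m j) f" if j: "j \<in> {1..N}" for j
  proof -
    obtain q where "\<forall>u\<in>elem m j. f u = (\<chi> i. poly (q i) u)" using assms j unfolding pwp_def by blast
    moreover have "continuous_on (elem m j) (\<lambda>u. \<chi> i. poly (q i) u)"
      by (intro continuous_on_vec_lambda continuous_on_poly continuous_on_id)
    ultimately show ?thesis by (simp cong: continuous_on_cong)
  qed
  then have "continuous_on (\<Union>j\<in>{1..N}. elem m j) f"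
    by (intro continuous_on_closed_Union) (auto simp: elem_def)
  moreover have "(\<Union>j\<in>{1..N}. elem m j) = dom m" using elem_subset dom_elem by blast
  ultimately show ?thesis by simp
qed

lemma pwp_pc: "pwp f \<Longrightarrow> pc f"
  by (intro pc_continuous pwp_continuous)

lemma D_at_interior:
  assumes "j \<in> {1..N}" "X (j - 1) < u" "u < X j" "(f has_vector_derivative f') (at u)"
  shows "D m f u = f'"
proof -
  have "u \<in> {0..L}" using interior_elem[OF assms(2,3)] elem_subset[OF assms(1)] dom_eq by auto
  then show ?thesis
    unfolding D_def dom_eq using L_pos by (intro vector_derivative_at_within_ivl[OF assms(4)]) auto
qed

lemma pwp_has_derivative:
  assumes j: "j \<in> {1..N}" "X (j - 1) < u" "u < X j" and q: "\<forall>u\<in>elem m j. f u = (\<chi> i. poly (q i) u)"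
  shows "(f has_vector_derivative (\<chi> i. poly (pderiv (q i)) u)) (at u)"
proof -
  have "((\<lambda>u. \<chi> i. poly (q i) u) has_vector_derivative (\<chi> i. poly (pderiv (q i)) u)) (at u)"
    by (rule has_vector_derivative_cart)
      (simp add: poly_DERIV flip: has_real_derivative_iff_has_vector_derivative)
  then show ?thesis
    by (rule has_vector_derivative_transform_within_open[of _ _ _ "{X (j - 1)<..<X j}"])
      (use j q in \<open>auto simp: elem_def\<close>)
qed

lemma pwp_D:
  assumes "pwp f" "u \<in> dom m - X ` {..N}"
  shows "(f has_vector_derivative D m f u) (at u)"
proof -
  obtain j where j: "j \<in> {1..N}" "X (j - 1) < u" "u < X j" using off_nodes_elem[OF assms(2)] .
  obtain q where "\<forall>u\<in>elem m j. f u = (\<chi> i. poly (q i) u)" using assms j unfolding pwp_def by blast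
  note d = pwp_has_derivative[OF j this]
  show ?thesis using d D_at_interior[OF j d] by simp
qed

lemma pwp_D_pc:
  assumes "pwp f"
  shows "pc (D m f)"
  unfolding pc_def
proof
  fix j assume j: "j \<in> {1..N}"
  then obtain q where q: "\<forall>u\<in>elem m j. f u = (\<chi> i. poly (q i) u)" using assms unfolding pwp_def by blast
  have "continuous_on (elem m j) (\<lambda>u. \<chi> i. poly (pderiv (q i)) u)"
    by (intro continuous_on_vec_lambda continuous_on_poly continuous_on_id)
  then show "\<exists>g. continuous_on (elem m j) g \<and> (\<forall>u. X (j - 1) < u \<longrightarrow> u < X j \<longrightarrow> D m f u = g u)"
    using D_at_interior[OF j _ _ pwp_has_derivative[OF j _ _ q]] by blast
qed

lemma pwp_D_lincomb:
  assumes "pwp f" "pwp g" "u \<in> dom m - X ` {..N}"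
  shows "D m (\<lambda>u. f u + a *\<^sub>R g u) u = D m f u + a *\<^sub>R D m g u"
proof -
  obtain j where j: "j \<in> {1..N}" "X (j - 1) < u" "u < X j" using off_nodes_elem[OF assms(3)] .
  have "((\<lambda>u. f u + a *\<^sub>R g u) has_vector_derivative (D m f u + a *\<^sub>R D m g u)) (at u)"
    using pwp_D[OF assms(1,3)] pwp_D[OF assms(2,3)]
    by (auto intro!: derivative_eq_intros has_vector_derivative_scaleR simp: has_vector_derivative_def scaleR_right_distrib)
  from D_at_interior[OF j this] show ?thesis .
qed

text \<open>Differentiability off finitely many points together with continuity suffices, so the
  unspecified values of \<open>D m f\<close> at kinks do not matter.\<close>

lemma pwp_ftc:
  assumes "pwp f" "a \<in> dom m" "b \<in> dom m" "a \<le> b"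
  shows "(D m f has_integral (f b - f a)) {a..b}"
proof (rule fundamental_theorem_of_calculus_interior_strong[of "X ` {..N}"])
  fix u assume "u \<in> {a<..<b} - X ` {..N}"
  then show "(f has_vector_derivative D m f u) (at u)"
    using assms by (intro pwp_D) (auto simp: dom_eq)
next
  show "continuous_on {a..b} f"
    using pwp_continuous[OF assms(1)] assms by (auto elim!: continuous_on_subset simp: dom_eq)
qed (use assms in auto)

lemma pwp_slope:
  assumes "pwp f" "j \<in> {1..N}"
  shows "(D m f has_integral l j *\<^sub>R slope f j) (elem m j)"
proof -
  have "j \<le> N" "j - 1 \<le> N" using assms(2) by auto
  from pwp_ftc[OF assms(1) node_in_dom[OF this(2)] node_in_dom[OF this(1)]] this
  show ?thesis
    using node_mono[of "j - 1" j] elem_length_pos[OF assms(2)] unfolding slope_def elem_def by simp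
qed

lemma Aop_D:
  assumes "pwp f" "j \<in> {1..N}" "X (j - 1) < u" "u \<le> X j"
  shows "Aop m (D m f) u = slope f j"
  unfolding Aop_def elem_of_eq[OF assms(2-)] Let_def
  using integral_unique[OF pwp_slope[OF assms(1,2)]] elem_length_pos[OF assms(2)] by simp

lemma slope_lincomb: "slope (\<lambda>u. f u + a *\<^sub>R g u) j = slope f j + a *\<^sub>R slope g j"
  unfolding slope_def by (simp add: algebra_simps)

text \<open>Elementwise averaging is a contraction in the \<open>L^2\<close> norm, by Cauchy-Schwarz
  on each element.\<close>

lemma slope_L2:
  assumes "pwp f"
  shows "(\<Sum>j = 1..N. l j * (norm (slope f j))\<^sup>2) \<le> (L2_norm m (D m f))\<^sup>2"
proof -
  have pc: "pc (D m f)" by (rule pwp_D_pc[OF assms])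
  have pc2: "pc (\<lambda>u. (norm (D m f u))\<^sup>2)"
    unfolding power2_norm_eq_inner by (rule pc_inner[OF pc pc])
  have "l j * (norm (slope f j))\<^sup>2 \<le> integral (elem m j) (\<lambda>u. (norm (D m f u))\<^sup>2)" if j: "j \<in> {1..N}" for j
  proof -
    note lj = elem_length_pos[OF j]
    have "(norm (integral (elem m j) (D m f)))\<^sup>2 \<le> l j * integral (elem m j) (\<lambda>u. (norm (D m f u))\<^sup>2)"
      using norm_integral_square_le[of "X (j - 1)" "X j" "D m f"] pc_integrable_elem[OF pc j]
        pc_integrable_elem[OF pc2 j] lj unfolding elem_def elem_length_def by simp
    then have "l j * (l j * (norm (slope f j))\<^sup>2) \<le> l j * integral (elem m j) (\<lambda>u. (norm (D m f u))\<^sup>2)"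
      using integral_unique[OF pwp_slope[OF assms j]] lj
      by (simp add: power_mult_distrib power2_eq_square mult_ac)
    then show ?thesis using lj by simp
  qed
  then have "(\<Sum>j = 1..N. l j * (norm (slope f j))\<^sup>2) \<le> (\<Sum>j = 1..N. integral (elem m j) (\<lambda>u. (norm (D m f u))\<^sup>2))"
    by (intro sum_mono) auto
  also have "\<dots> = (L2_norm m (D m f))\<^sup>2"
    unfolding L2_norm_square_integral[OF pc] integral_elems[OF pc2] ..
  finally show ?thesis .
qed

text \<open>One-dimensional Sobolev inequality. At a minimum point \<open>z\<close> of
  \<open>|f|\<close> the value is bounded by the \<open>L^2\<close> mean; from there to
  \<open>u\<close>, the derivative is integrated and Cauchy-Schwarz applied.\<close>

lemma pwp_sup_bound:
  assumes f: "pwp f" and u: "u \<in> dom m"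
  shows "(norm (f u))\<^sup>2 \<le> 2 / L * (L2_norm m f)\<^sup>2 + 2 * L * (L2_norm m (D m f))\<^sup>2"
proof -
  have cont: "continuous_on (dom m) (\<lambda>u. (norm (f u))\<^sup>2)"
    using pwp_continuous[OF f] by (intro continuous_intros)
  obtain z where z: "z \<in> dom m" "\<And>v. v \<in> dom m \<Longrightarrow> (norm (f z))\<^sup>2 \<le> (norm (f v))\<^sup>2"
    using continuous_attains_inf[OF _ _ cont] u dom_eq by (metis compact_Icc empty_iff)
  have "integral (dom m) (\<lambda>v. (norm (f z))\<^sup>2) \<le> integral (dom m) (\<lambda>v. (norm (f v))\<^sup>2)"
    using z pc_integrable[OF pc_continuous[OF cont]]
    by (intro integral_le) (auto simp: dom_eq)
  then have fz: "L * (norm (f z))\<^sup>2 \<le> (L2_norm m f)\<^sup>2"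
    using L2_norm_square_integral[OF pwp_pc[OF f]] L_pos by (simp add: dom_eq)
  have pc: "pc (D m f)" by (rule pwp_D_pc[OF f])
  have pc2: "pc (\<lambda>u. (norm (D m f u))\<^sup>2)"
    unfolding power2_norm_eq_inner by (rule pc_inner[OF pc pc])
  have diff: "(norm (f b - f a))\<^sup>2 \<le> L * (L2_norm m (D m f))\<^sup>2"
    if "a \<in> dom m" "b \<in> dom m" "a \<le> b" for a b
  proof -
    have sub: "{a..b} \<subseteq> dom m" using that unfolding dom_eq by auto
    have int: "(\<lambda>u. (norm (D m f u))\<^sup>2) integrable_on {a..b}"
      using integrable_on_subinterval[OF pc_integrable[OF pc2] sub] .
    have "(norm (f b - f a))\<^sup>2 \<le> (b - a) * integral {a..b} (\<lambda>u. (norm (D m f u))\<^sup>2)"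
      using norm_integral_square_le[OF that(3) _ int] pwp_ftc[OF f that] by (metis has_integral_integrable_integral)
    also have "\<dots> \<le> L * integral (dom m) (\<lambda>u. (norm (D m f u))\<^sup>2)"
      using that int pc_integrable[OF pc2] sub
      by (intro mult_mono integral_subset_le integral_nonneg) (auto simp: dom_eq)
    finally show ?thesis using L2_norm_square_integral[OF pc] by simp
  qed
  have "(norm (f u - f z))\<^sup>2 \<le> L * (L2_norm m (D m f))\<^sup>2"
    using diff[of u z] diff[of z u] u z by (cases "u \<le> z") (auto simp: norm_minus_commute)
  moreover have "(norm (f u))\<^sup>2 \<le> 2 * (norm (f z))\<^sup>2 + 2 * (norm (f u - f z))\<^sup>2"
  proof -
    \<comment> \<open>The difference of the two sides of the claim is exactly
      \<open>|f u - 2 f z|^2\<close>.\<close>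
    have "0 \<le> (f u - 2 *\<^sub>R f z) \<bullet> (f u - 2 *\<^sub>R f z)" by simp
    then show ?thesis unfolding power2_norm_eq_inner by (simp add: inner_diff inner_commute)
  qed
  moreover have "2 * (norm (f z))\<^sup>2 \<le> 2 / L * (L2_norm m f)\<^sup>2"
    using fz L_pos by (simp add: field_simps)
  ultimately show ?thesis by linarith
qed

subsection \<open>Splines\<close>

lemma Bh_pwp:
  assumes "b \<in> Bh m"
  shows "pwp b"
  unfolding pwp_def
proof
  fix j assume "j \<in> {1..N}"
  then have "\<forall>i. \<exists>q. \<forall>u\<in>elem m j. b u $ i = poly q u"
    using assms unfolding Bh_def Spl_def by blast
  then obtain q where "\<forall>i. \<forall>u\<in>elem m j. b u $ i = poly (q i) u" by metis
  then show "\<exists>q. \<forall>u\<in>elem m j. b u = (\<chi> i. poly (q i) u)"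
    by (intro exI[of _ q]) (auto simp: vec_eq_iff)
qed

lemma Bh_D:
  assumes b: "b \<in> Bh m" and j: "j \<in> {1..N}" "X (j - 1) < u" "u < X j"
  shows "D m b u = slope b j"
proof -
  have "\<forall>i. \<exists>q. degree q \<le> 1 \<and> (\<forall>u\<in>elem m j. b u $ i = poly q u)"
    using b j unfolding Bh_def Spl_def by blast
  then obtain q where q: "\<forall>i. degree (q i) \<le> 1 \<and> (\<forall>u\<in>elem m j. b u $ i = poly (q i) u)" by metis
  have e: "X j \<in> elem m j" "X (j - 1) \<in> elem m j" using j unfolding elem_def by auto
  have "D m b u = (\<chi> i. poly (pderiv (q i)) u)"
    using q by (intro D_at_interior[OF j pwp_has_derivative[OF j]]) (auto simp: vec_eq_iff)
  also have "\<dots> = slope b j"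
    unfolding vec_eq_iff
  proof
    fix i
    have qi: "q i = [:coeff (q i) 0, coeff (q i) 1:]" using q poly_degree_le_1 by blast
    have "poly (pderiv (q i)) u = coeff (q i) 1" by (subst qi) (simp add: pderiv_pCons)
    moreover have "poly (q i) (X j) - poly (q i) (X (j - 1)) = l j * coeff (q i) 1"
      by (subst qi, subst (2) qi) (simp add: elem_length_def algebra_simps)
    moreover have "slope b j $ i = (poly (q i) (X j) - poly (q i) (X (j - 1))) / l j"
      unfolding slope_def using q e by (simp add: divide_inverse)
    ultimately show "(\<chi> i. poly (pderiv (q i)) u) $ i = slope b j $ i"
      using elem_length_pos[OF j(1)] by simp
  qed
  finally show ?thesis .
qed

lemma D_eq:
  fixes f :: "real \<Rightarrow> 'a::euclidean_space"
  shows "u \<in> dom m \<Longrightarrow> (f has_vector_derivative f') (at u within dom m) \<Longrightarrow> D m f u = f'"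
  unfolding D_def using vector_derivative_within_closed_interval[of 0 L u f f'] L_pos
  unfolding dom_eq by simp

lemma Spl1_D:
  assumes "f \<in> Spl m p 1" "u \<in> dom m"
  shows "(f has_vector_derivative D m f u) (at u within dom m)"
  using assms unfolding Spl_def C_k_def D_def
  by (auto simp: differentiable_on_def vector_derivative_works)

lemma D_lincomb:
  fixes f g :: "real \<Rightarrow> 'a::euclidean_space"
  assumes "u \<in> dom m" "(f has_vector_derivative D m f u) (at u within dom m)"
    "(g has_vector_derivative D m g u) (at u within dom m)"
  shows "((\<lambda>u. f u + a *\<^sub>R g u) has_vector_derivative (D m f u + a *\<^sub>R D m g u)) (at u within dom m)"
    "D m (\<lambda>u. f u + a *\<^sub>R g u) u = D m f u + a *\<^sub>R D m g u"
proof -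
  show 1: "((\<lambda>u. f u + a *\<^sub>R g u) has_vector_derivative (D m f u + a *\<^sub>R D m g u)) (at u within dom m)"
    using assms
    by (auto intro!: derivative_eq_intros simp: has_vector_derivative_def scaleR_right_distrib)
  show "D m (\<lambda>u. f u + a *\<^sub>R g u) u = D m f u + a *\<^sub>R D m g u" by (rule D_eq[OF assms(1) 1])
qed

lemma Yh_D:
  assumes "y \<in> Yh m" "u \<in> dom m"
  shows "(y has_vector_derivative D m y u) (at u within dom m)"
    "D m y u $ i = D m (\<lambda>u. y u $ i) u"
proof -
  have "(y has_vector_derivative (\<chi> i. D m (\<lambda>u. y u $ i) u)) (at u within dom m)"
    by (rule has_vector_derivative_cart) (use assms Spl1_D in \<open>auto simp: Yh_def\<close>)
  note d = this and e = D_eq[OF assms(2) this]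
  show "(y has_vector_derivative D m y u) (at u within dom m)" using d e by simp
  show "D m y u $ i = D m (\<lambda>u. y u $ i) u" using e by simp
qed

lemma Yh_D_lincomb:
  assumes "y \<in> Yh m" "w \<in> Yh m" "u \<in> dom m"
  shows "D m (\<lambda>u. y u + a *\<^sub>R w u) u = D m y u + a *\<^sub>R D m w u"
  using D_lincomb(2) Yh_D(1) assms by blast

text \<open>The formula must hold up to the nodes. There the derivative relative to the interval is
  restricted to one closed element, where one-sided derivatives are unique, so it agrees with that
  of the polynomial piece.\<close>

lemma Yh_D_pwp:
  assumes "y \<in> Yh m"
  shows "pwp (D m y)"
  unfolding pwp_def
proof
  fix j assume j: "j \<in> {1..N}"
  then have "\<forall>i. \<exists>q. \<forall>u\<in>elem m j. y u $ i = poly q u"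
    using assms unfolding Yh_def Spl_def by blast
  then obtain q where q: "\<forall>i. \<forall>u\<in>elem m j. y u $ i = poly (q i) u" by metis
  have "D m y u = (\<chi> i. poly (pderiv (q i)) u)" if u: "u \<in> elem m j" for u
    unfolding vec_eq_iff
  proof
    fix i
    have ud: "u \<in> dom m" using u elem_subset[OF j] by blast
    have "((\<lambda>u. y u $ i) has_vector_derivative D m y u $ i) (at u within elem m j)"
      unfolding Yh_D(2)[OF assms ud]
      by (rule has_vector_derivative_within_subset[OF Spl1_D[OF _ ud] elem_subset[OF j]])
        (use assms in \<open>auto simp: Yh_def\<close>)
    then have 1: "((\<lambda>u. poly (q i) u) has_vector_derivative D m y u $ i) (at u within elem m j)"
      by (rule has_vector_derivative_transform[OF u, rotated]) (use q in simp)
    have "((\<lambda>u. poly (q i) u) has_vector_derivative poly (pderiv (q i)) u) (at u within elem m j)"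
      by (simp add: has_field_derivative_at_within[OF poly_DERIV] flip: has_real_derivative_iff_has_vector_derivative)
    from vector_derivative_unique_within_closed_interval[of "X (j - 1)" "X j", OF _ _ 1[unfolded elem_def, folded cbox_interval] this[unfolded elem_def, folded cbox_interval]]
    show "D m y u $ i = (\<chi> i. poly (pderiv (q i)) u) $ i"
      using u elem_length_pos[OF j] unfolding elem_def elem_length_def by simp
  qed
  then show "\<exists>q. \<forall>u\<in>elem m j. D m y u = (\<chi> i. poly (q i) u)"
    by (intro exI[of _ "\<lambda>i. pderiv (q i)"]) auto
qed

lemma Spl_lincomb:
  assumes f: "f \<in> Spl m p k" and g: "g \<in> Spl m p k" and k: "k = 0 \<or> k = 1"
  shows "(\<lambda>u. f u + a * g u) \<in> Spl m p k"
proof -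
  have "C_k m k (\<lambda>u. f u + a * g u)"
  proof (cases "k = 0")
    case True
    then show ?thesis using f g by (auto simp: Spl_def C_k_def intro!: continuous_intros)
  next
    case False
    then have k1: "k = 1" using k by simp
    have fg: "continuous_on (dom m) (D m f)" "continuous_on (dom m) (D m g)"
      using f g k1 unfolding Spl_def C_k_def by auto
    note d = D_lincomb[OF _ Spl1_D Spl1_D, OF _ f[unfolded k1] _ g[unfolded k1]]
    have "continuous_on (dom m) (D m (\<lambda>u. f u + a * g u))"
      using fg d(2)[of _ a] by (simp add: continuous_on_add continuous_on_mult_left cong: continuous_on_cong)
    moreover have "(\<lambda>u. f u + a * g u) differentiable_on dom m"
      unfolding differentiable_on_def using d(1)[of _ a]
      by (auto simp: has_vector_derivative_def intro: differentiableI)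
    ultimately show ?thesis unfolding k1 C_k_def by simp
  qed
  moreover have "\<exists>q. degree q \<le> p \<and> (\<forall>u\<in>elem m j. f u + a * g u = poly q u)" if j: "j \<in> {1..N}" for j
  proof -
    obtain q r where "degree q \<le> p" "\<forall>u\<in>elem m j. f u = poly q u"
      "degree r \<le> p" "\<forall>u\<in>elem m j. g u = poly r u"
      using f g j unfolding Spl_def by blast
    then show ?thesis
      by (intro exI[of _ "q + smult a r"])
        (auto intro!: degree_add_le intro: le_trans[OF degree_smult_le])
  qed
  ultimately show ?thesis using f g unfolding Spl_def by simp
qed

lemma Spl_zero:
  assumes k: "k = 0 \<or> k = 1"
  shows "(\<lambda>u. 0) \<in> Spl m p k"
proof -
  have "D m (\<lambda>u. 0) u = (0::real)" if "u \<in> dom m" for u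
    by (rule D_eq[OF that]) simp
  then have "continuous_on (dom m) (D m (\<lambda>u. 0::real))" by (simp cong: continuous_on_cong)
  then have "C_k m k (\<lambda>u. 0)" using k by (auto simp: C_k_def)
  then show ?thesis unfolding Spl_def by (auto intro: exI[of _ 0])
qed

lemma Spl_vec_subspace:
  assumes k: "k = 0 \<or> k = 1"
  shows "fsubspace {y :: real \<Rightarrow> vec3. \<forall>i. (\<lambda>u. y u $ i) \<in> Spl m p k}"
proof -
  have add: "(\<lambda>u. f u + g u) \<in> Spl m p k" if "f \<in> Spl m p k" "g \<in> Spl m p k" for f g
    using Spl_lincomb[OF that k, of 1] by simp
  have scale: "(\<lambda>u. a * f u) \<in> Spl m p k" if "f \<in> Spl m p k" for f a
    using Spl_lincomb[OF Spl_zero[OF k] that k, of a] by simp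
  show ?thesis unfolding fsubspace_def using add scale Spl_zero[OF k] by simp
qed

lemma Yh_subspace: "fsubspace (Yh m)" and Bh_subspace: "fsubspace (Bh m)"
  unfolding Yh_def Bh_def by (rule Spl_vec_subspace, simp)+

text \<open>The \<open>p + 1\<close> equidistant sample points all lie in the element and determine
  a polynomial of degree at most \<open>p\<close>.\<close>

lemma Spl_eq_zero:
  assumes f: "f \<in> Spl m p k"
    and z: "\<And>i j. i \<le> p \<Longrightarrow> j \<in> {1..N} \<Longrightarrow> f (X (j - 1) + real i / real (p + 1) * l j) = 0"
  shows "f = (\<lambda>u. 0)"
proof
  fix u
  show "f u = 0"
  proof (cases "u \<in> dom m")
    case True
    then obtain j where j: "j \<in> {1..N}" "u \<in> elem m j" using dom_elem by blast
    obtain q where q: "degree q \<le> p" "\<forall>u\<in>elem m j. f u = poly q u"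
      using f j unfolding Spl_def by blast
    note lj = elem_length_pos[OF j(1)]
    have "q = 0"
    proof (rule poly_eq_0_if_many_zeros[OF q(1), of "\<lambda>i. X (j - 1) + real i / real (p + 1) * l j"])
      show "inj_on (\<lambda>i. X (j - 1) + real i / real (p + 1) * l j) {..p}"
        using lj by (auto simp: inj_on_def)
      fix i assume i: "i \<le> p"
      have "real i / real (p + 1) * l j \<le> 1 * l j" using i lj by (intro mult_right_mono) auto
      then have "X (j - 1) + real i / real (p + 1) * l j \<in> elem m j"
        using lj unfolding elem_def by (auto simp: elem_length_def)
      then show "poly q (X (j - 1) + real i / real (p + 1) * l j) = 0" using q z[OF i j(1)] by simp
    qed
    then show ?thesis using q j by simp
  qed (use f in \<open>simp add: Spl_def\<close>)
qed

text \<open>Finite dimensionality in the form the Riesz lemma consumes: the functionals are the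
  components of the sampled values.\<close>

lemma Spl_vec_separating:
  fixes p k
  defines "V \<equiv> {y :: real \<Rightarrow> vec3. \<forall>i. (\<lambda>u. y u $ i) \<in> Spl m p k}"
  obtains \<N> where "finite \<N>" "\<forall>f\<in>\<N>. linear_fun_on V f"
    "\<forall>v\<in>V. (\<forall>f\<in>\<N>. f v = 0) \<longrightarrow> v = (\<lambda>s. 0)"
proof (rule that)
  let ?x = "\<lambda>i j. X (j - 1) + real i / real (p + 1) * l j"
  let ?\<N> = "(\<lambda>(i, j, c) v. v (?x i j) $ c) ` ({..p} \<times> {1..N} \<times> (UNIV :: 3 set))"
  show "finite ?\<N>" by (intro finite_imageI finite_cartesian_product) auto
  show "\<forall>f\<in>?\<N>. linear_fun_on V f" unfolding linear_fun_on_def by auto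
  show "\<forall>v\<in>V. (\<forall>f\<in>?\<N>. f v = 0) \<longrightarrow> v = (\<lambda>s. 0)"
  proof (intro ballI impI)
    fix v assume v: "v \<in> V" and z: "\<forall>f\<in>?\<N>. f v = 0"
    have "(\<lambda>u. v u $ c) = (\<lambda>u. 0)" for c
    proof (rule Spl_eq_zero)
      show "(\<lambda>u. v u $ c) \<in> Spl m p k" using v unfolding V_def by blast
      fix i j assume "i \<le> p" "j \<in> {1..N}"
      then have "(i, j, c) \<in> {..p} \<times> {1..N} \<times> (UNIV :: 3 set)" by simp
      from bspec[OF z imageI[OF this]] show "v (?x i j) $ c = 0" by simp
    qed
    then show "v = (\<lambda>s. 0)" by (metis (mono_tags) ext vec_eq_iff zero_index)
  qed
qed

subsection \<open>Nodal interpolation\<close>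

text \<open>Existence and uniqueness of the interpolant have to be shown together, since
  \<open>interp\<close> is a definite description. The witness glues the affine pieces
  \<open>q j\<close>.\<close>

lemma interp_Spl:
  "interp m f \<in> Spl m 1 0" (is ?A) and interp_node: "j \<le> N \<Longrightarrow> interp m f (X j) = f (X j)"
proof -
  define q where "q j = [:f (X (j - 1)) - X (j - 1) * ((f (X j) - f (X (j - 1))) / l j),
    (f (X j) - f (X (j - 1))) / l j:]" for j
  have qL: "poly (q j) (X (j - 1)) = f (X (j - 1))" for j
    unfolding q_def by (simp add: algebra_simps)
  have qR: "poly (q j) (X j) = f (X j)" if "j \<in> {1..N}" for j
  proof -
    define \<alpha> where "\<alpha> = (f (X j) - f (X (j - 1))) / l j"
    have "poly (q j) (X j) = f (X (j - 1)) + l j * \<alpha>"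
      unfolding q_def \<alpha>_def[symmetric] by (simp add: elem_length_def algebra_simps)
    then have "poly (q j) (X j) = f (X (j - 1)) + l j * ((f (X j) - f (X (j - 1))) / l j)"
      unfolding \<alpha>_def .
    then show ?thesis using elem_length_pos[OF that] by simp
  qed
  define g where "g u = (if u \<in> dom m then poly (q (elem_of m u)) u else 0)" for u
  have g: "g u = poly (q j) u" if j: "j \<in> {1..N}" and u: "u \<in> elem m j" for j u
  proof (cases "u = X (j - 1)")
    case False
    then have "elem_of m u = j" using u j by (intro elem_of_eq) (auto simp: elem_def)
    then show ?thesis unfolding g_def using elem_subset[OF j] u by auto
  next
    \<comment> \<open>At its left end a point is assigned to the preceding element; the two affine
      pieces take the same nodal value there.\<close>
    case True
    have ud: "u \<in> dom m" using elem_subset[OF j] u by auto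
    show ?thesis
    proof (cases "j = 1")
      \<comment> \<open>The node 0 has no element to its left, but the search in
        \<open>elem_of\<close> starts at index 1 and returns the correct element.\<close>
      case j1: True
      have "elem_of m u = 1"
        unfolding elem_of_def using True j1 node_mono[of 0 1] N_pos by (intro Least_equality) auto
      then show ?thesis unfolding g_def using ud j1 by simp
    next
      case False
      then have j': "j - 1 \<in> {1..N}" using j by auto
      have "elem_of m u = j - 1"
        using True node_strict[of "j - 1 - 1" "j - 1"] j' by (intro elem_of_eq) auto
      then show ?thesis unfolding g_def using ud True qL qR[OF j'] by simp
    qed
  qed
  have "continuous_on (\<Union>j\<in>{1..N}. elem m j) g"
  proof (rule continuous_on_closed_Union)
    fix j assume "j \<in> {1..N}"
    then show "continuous_on (elem m j) g"
      using g by (simp add: continuous_on_poly continuous_on_id cong: continuous_on_cong)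
  qed (auto simp: elem_def)
  moreover have "(\<Union>j\<in>{1..N}. elem m j) = dom m" using elem_subset dom_elem by blast
  ultimately have cont: "continuous_on (dom m) g" by simp
  have "degree (q j) \<le> 1" for j unfolding q_def by simp
  then have gS: "g \<in> Spl m 1 0"
    unfolding Spl_def C_k_def using cont g by (auto simp: g_def)
  have gn: "g (X j) = f (X j)" if "j \<le> N" for j
  proof (cases "j = 0")
    case True
    then show ?thesis using g[of 1 "X 0"] qL[of 1] N_pos node_mono[of 0 1] by (simp add: elem_def)
  next
    case False
    then show ?thesis using g[of j "X j"] qR[of j] that node_mono[of "j - 1" j] by (simp add: elem_def)
  qed
  have uniq: "h = g" if h: "h \<in> Spl m 1 0" "\<forall>j\<le>N. h (X j) = f (X j)" for h
  proof
    fix u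
    show "h u = g u"
    proof (cases "u \<in> dom m")
      case True
      then obtain j where j: "j \<in> {1..N}" "u \<in> elem m j" using dom_elem by blast
      obtain r where r: "degree r \<le> 1" "\<forall>u\<in>elem m j. h u = poly r u"
        using h j unfolding Spl_def by blast
      have "r - q j = 0"
      proof (rule poly_eq_0_if_many_zeros[of _ 1 "\<lambda>i. X (j - 1 + i)"])
        show "degree (r - q j) \<le> 1" using r(1) by (intro degree_diff_le) (auto simp: q_def)
        show "inj_on (\<lambda>i. X (j - 1 + i)) {..1}"
          using node_strict[of "j - 1" j] j by (auto simp: inj_on_def le_Suc_eq)
        fix i :: nat assume "i \<le> 1"
        moreover have "X j \<in> elem m j" "X (j - 1) \<in> elem m j"
          using node_mono[of "j - 1" j] j by (auto simp: elem_def)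
        ultimately show "poly (r - q j) (X (j - 1 + i)) = 0"
          using r(2) h(2) qL[of j] qR[OF j(1)] j(1) by (auto simp: le_Suc_eq)
      qed
      then show ?thesis using g[OF j] r(2) j by simp
    qed (use h gS in \<open>simp add: Spl_def\<close>)
  qed
  have "interp m f = g"
    unfolding interp_def by (rule the_equality) (use gS gn uniq in blast)+
  then show ?A "j \<le> N \<Longrightarrow> interp m f (X j) = f (X j)" for j using gS gn by auto
qed

lemma interp_elem:
  assumes j: "j \<in> {1..N}" "u \<in> elem m j"
  shows "interp m f u = f (X (j - 1)) + (u - X (j - 1)) / l j * (f (X j) - f (X (j - 1)))"
proof -
  obtain q where q: "degree q \<le> 1" "\<forall>u\<in>elem m j. interp m f u = poly q u"
    using interp_Spl[of f] j unfolding Spl_def by blast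
  define a b where "a = coeff q 0" and "b = coeff q 1"
  have qe: "interp m f u = a + b * u" if "u \<in> elem m j" for u
  proof -
    have "poly q u = poly [:a, b:] u" unfolding a_def b_def using poly_degree_le_1[OF q(1)] by simp
    then show ?thesis using q(2) that by (simp add: mult.commute)
  qed
  have e: "X j \<in> elem m j" "X (j - 1) \<in> elem m j"
    using node_mono[of "j - 1" j] j by (auto simp: elem_def)
  have f: "f (X j) = a + b * X j" "f (X (j - 1)) = a + b * X (j - 1)"
    using qe[OF e(1)] qe[OF e(2)] interp_node[of j f] interp_node[of "j - 1" f] j by auto
  have "f (X j) - f (X (j - 1)) = b * l j" unfolding f elem_length_def by (simp add: algebra_simps)
  then have "(u - X (j - 1)) / l j * (f (X j) - f (X (j - 1))) = (u - X (j - 1)) * b"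
    using elem_length_pos[OF j(1)] by simp
  then show ?thesis unfolding qe[OF j(2)] f(2) by (simp add: algebra_simps)
qed

text \<open>The trapezoidal rule is exact for affine pieces; the first penalty term thus becomes a
  sum over nodal values.\<close>

lemma integral_interp:
  "integral (dom m) (interp m f) = (\<Sum>j = 1..N. l j / 2 * (f (X (j - 1)) + f (X j)))"
proof (rule integral_unique, rule has_integral_elems)
  fix j assume j: "j \<in> {1..N}"
  note lj = elem_length_pos[OF j]
  define a d where "a = X (j - 1)" and "d = f (X j) - f (X (j - 1))"
  let ?F = "\<lambda>u. f a * u + (u - a)\<^sup>2 / (2 * l j) * d"
  have "((\<lambda>u. f a + (u - a) / l j * d) has_integral (?F (X j) - ?F a)) {a..X j}"
  proof (rule fundamental_theorem_of_calculus)
    show "a \<le> X j" using lj unfolding a_def elem_length_def by simp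
    fix u
    show "(?F has_vector_derivative f a + (u - a) / l j * d) (at u within {a..X j})"
      using lj unfolding has_real_derivative_iff_has_vector_derivative[symmetric]
      by (auto intro!: derivative_eq_intros simp: field_simps)
  qed
  moreover have "?F (X j) - ?F a = l j / 2 * (f (X (j - 1)) + f (X j))"
  proof -
    have "X j = a + l j" unfolding a_def elem_length_def by simp
    then show ?thesis using lj unfolding d_def a_def[symmetric]
      by (simp add: field_simps power2_eq_square)
  qed
  ultimately have "((\<lambda>u. f a + (u - a) / l j * d) has_integral l j / 2 * (f (X (j - 1)) + f (X j))) (elem m j)"
    unfolding elem_def a_def by (simp only:)
  then show "(interp m f has_integral l j / 2 * (f (X (j - 1)) + f (X j))) (elem m j)"
    by (rule has_integral_elem_cong)
      (use interp_elem[OF j] interior_elem in \<open>auto simp: a_def d_def\<close>)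
qed

lemma interp_bound:
  assumes "\<And>j. j \<le> N \<Longrightarrow> \<bar>f (X j) - c\<bar> \<le> M" and u: "u \<in> dom m"
  shows "\<bar>interp m f u - c\<bar> \<le> M"
proof -
  obtain j where j: "j \<in> {1..N}" "u \<in> elem m j" using dom_elem[OF u] .
  define t where "t = (u - X (j - 1)) / l j"
  have t: "0 \<le> t" "t \<le> 1"
    using j elem_length_pos[OF j(1)] unfolding t_def elem_def by (auto simp: elem_length_def)
  have "interp m f u - c = (1 - t) * (f (X (j - 1)) - c) + t * (f (X j) - c)"
    unfolding interp_elem[OF j] t_def[symmetric] by (simp add: algebra_simps)
  also have "\<bar>\<dots>\<bar> \<le> (1 - t) * M + t * M"
    using t assms(1)[of j] assms(1)[of "j - 1"] j(1)
    by (intro order_trans[OF abs_triangle_ineq] add_mono) (auto simp: abs_mult intro!: mult_left_mono)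
  finally show ?thesis by (simp add: algebra_simps)
qed

text \<open>An interpolant is a convex combination of nodal values on each element, so nodal bounds
  hold everywhere, in particular almost everywhere.\<close>

lemma Linf_interp_le:
  assumes "\<And>j. j \<le> N \<Longrightarrow> \<bar>f (X j) - c\<bar> \<le> M"
  shows "Linf_norm m (\<lambda>u. interp m f u - c) \<le> M"
  unfolding Linf_norm_def
proof (rule cInf_lower)
  have "0 \<le> M" using assms[of 0] by simp
  moreover have "norm (interp m f u - c) \<le> M" if "u \<in> {0<..<len m}" for u
    using interp_bound[of f c M u, OF assms] that unfolding len_eq dom_eq by simp
  ultimately show "M \<in> {C. 0 \<le> C \<and> (AE u in lebesgue_on {0<..<len m}. norm (interp m f u - c) \<le> C)}"
    by (auto intro!: AE_I2)
  show "bdd_below {C. 0 \<le> C \<and> (AE u in lebesgue_on {0<..<len m}. norm (interp m f u - c) \<le> C)}"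
    by (rule bdd_belowI[of _ 0]) auto
qed

end

section \<open>Discrete energies\<close>

context mesh_partition
begin

text \<open>Linearity of \<open>D m\<close> on splines is known only on \<open>dom m\<close>; this
  allows a second derivative to be taken.\<close>

lemma D_cong:
  assumes "\<And>v. v \<in> dom m \<Longrightarrow> f v = g v" "u \<in> dom m"
  shows "D m f u = D m g u"
proof -
  have "(f has_vector_derivative d) (at u within dom m) \<longleftrightarrow> (g has_vector_derivative d) (at u within dom m)" for d
    using has_vector_derivative_transform[OF assms(2), of f g d] has_vector_derivative_transform[OF assms(2), of g f d]
      assms(1) by auto
  then show ?thesis unfolding D_def vector_derivative_def by simp
qed

lemma Yh_DD_lincomb:
  assumes "y \<in> Yh m" "w \<in> Yh m" "u \<in> dom m - X ` {..N}"
  shows "D m (D m (\<lambda>s. y s + a *\<^sub>R w s)) u = D m (D m y) u + a *\<^sub>R D m (D m w) u"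
proof -
  have "D m (D m (\<lambda>s. y s + a *\<^sub>R w s)) u = D m (\<lambda>v. D m y v + a *\<^sub>R D m w v) u"
    by (rule D_cong) (use Yh_D_lincomb assms in auto)
  then show ?thesis using pwp_D_lincomb[OF Yh_D_pwp Yh_D_pwp] assms by simp
qed

lemma D_zero: "u \<in> dom m \<Longrightarrow> D m (\<lambda>s. 0 :: vec3) u = 0"
  by (rule D_eq) simp_all

section \<open>Nodal form of the penalty and of the energy\<close>

definition avg :: "(real \<Rightarrow> vec3) \<Rightarrow> nat \<Rightarrow> vec3" where
  "avg f j = (1 / 2) *\<^sub>R (f (X (j - 1)) + f (X j))"

lemma avg_lincomb: "avg (\<lambda>s. f s + a *\<^sub>R g s) j = avg f j + a *\<^sub>R avg g j"
  unfolding avg_def by (simp add: algebra_simps)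

lemma pred_le: "j \<le> N \<Longrightarrow> j - Suc 0 \<le> N" by simp

lemma avg_cong: "(\<And>i. i \<le> N \<Longrightarrow> f (X i) = g (X i)) \<Longrightarrow> j \<in> {1..N} \<Longrightarrow> avg f j = avg g j"
  and slope_cong: "(\<And>i. i \<le> N \<Longrightarrow> f (X i) = g (X i)) \<Longrightarrow> j \<in> {1..N} \<Longrightarrow> slope f j = slope g j"
  unfolding avg_def slope_def by (simp_all add: pred_le)

lemma slope_D_lincomb:
  assumes "y \<in> Yh m" "w \<in> Yh m" "j \<in> {1..N}"
  shows "slope (D m (\<lambda>s. y s + a *\<^sub>R w s)) j = slope (D m y) j + a *\<^sub>R slope (D m w) j"
proof -
  have "slope (D m (\<lambda>s. y s + a *\<^sub>R w s)) j = slope (\<lambda>u. D m y u + a *\<^sub>R D m w u) j"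
    by (rule slope_cong) (use assms Yh_D_lincomb node_in_dom in auto)
  then show ?thesis by (simp add: slope_lincomb)
qed

text \<open>The penalty functional depends only on the nodal values of \<open>y'\<close> and \<open>b\<close>; \<open>pen\<close> is its
  polarization.\<close>

definition pen ::
    "real \<Rightarrow> real \<Rightarrow> (real \<Rightarrow> vec3) \<Rightarrow> (real \<Rightarrow> vec3) \<Rightarrow> (real \<Rightarrow> vec3) \<Rightarrow> (real \<Rightarrow> vec3) \<Rightarrow> real" where
  "pen \<epsilon>1 \<epsilon>2 f b g c =
     1 / \<epsilon>1 * (\<Sum>j = 1..N. l j / 2 * ((f (X (j - 1)) \<bullet> b (X (j - 1))) * (g (X (j - 1)) \<bullet> c (X (j - 1))) +
        (f (X j) \<bullet> b (X j)) * (g (X j) \<bullet> c (X j)))) +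
     1 / \<epsilon>2 * (\<Sum>j = 1..N. l j * ((avg f j \<bullet> slope b j) * (avg g j \<bullet> slope c j)))"

lemma pen_commute: "pen \<epsilon>1 \<epsilon>2 f b g c = pen \<epsilon>1 \<epsilon>2 g c f b"
  unfolding pen_def by (simp add: mult.commute)

lemma pen_nonneg: "\<epsilon>1 > 0 \<Longrightarrow> \<epsilon>2 > 0 \<Longrightarrow> 0 \<le> pen \<epsilon>1 \<epsilon>2 f b f b"
  unfolding pen_def
  by (intro add_nonneg_nonneg mult_nonneg_nonneg[of "1 / _"] sum_nonneg mult_nonneg_nonneg[of "l _"]
      mult_nonneg_nonneg[of "l _ / 2"] zero_le_square) (auto simp: elem_length_pos less_imp_le)

lemma pen_cong:
  assumes "\<And>j. j \<le> N \<Longrightarrow> g (X j) = g' (X j)"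
  shows "pen \<epsilon>1 \<epsilon>2 f b g c = pen \<epsilon>1 \<epsilon>2 f b g' c"
  unfolding pen_def
  by (intro arg_cong2[where f = "(+)"] arg_cong2[where f = "(*)"] refl sum.cong)
    (simp_all add: assms pred_le avg_cong[of g g', OF assms])

lemma pen_lincomb:
  "pen \<epsilon>1 \<epsilon>2 f b (\<lambda>s. g s + a *\<^sub>R h s) c = pen \<epsilon>1 \<epsilon>2 f b g c + a * pen \<epsilon>1 \<epsilon>2 f b h c"
  "pen \<epsilon>1 \<epsilon>2 f b g (\<lambda>s. c s + a *\<^sub>R d s) = pen \<epsilon>1 \<epsilon>2 f b g c + a * pen \<epsilon>1 \<epsilon>2 f b g d"
  unfolding pen_def avg_lincomb slope_lincomb
  by (simp_all add: inner_add_left inner_add_right distrib_left distrib_right sum.distrib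
      sum_distrib_left mult_ac add_ac)

text \<open>The membership of \<open>b\<close> in \<open>Bh\<close> makes \<open>b'\<close> constant
  on each element, so the second integrand is piecewise constant as well.\<close>

lemma P_eps_eq_pen:
  assumes "b \<in> Bh m"
  shows "P_eps m \<epsilon>1 \<epsilon>2 y b = 1 / 2 * pen \<epsilon>1 \<epsilon>2 (D m y) b (D m y) b"
proof -
  have "integral (dom m) (\<lambda>u. (Mop m (D m y) u \<bullet> D m b u)\<^sup>2)
      = (\<Sum>j = 1..N. l j *\<^sub>R (avg (D m y) j \<bullet> slope b j)\<^sup>2)"
  proof (rule integral_unique, rule has_integral_piecewise_const)
    fix j u assume j: "j \<in> {1..N}" "X (j - 1) < u" "u < X j"
    have "Mop m (D m y) u = avg (D m y) j"
      unfolding Mop_def avg_def Let_def using elem_of_eq[OF j(1,2)] j(3) by simp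
    then show "(Mop m (D m y) u \<bullet> D m b u)\<^sup>2 = (avg (D m y) j \<bullet> slope b j)\<^sup>2"
      using Bh_D[OF assms j] by simp
  qed
  then show ?thesis
    unfolding P_eps_def pen_def integral_interp by (simp add: power2_eq_square)
qed

lemma pen_form_Y: "sym_form_on (Yh m) (\<lambda>v w. pen \<epsilon>1 \<epsilon>2 (D m v) b (D m w) b)"
  unfolding sym_form_on_def
proof (intro conjI ballI linear_fun_onI[OF Yh_subspace])
  fix u v w :: "real \<Rightarrow> vec3" and a
  assume "v \<in> Yh m" "w \<in> Yh m"
  then have "pen \<epsilon>1 \<epsilon>2 (D m u) b (D m (\<lambda>s. v s + a *\<^sub>R w s)) b
      = pen \<epsilon>1 \<epsilon>2 (D m u) b (\<lambda>s. D m v s + a *\<^sub>R D m w s) b"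
    by (intro pen_cong Yh_D_lincomb node_in_dom) auto
  then show "pen \<epsilon>1 \<epsilon>2 (D m u) b (D m (\<lambda>s. v s + a *\<^sub>R w s)) b
      = pen \<epsilon>1 \<epsilon>2 (D m u) b (D m v) b + a * pen \<epsilon>1 \<epsilon>2 (D m u) b (D m w) b"
    by (simp add: pen_lincomb)
qed (rule pen_commute)

lemma pen_form_B: "sym_form_on (Bh m) (\<lambda>v w. pen \<epsilon>1 \<epsilon>2 f v f w)"
  unfolding sym_form_on_def
  by (intro conjI ballI linear_fun_onI[OF Bh_subspace] pen_lincomb pen_commute)

text \<open>\<open>G\<close> stands for the second derivative on \<open>Yh\<close> or the first on
  \<open>Bh\<close>; linearity is asked only off the nodes, where these derivatives are
  determined.\<close>

lemma L2_form:
  assumes V: "fsubspace V" and G: "\<And>v. v \<in> V \<Longrightarrow> pc (G v)"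
    and lin: "\<And>v w a u. v \<in> V \<Longrightarrow> w \<in> V \<Longrightarrow> u \<in> dom m - X ` {..N} \<Longrightarrow>
      G (\<lambda>s. v s + a *\<^sub>R w s) u = G v u + a *\<^sub>R G w u"
  shows "sym_form_on V (\<lambda>v w. L2_inner m (G v :: real \<Rightarrow> vec3) (G w))"
  unfolding sym_form_on_def
proof (intro conjI ballI linear_fun_onI[OF V] L2_inner_commute)
  fix u v w a
  assume *: "u \<in> V" "v \<in> V" "w \<in> V"
  have "L2_inner m (G u) (G (\<lambda>s. v s + a *\<^sub>R w s)) = L2_inner m (G u) (\<lambda>t. G v t + a *\<^sub>R G w t)"
    by (rule L2_inner_cong) (use lin * in auto)
  also have "pc (\<lambda>t. a *\<^sub>R G w t)"
    by (rule pc_compose2[OF G[OF *(3)] G[OF *(3)], of "\<lambda>x y. a *\<^sub>R x"]) (rule continuous_on_scaleR, simp_all)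
  then have "L2_inner m (G u) (\<lambda>t. G v t + a *\<^sub>R G w t) = L2_inner m (G u) (G v) + a * L2_inner m (G u) (G w)"
    using G * by (simp add: L2_inner_add_right L2_inner_scaleR_right)
  finally show "L2_inner m (G u) (G (\<lambda>s. v s + a *\<^sub>R w s)) = L2_inner m (G u) (G v) + a * L2_inner m (G u) (G w)" .
qed

lemma DD_form_Y: "sym_form_on (Yh m) (\<lambda>v w. L2_inner m (D m (D m v)) (D m (D m w)))"
  by (rule L2_form[OF Yh_subspace]) (auto intro: pwp_D_pc Yh_D_pwp Yh_DD_lincomb)

lemma D_form_B: "sym_form_on (Bh m) (\<lambda>v w. L2_inner m (D m v) (D m w))"
  by (rule L2_form[OF Bh_subspace]) (auto intro: pwp_D_pc Bh_pwp pwp_D_lincomb)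

lemma dP_y_eq:
  assumes "y \<in> Yh m" "w \<in> Yh m" "b \<in> Bh m"
  shows "dP_y m \<epsilon>1 \<epsilon>2 y b w = pen \<epsilon>1 \<epsilon>2 (D m y) b (D m w) b"
  unfolding dP_y_def
  by (rule deriv_quadratic[OF Yh_subspace pen_form_Y assms(1,2)]) (rule P_eps_eq_pen[OF assms(3)])

lemma dP_b_eq:
  assumes "b \<in> Bh m" "r \<in> Bh m"
  shows "dP_b m \<epsilon>1 \<epsilon>2 y b r = pen \<epsilon>1 \<epsilon>2 (D m y) b (D m y) r"
  unfolding dP_b_def
  by (rule deriv_quadratic[OF Bh_subspace pen_form_B assms]) (rule P_eps_eq_pen)

definition psi_part :: "(real \<Rightarrow> real) \<Rightarrow> (real \<Rightarrow> vec3) \<Rightarrow> (real \<Rightarrow> vec3) \<Rightarrow> real" where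
  "psi_part \<phi> y b = (\<Sum>j = 1..N. l j * psi \<phi> ((norm (slope (D m y) j))\<^sup>2) ((norm (slope b j))\<^sup>2))"

lemma energy_eq:
  assumes y: "y \<in> Yh m" and b: "b \<in> Bh m"
  shows "energy m \<phi> \<epsilon>1 \<epsilon>2 y b = 1 / 2 * L2_inner m (D m (D m y)) (D m (D m y)) +
    5 / 2 * L2_inner m (D m b) (D m b) + 1 / 2 * psi_part \<phi> y b +
    1 / 2 * pen \<epsilon>1 \<epsilon>2 (D m y) b (D m y) b"
proof -
  let ?\<psi> = "\<lambda>u. psi \<phi> ((norm (Aop m (D m (D m y)) u))\<^sup>2) ((norm (D m b u))\<^sup>2)"
  have psi: "(?\<psi> has_integral (\<Sum>j = 1..N. l j *\<^sub>R psi \<phi> ((norm (slope (D m y) j))\<^sup>2) ((norm (slope b j))\<^sup>2))) (dom m)"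
    by (rule has_integral_piecewise_const) (simp add: Bh_D[OF b] Aop_D[OF Yh_D_pwp[OF y]])
  have pcy: "pc (D m (D m y))" and pcb: "pc (D m b)"
    by (intro pwp_D_pc Yh_D_pwp Bh_pwp y b)+
  have iy: "((\<lambda>u. D m (D m y) u \<bullet> D m (D m y) u) has_integral L2_inner m (D m (D m y)) (D m (D m y))) (dom m)"
    and ib: "((\<lambda>u. D m b u \<bullet> D m b u) has_integral L2_inner m (D m b) (D m b)) (dom m)"
    unfolding L2_inner_def by (intro integrable_integral pc_integrable pc_inner pcy pcb)+
  have "integral (dom m) (\<lambda>u. D m (D m y) u \<bullet> D m (D m y) u + 5 * (D m b u \<bullet> D m b u) + ?\<psi> u)
      = L2_inner m (D m (D m y)) (D m (D m y)) + 5 * L2_inner m (D m b) (D m b) + psi_part \<phi> y b"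
    using has_integral_add[OF has_integral_add[OF iy has_integral_mult_right[OF ib, of 5]] psi]
    unfolding psi_part_def by (simp add: integral_unique)
  then show ?thesis
    unfolding energy_def P_eps_eq_pen[OF b] power2_norm_eq_inner by (simp add: algebra_simps)
qed

lemma psi_1_functional:
  assumes "y \<in> Yh m" "w \<in> Yh m" "b \<in> Bh m"
  shows "L2_inner m (\<lambda>u. psi_1 \<phi> ((norm (Aop m (D m (D m y)) u))\<^sup>2) ((norm (D m b u))\<^sup>2)
      *\<^sub>R Aop m (D m (D m y)) u) (Aop m (D m (D m w))) =
    (\<Sum>j = 1..N. l j * (psi_1 \<phi> ((norm (slope (D m y) j))\<^sup>2) ((norm (slope b j))\<^sup>2)
      * (slope (D m y) j \<bullet> slope (D m w) j)))"
  unfolding L2_inner_def real_scaleR_def[symmetric]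
  by (rule integral_unique, rule has_integral_piecewise_const)
    (simp add: Bh_D[OF assms(3)] Aop_D[OF Yh_D_pwp[OF assms(1)]] Aop_D[OF Yh_D_pwp[OF assms(2)]])

lemma psi_2_functional:
  assumes "y \<in> Yh m" "b \<in> Bh m" "r \<in> Bh m"
  shows "L2_inner m (\<lambda>u. psi_2 \<phi> ((norm (Aop m (D m (D m y)) u))\<^sup>2) ((norm (D m b u))\<^sup>2)
      *\<^sub>R D m b u) (D m r) =
    (\<Sum>j = 1..N. l j * (psi_2 \<phi> ((norm (slope (D m y) j))\<^sup>2) ((norm (slope b j))\<^sup>2)
      * (slope b j \<bullet> slope r j)))"
  unfolding L2_inner_def real_scaleR_def[symmetric]
  by (rule integral_unique, rule has_integral_piecewise_const)
    (simp add: Bh_D[OF assms(2)] Bh_D[OF assms(3)] Aop_D[OF Yh_D_pwp[OF assms(1)]])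

section \<open>Test spaces and comparison of norms\<close>

lemma tangent_Y_subspace:
  assumes "bounded_linear \<Lambda>"
  shows "fsubspace (tangent_Y m \<Lambda> y)"
proof (rule fsubspaceI)
  interpret bounded_linear \<Lambda> by fact
  have d: "0 \<in> dom m" "len m \<in> dom m" using L_pos by (auto simp: dom_eq len_eq)
  show "(\<lambda>s. 0) \<in> tangent_Y m \<Lambda> y"
    unfolding tangent_Y_def bc1_def using fsubspaceD(1)[OF Yh_subspace] d D_zero node_in_dom zero
    by (simp add: zero_prod_def)
  fix u v a assume uv: "u \<in> tangent_Y m \<Lambda> y" "v \<in> tangent_Y m \<Lambda> y"
  then have uvY: "u \<in> Yh m" "v \<in> Yh m" unfolding tangent_Y_def by auto
  have "bc1 m \<Lambda> (\<lambda>s. u s + a *\<^sub>R v s) = bc1 m \<Lambda> u + a *\<^sub>R bc1 m \<Lambda> v"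
    unfolding bc1_def using Yh_D_lincomb[OF uvY d(1)] Yh_D_lincomb[OF uvY d(2)]
    by (simp add: add[symmetric] scaleR[symmetric])
  then show "(\<lambda>s. u s + a *\<^sub>R v s) \<in> tangent_Y m \<Lambda> y"
    using uv fsubspace_lincomb[OF Yh_subspace uvY] Yh_D_lincomb[OF uvY node_in_dom]
    unfolding tangent_Y_def by (simp add: inner_add_left)
qed

lemma tangent_B_subspace:
  assumes "bounded_linear \<Lambda>"
  shows "fsubspace (tangent_B m \<Lambda> b)"
proof (rule fsubspaceI)
  interpret bounded_linear \<Lambda> by fact
  show "(\<lambda>s. 0) \<in> tangent_B m \<Lambda> b"
    unfolding tangent_B_def bc2_def using fsubspaceD(1)[OF Bh_subspace] zero
    by (simp add: zero_prod_def)
  fix u v a assume uv: "u \<in> tangent_B m \<Lambda> b" "v \<in> tangent_B m \<Lambda> b"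
  then have uvB: "u \<in> Bh m" "v \<in> Bh m" unfolding tangent_B_def by auto
  have "bc2 m \<Lambda> (\<lambda>s. u s + a *\<^sub>R v s) = bc2 m \<Lambda> u + a *\<^sub>R bc2 m \<Lambda> v"
    unfolding bc2_def by (simp flip: add scaleR)
  then show "(\<lambda>s. u s + a *\<^sub>R v s) \<in> tangent_B m \<Lambda> b"
    using uv fsubspace_lincomb[OF Bh_subspace uvB]
    unfolding tangent_B_def by (simp add: inner_add_left)
qed

text \<open>Norm comparison in finite dimension: each squared \<open>L^2\<close> seminorm serves as
  \<open>Q\<close> in \<open>finite_dim_quadratic_bound\<close>, and the sum of the two constants
  works for both spaces.\<close>

lemma ex_low_order_control:
  assumes ipS: "inner_product_on (Yh m) ipS" and ipD: "inner_product_on (Bh m) ipD"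
  shows "\<exists>C. low_order_control m ipS ipD \<Lambda>1 \<Lambda>2 C"
proof -
  have bound: "\<exists>C\<ge>0. \<forall>v\<in>V. L2_norm m (G v) \<le> C * ip_norm ip v"
    if V: "V = {y :: real \<Rightarrow> vec3. \<forall>i. (\<lambda>u. y u $ i) \<in> Spl m p k}" "fsubspace V"
      and ip: "inner_product_on V ip"
      and G: "\<And>v. v \<in> V \<Longrightarrow> continuous_on (dom m) (G v)"
        "\<And>v w a u. v \<in> V \<Longrightarrow> w \<in> V \<Longrightarrow> u \<in> dom m \<Longrightarrow> G (\<lambda>s. v s + a *\<^sub>R w s) u = G v u + a *\<^sub>R G w u"
    for V ip p k and G :: "(real \<Rightarrow> vec3) \<Rightarrow> real \<Rightarrow> vec3"
  proof -
    let ?Q = "\<lambda>v. L2_inner m (G v) (G v)"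
    note pcG = pc_continuous[OF G(1)]
    note z = fsubspaceD(1)[OF V(2)]
    have "G (\<lambda>s. 0) u = 0" if "u \<in> dom m" for u using G(2)[OF z z that, of 1] by simp
    then have scale: "G (\<lambda>s. t *\<^sub>R v s) u = t *\<^sub>R G v u" if "v \<in> V" "u \<in> dom m" for t v u
      using G(2)[OF z that, of t] that by simp
    have add: "?Q (\<lambda>s. u s + v s) \<le> 2 * ?Q u + 2 * ?Q v" if "u \<in> V" "v \<in> V" for u v
    proof -
      have "?Q (\<lambda>s. u s + v s) = L2_inner m (\<lambda>s. G u s + G v s) (\<lambda>s. G u s + G v s)"
        by (rule L2_inner_cong) (use G(2)[OF that, of _ 1] in simp_all)
      also have "\<dots> \<le> 2 * ?Q u + 2 * ?Q v" by (rule L2_inner_add_le[OF pcG pcG, OF that])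
      finally show ?thesis .
    qed
    have sc: "?Q (\<lambda>s. t *\<^sub>R v s) = t\<^sup>2 * ?Q v" if "v \<in> V" for t v
    proof -
      have "?Q (\<lambda>s. t *\<^sub>R v s) = L2_inner m (\<lambda>s. t *\<^sub>R G v s) (\<lambda>s. t *\<^sub>R G v s)"
        by (rule L2_inner_cong) (use scale[OF that] in simp_all)
      also have "\<dots> = t * L2_inner m (\<lambda>s. t *\<^sub>R G v s) (G v)" by (rule L2_inner_scaleR_right)
      also have "\<dots> = t * (t * ?Q v)"
        by (subst L2_inner_commute) (simp only: L2_inner_scaleR_right)
      finally show ?thesis by (simp add: power2_eq_square)
    qed
    obtain \<N> where N: "finite \<N>" "\<forall>f\<in>\<N>. linear_fun_on V f"
      "\<forall>v\<in>V. (\<forall>f\<in>\<N>. f v = 0) \<longrightarrow> v = (\<lambda>s. 0)"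
      using Spl_vec_separating[of p k] unfolding V(1) by blast
    have ex: "\<exists>C\<ge>0. \<forall>v\<in>V. ?Q v \<le> C * ip v v"
      by (rule finite_dim_quadratic_bound[OF N(1) V(2) inner_product_on_form(1,2)[OF V(2) ip] N(2,3)])
        (use add sc in blast)+
    then obtain C where C: "C \<ge> 0" "\<forall>v\<in>V. ?Q v \<le> C * ip v v" by blast
    have "L2_norm m (G v) \<le> sqrt C * ip_norm ip v" if "v \<in> V" for v
      unfolding L2_norm_def ip_norm_def real_sqrt_mult[symmetric] using C that by (simp del: real_sqrt_mult)
    then show ?thesis using C(1) by (intro exI[of _ "sqrt C"]) auto
  qed
  obtain C1 where C1: "C1 \<ge> 0" "\<forall>v\<in>Yh m. L2_norm m (D m v) \<le> C1 * ip_norm ipS v"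
    using bound[OF Yh_def Yh_subspace ipS, of "D m"] pwp_continuous Yh_D_pwp Yh_D_lincomb by blast
  obtain C2 where C2: "C2 \<ge> 0" "\<forall>v\<in>Bh m. L2_norm m v \<le> C2 * ip_norm ipD v"
    using bound[OF Bh_def Bh_subspace ipD, of "\<lambda>v. v"] pwp_continuous Bh_pwp by blast
  have nn: "0 \<le> ip_norm ipS v" if "v \<in> Yh m" for v
    using inner_product_on_form(3)[OF Yh_subspace ipS that] unfolding ip_norm_def by simp
  have nn': "0 \<le> ip_norm ipD v" if "v \<in> Bh m" for v
    using inner_product_on_form(3)[OF Bh_subspace ipD that] unfolding ip_norm_def by simp
  have "low_order_control m ipS ipD \<Lambda>1 \<Lambda>2 (C1 + C2)"
    unfolding low_order_control_def
  proof (intro conjI ballI impI)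
    fix w assume w: "w \<in> Yh m"
    show "L2_norm m (D m w) \<le> (C1 + C2) * ip_norm ipS w"
      using C1(2) w mult_nonneg_nonneg[OF C2(1) nn[OF w]] by (force simp: distrib_right)
  next
    fix r assume r: "r \<in> Bh m"
    show "L2_norm m r \<le> (C1 + C2) * ip_norm ipD r"
      using C2(2) r mult_nonneg_nonneg[OF C1(1) nn'[OF r]] by (force simp: distrib_right)
  qed
  then show ?thesis by blast
qed

end

section \<open>The scheme\<close>

text \<open>The factors come from \<open>psi_remainder\<close>, from \<open>hessian_factor\<close>
  and from the bounds on \<open>w''\<close> and \<open>r'\<close>. The summand 1 and
  \<open>max e 0\<close> make the function positive and monotone on all reals.\<close>

definition ced_bound :: "real \<Rightarrow> real \<Rightarrow> real \<Rightarrow> real \<Rightarrow> real \<Rightarrow> real \<Rightarrow> real \<Rightarrow> real" where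
  "ced_bound c c0 c1 c2 cstar cdag e = 1 + (3 * psi_lip c1 + 5 * psi_hess c0 c1 c2) *
     (2 / c0 + 2 / c) * (cstar\<^sup>2 + cdag\<^sup>2) * max e 0"

lemma ced_bound_mono_pos:
  assumes "c > 0" "c0 > 0" "c1 > 0" "c2 > 0"
  shows "mono (ced_bound c c0 c1 c2 cstar cdag)" "ced_bound c c0 c1 c2 cstar cdag e > 0"
proof -
  have *: "0 \<le> (3 * psi_lip c1 + 5 * psi_hess c0 c1 c2) * (2 / c0 + 2 / c) * (cstar\<^sup>2 + cdag\<^sup>2)"
    using assms unfolding psi_lip_def psi_hess_def by (intro mult_nonneg_nonneg add_nonneg_nonneg) auto
  show "mono (ced_bound c c0 c1 c2 cstar cdag)"
    unfolding ced_bound_def using * by (auto intro!: monoI mult_left_mono)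
  show "ced_bound c c0 c1 c2 cstar cdag e > 0"
    unfolding ced_bound_def using mult_nonneg_nonneg[OF *, of "max e 0"] by simp
qed

locale scheme = mesh_partition m L + regularized \<phi> \<phi>' \<phi>'' c0 c1 c2 \<delta>
  for m :: mesh and L :: real and \<phi> \<phi>' \<phi>'' :: "real \<Rightarrow> real" and c0 c1 c2 \<delta> :: real +
  fixes c cstar cdag \<epsilon>1 \<epsilon>2 \<tau> :: real
    and ipS ipD :: "(real \<Rightarrow> vec3) \<Rightarrow> (real \<Rightarrow> vec3) \<Rightarrow> real"
    and \<Lambda>1 :: "vec3 \<times> vec3 \<times> vec3 \<times> vec3 \<Rightarrow> 'm::real_normed_vector"
    and \<Lambda>2 :: "vec3 \<times> vec3 \<Rightarrow> 'n::real_normed_vector"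
  assumes c: "c > 0" and qu: "quasiuniform c m"
    and ipS: "inner_product_on (Yh m) ipS" and ipD: "inner_product_on (Bh m) ipD"
    and star: "w \<in> Yh m \<Longrightarrow> L2_norm m (D m (D m w)) \<le> cstar * ip_norm ipS w"
    and dagger: "r \<in> Bh m \<Longrightarrow> L2_norm m (D m r) \<le> cdag * ip_norm ipD r"
    and bl1: "bounded_linear \<Lambda>1" and bl2: "bounded_linear \<Lambda>2"
    and eps: "\<epsilon>1 > 0" "\<epsilon>2 > 0" and tau: "\<tau> > 0"
begin

abbreviation energy' where "energy' \<equiv> energy m \<phi> \<epsilon>1 \<epsilon>2"
abbreviation pen' where "pen' \<equiv> pen \<epsilon>1 \<epsilon>2"
abbreviation ced where "ced \<equiv> ced_bound c c0 c1 c2 cstar cdag"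
abbreviation TY where "TY \<equiv> tangent_Y m \<Lambda>1"
abbreviation TB where "TB \<equiv> tangent_B m \<Lambda>2"
abbreviation quot where "quot a a' \<equiv> (\<lambda>s. (1 / \<tau>) *\<^sub>R (a' s - a s) :: vec3)"

section \<open>The two steps as linear problems and their unique solvability\<close>

definition form_Y where
  "form_Y b v w = L2_inner m (D m (D m v)) (D m (D m w)) + pen' (D m v) b (D m w) b"

definition form_B where
  "form_B y v w = 5 * L2_inner m (D m v) (D m w) + pen' (D m y) v (D m y) w"

definition rhs_Y where
  "rhs_Y y b w = - (\<Sum>j = 1..N. l j * (psi_1 \<phi> ((norm (slope (D m y) j))\<^sup>2) ((norm (slope b j))\<^sup>2)
      * (slope (D m y) j \<bullet> slope (D m w) j)))"

definition rhs_B where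
  "rhs_B y b r = - (\<Sum>j = 1..N. l j * (psi_2 \<phi> ((norm (slope (D m y) j))\<^sup>2) ((norm (slope b j))\<^sup>2)
      * (slope b j \<bullet> slope r j)))"

definition Y_update where
  "Y_update y b y' \<longleftrightarrow> y' \<in> Yh m \<and> quot y y' \<in> TY y \<and>
     (\<forall>w\<in>TY y. ipS (quot y y') w + form_Y b y' w = rhs_Y y b w)"

text \<open>Both the old and the new \<open>y\<close> occur: the explicit term uses the old one, the
  implicit penalty the new one.\<close>

definition B_update where
  "B_update y y' b b' \<longleftrightarrow> b' \<in> Bh m \<and> quot b b' \<in> TB b \<and>
     (\<forall>r\<in>TB b. ipD (quot b b') r + form_B y' b' r = rhs_B y b r)"

lemma TY_subset: "TY y \<subseteq> Yh m" and TB_subset: "TB b \<subseteq> Bh m"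
  unfolding tangent_Y_def tangent_B_def by auto

lemma sym_form_Y: "sym_form_on (Yh m) (form_Y b)"
  unfolding form_Y_def by (intro sym_form_on_add DD_form_Y pen_form_Y)

lemma sym_form_B: "sym_form_on (Bh m) (form_B y)"
  unfolding form_B_def by (intro sym_form_on_add sym_form_on_mult D_form_B pen_form_B)

lemma form_Y_nonneg: "v \<in> Yh m \<Longrightarrow> 0 \<le> form_Y b v v"
  unfolding form_Y_def using L2_inner_nonneg[OF pwp_D_pc[OF Yh_D_pwp]] pen_nonneg[OF eps] by simp

lemma form_B_nonneg: "v \<in> Bh m \<Longrightarrow> 0 \<le> form_B y v v"
  unfolding form_B_def using L2_inner_nonneg[OF pwp_D_pc[OF Bh_pwp]] pen_nonneg[OF eps] by simp

lemma rhs_Y_linear: "linear_fun_on (Yh m) (rhs_Y y b)"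
  by (rule linear_fun_onI[OF Yh_subspace])
    (simp add: rhs_Y_def slope_D_lincomb inner_add_right algebra_simps sum.distrib sum_distrib_left)

lemma rhs_B_linear: "linear_fun_on (Bh m) (rhs_B y b)"
  by (rule linear_fun_onI[OF Bh_subspace])
    (simp add: rhs_B_def slope_lincomb inner_add_right algebra_simps sum.distrib sum_distrib_left)

lemma ex1_Y_update:
  assumes "y \<in> Yh m"
  shows "\<exists>!y'. Y_update y b y'"
proof -
  obtain \<N> where N: "finite \<N>" "\<forall>f\<in>\<N>. linear_fun_on (Yh m) f"
    "\<forall>v\<in>Yh m. (\<forall>f\<in>\<N>. f v = 0) \<longrightarrow> v = (\<lambda>s. 0)"
    using Spl_vec_separating[of 3 1] unfolding Yh_def by blast
  show ?thesis
    unfolding Y_update_def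
    by (rule implicit_step[OF N Yh_subspace tangent_Y_subspace[OF bl1] TY_subset
          inner_product_on_form(1,2)[OF Yh_subspace ipS] sym_form_Y _
          linear_fun_on_subset[OF rhs_Y_linear TY_subset] tau assms])
      (use form_Y_nonneg in blast)
qed

lemma ex1_B_update:
  assumes "b \<in> Bh m"
  shows "\<exists>!b'. B_update y y' b b'"
proof -
  obtain \<N> where N: "finite \<N>" "\<forall>f\<in>\<N>. linear_fun_on (Bh m) f"
    "\<forall>v\<in>Bh m. (\<forall>f\<in>\<N>. f v = 0) \<longrightarrow> v = (\<lambda>s. 0)"
    using Spl_vec_separating[of 1 0] unfolding Bh_def by blast
  show ?thesis
    unfolding B_update_def
    by (rule implicit_step[OF N Bh_subspace tangent_B_subspace[OF bl2] TB_subset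
          inner_product_on_form(1,2)[OF Bh_subspace ipD] sym_form_B _
          linear_fun_on_subset[OF rhs_B_linear TB_subset] tau assms])
      (use form_B_nonneg in blast)
qed

lemma y_step_iff:
  assumes "y (k - 1) \<in> Yh m" "b (k - 1) \<in> Bh m"
  shows "y_step m \<phi> \<epsilon>1 \<epsilon>2 ipS \<Lambda>1 \<tau> y b k \<longleftrightarrow> Y_update (y (k - 1)) (b (k - 1)) (y k)"
proof -
  have dt: "dt \<tau> y k = quot (y (k - 1)) (y k)" unfolding dt_def by (rule ext) simp
  have "ipS d w + L2_inner m (D m (D m (y k))) (D m (D m w)) + dP_y m \<epsilon>1 \<epsilon>2 (y k) (b (k - 1)) w =
      ipS d w + form_Y (b (k - 1)) (y k) w"
    if "y k \<in> Yh m" "w \<in> Yh m" for w d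
    unfolding form_Y_def dP_y_eq[OF that assms(2)] by simp
  then show ?thesis
    unfolding y_step_def Y_update_def dt rhs_Y_def
    using psi_1_functional[OF assms(1) _ assms(2)] TY_subset
    by (intro conj_cong refl ball_cong) (simp_all only: subset_iff)
qed

lemma b_step_iff:
  assumes "y (k - 1) \<in> Yh m" "b (k - 1) \<in> Bh m"
  shows "b_step m \<phi> \<epsilon>1 \<epsilon>2 ipD \<Lambda>2 \<tau> y b k \<longleftrightarrow> B_update (y (k - 1)) (y k) (b (k - 1)) (b k)"
proof -
  have dt: "dt \<tau> b k = quot (b (k - 1)) (b k)" unfolding dt_def by (rule ext) simp
  have "ipD d r + 5 * L2_inner m (D m (b k)) (D m r) + dP_b m \<epsilon>1 \<epsilon>2 (y k) (b k) r =
      ipD d r + form_B (y k) (b k) r"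
    if "b k \<in> Bh m" "r \<in> Bh m" for r d
    unfolding form_B_def dP_b_eq[OF that] by simp
  then show ?thesis
    unfolding b_step_def B_update_def dt rhs_B_def
    using psi_2_functional[OF assms] TB_subset
    by (intro conj_cong refl ball_cong) (simp_all only: subset_iff)
qed

lemma iterates_mem:
  assumes "iterates m \<phi> \<epsilon>1 \<epsilon>2 ipS ipD \<Lambda>1 \<Lambda>2 \<tau> y0 b0 y b" "y0 \<in> Yh m" "b0 \<in> Bh m"
  shows "y k \<in> Yh m" "b k \<in> Bh m"
  using assms by (cases k; simp add: iterates_def y_step_def b_step_def)+

lemma iterates_update:
  assumes it: "iterates m \<phi> \<epsilon>1 \<epsilon>2 ipS ipD \<Lambda>1 \<Lambda>2 \<tau> y0 b0 y b" "y0 \<in> Yh m" "b0 \<in> Bh m"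
  shows "Y_update (y k) (b k) (y (Suc k))" "B_update (y k) (y (Suc k)) (b k) (b (Suc k))"
proof -
  have "y_step m \<phi> \<epsilon>1 \<epsilon>2 ipS \<Lambda>1 \<tau> y b (Suc k) \<and> b_step m \<phi> \<epsilon>1 \<epsilon>2 ipD \<Lambda>2 \<tau> y b (Suc k)"
    using it(1) unfolding iterates_def by auto
  then show "Y_update (y k) (b k) (y (Suc k))" "B_update (y k) (y (Suc k)) (b k) (b (Suc k))"
    using y_step_iff[of y "Suc k" b] b_step_iff[of y "Suc k" b] iterates_mem[OF it, of k] by auto
qed

lemma ex1_iterates:
  assumes y0: "y0 \<in> Yh m" and b0: "b0 \<in> Bh m"
  shows "\<exists>!(y, b). iterates m \<phi> \<epsilon>1 \<epsilon>2 ipS ipD \<Lambda>1 \<Lambda>2 \<tau> y0 b0 y b"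
proof -
  \<comment> \<open>The \<open>b\<close>-step is solved after the \<open>y\<close>-step because its
    form contains the new \<open>y\<close>.\<close>
  define next' where "next' = (\<lambda>(y, b). let y' = THE z. Y_update y b z in (y', THE z. B_update y y' b z))"
  define s where "s = rec_nat (y0, b0) (\<lambda>_. next')"
  have Y: "Y_update y b (THE z. Y_update y b z)" if "y \<in> Yh m" for y b
    by (rule theI'[OF ex1_Y_update[OF that]])
  have B: "B_update y y' b (THE z. B_update y y' b z)" if "b \<in> Bh m" for y y' b
    by (rule theI'[OF ex1_B_update[OF that]])
  have s0: "s 0 = (y0, b0)" and sS: "s (Suc k) = next' (s k)" for k unfolding s_def by simp_all
  have upd: "Y_update (fst (s k)) (snd (s k)) (fst (s (Suc k))) \<and>
      B_update (fst (s k)) (fst (s (Suc k))) (snd (s k)) (snd (s (Suc k)))"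
    if "fst (s k) \<in> Yh m \<and> snd (s k) \<in> Bh m" for k
    unfolding sS next'_def using Y B that by (auto simp: Let_def split: prod.splits)
  have mem: "fst (s k) \<in> Yh m \<and> snd (s k) \<in> Bh m" for k
  proof (induction k)
    case (Suc k)
    show ?case using upd[OF Suc] unfolding Y_update_def B_update_def by blast
  qed (use s0 y0 b0 in simp)
  note upd = upd[OF mem]
  have it: "iterates m \<phi> \<epsilon>1 \<epsilon>2 ipS ipD \<Lambda>1 \<Lambda>2 \<tau> y0 b0 (fst \<circ> s) (snd \<circ> s)"
    unfolding iterates_def
  proof (intro conjI allI impI)
    fix k :: nat assume "1 \<le> k"
    then show "y_step m \<phi> \<epsilon>1 \<epsilon>2 ipS \<Lambda>1 \<tau> (fst \<circ> s) (snd \<circ> s) k"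
      "b_step m \<phi> \<epsilon>1 \<epsilon>2 ipD \<Lambda>2 \<tau> (fst \<circ> s) (snd \<circ> s) k"
      using upd[of "k - 1"] mem[of "k - 1"] by (simp_all add: y_step_iff b_step_iff)
  qed (simp_all add: s0)
  have uniq: "(y, b) = (fst \<circ> s, snd \<circ> s)"
    if *: "iterates m \<phi> \<epsilon>1 \<epsilon>2 ipS ipD \<Lambda>1 \<Lambda>2 \<tau> y0 b0 y b" for y b
  proof -
    have "y k = fst (s k) \<and> b k = snd (s k)" for k
    proof (induction k)
      case 0
      then show ?case using * s0 unfolding iterates_def by simp
    next
      case (Suc k)
      note u = iterates_update[OF * y0 b0, of k]
      have v: "Y_update (y k) (b k) (fst (s (Suc k)))" "B_update (y k) (fst (s (Suc k))) (b k) (snd (s (Suc k)))"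
        using upd[of k] Suc by simp_all
      have eq: "y (Suc k) = fst (s (Suc k))"
        using ex1_Y_update[OF iterates_mem(1)[OF * y0 b0]] u(1) v(1) by blast
      have "b (Suc k) = snd (s (Suc k))"
        using ex1_B_update[OF iterates_mem(2)[OF * y0 b0]] u(2) v(2) unfolding eq by blast
      then show ?case using eq by blast
    qed
    then show ?thesis by (auto simp: fun_eq_iff)
  qed
  show ?thesis
  proof (rule ex1I[of _ "(fst \<circ> s, snd \<circ> s)"], unfold prod.case, rule it)
    fix p :: "(nat \<Rightarrow> real \<Rightarrow> vec3) \<times> (nat \<Rightarrow> real \<Rightarrow> vec3)"
    obtain y b where p: "p = (y, b)" by (rule prod.exhaust)
    assume "case p of (y, b) \<Rightarrow> iterates m \<phi> \<epsilon>1 \<epsilon>2 ipS ipD \<Lambda>1 \<Lambda>2 \<tau> y0 b0 y b"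
    then show "p = (fst \<circ> s, snd \<circ> s)" unfolding p prod.case by (rule uniq)
  qed
qed

section \<open>Lower bounds for the energy and dissipation in one step\<close>

lemma psi_part_ge: "L * (c0 * \<delta>) \<le> psi_part \<phi> y b"
proof -
  have "(\<Sum>j = 1..N. l j * (c0 * \<delta>)) \<le> psi_part \<phi> y b"
    unfolding psi_part_def using elem_length_pos
    by (intro sum_mono mult_left_mono psi_ge) (auto simp: less_imp_le)
  then show ?thesis unfolding sum_distrib_right[symmetric] sum_elem_length .
qed

lemma energy_bounds:
  assumes y: "y \<in> Yh m" and b: "b \<in> Bh m"
  shows "L2_inner m (D m (D m y)) (D m (D m y)) + L2_inner m (D m b) (D m b) \<le> 2 * energy' y b"
    "L * (c0 * \<delta>) \<le> 2 * energy' y b" "0 < energy' y b"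
proof -
  note L2_inner_nonneg[OF pwp_D_pc[OF Yh_D_pwp[OF y]]] L2_inner_nonneg[OF pwp_D_pc[OF Bh_pwp[OF b]]]
    pen_nonneg[OF eps, of "D m y" b] psi_part_ge[of y b] energy_eq[OF y b, of \<phi> \<epsilon>1 \<epsilon>2]
  moreover have "0 < L * (c0 * \<delta>)" using L_pos pos by simp
  ultimately show "L2_inner m (D m (D m y)) (D m (D m y)) + L2_inner m (D m b) (D m b) \<le> 2 * energy' y b"
    "L * (c0 * \<delta>) \<le> 2 * energy' y b" "0 < energy' y b"
    by linarith+
qed

lemma K_nonneg: "0 \<le> 3 * K1 + 5 * K2"
  using pos unfolding psi_lip_def psi_hess_def by (intro add_nonneg_nonneg) auto

text \<open>The inverse estimate on an element produces the factor \<open>1 / h\<close>.  No upper bound on \<open>\<delta>\<close> is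
  needed since \<open>psi \<ge> c0 * \<delta>\<close> makes the energy at least \<open>L * c0 * \<delta> / 2\<close>.\<close>

lemma hessian_factor:
  assumes y: "y \<in> Yh m" and b: "b \<in> Bh m" and j: "j \<in> {1..N}"
  shows "1 + ((norm (slope (D m y) j))\<^sup>2 + (norm (slope b j))\<^sup>2) / \<delta>
    \<le> (2 / c0 + 2 / c) * energy' y b / (\<delta> * mesh_size m)"
proof -
  define M where "M = (norm (slope (D m y) j))\<^sup>2 + (norm (slope b j))\<^sup>2"
  define h where "h = mesh_size m"
  define E where "E = energy' y b"
  have h: "h > 0" "h \<le> L" unfolding h_def by (rule mesh_size_pos mesh_size_le)+
  have lj: "c * h \<le> l j" using qu j unfolding quasiuniform_def h_def by blast
  have elem_le: "l j * (norm (slope f j))\<^sup>2 \<le> L2_inner m (D m f) (D m f)" if "pwp f" for f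
  proof -
    have "l j * (norm (slope f j))\<^sup>2 \<le> (\<Sum>j = 1..N. l j * (norm (slope f j))\<^sup>2)"
      using j elem_length_pos by (intro member_le_sum) (auto simp: less_imp_le)
    then show ?thesis using slope_L2[OF that] L2_norm_square[OF pwp_D_pc[OF that]] by simp
  qed
  \<comment> \<open>Inverse estimate: by quasiuniformity the element length is at least
    \<open>c h\<close>, and the contribution of one element is at most the global norm.\<close>
  have "c * h * M \<le> l j * M" using lj by (intro mult_right_mono) (auto simp: M_def)
  also have "\<dots> \<le> 2 * E"
    unfolding M_def E_def distrib_left
    using elem_le[OF Yh_D_pwp[OF y]] elem_le[OF Bh_pwp[OF b]] energy_bounds(1)[OF y b] by linarith
  finally have M: "h * M \<le> 2 / c * E" using c by (simp add: field_simps)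
  \<comment> \<open>The summand 1 in the claim is \<open>\<delta> h / (\<delta> h)\<close>; its
    numerator is bounded by the energy because \<open>h \<le> L\<close>.\<close>
  have "h * (c0 * \<delta>) \<le> L * (c0 * \<delta>)" using h pos by (intro mult_right_mono) auto
  also have "\<dots> \<le> 2 * E" unfolding E_def by (rule energy_bounds(2)[OF y b])
  finally have d: "\<delta> * h \<le> 2 / c0 * E" using pos by (simp add: field_simps)
  have "1 + M / \<delta> = (\<delta> * h + h * M) / (\<delta> * h)" using h pos by (simp add: field_simps)
  also have "\<dots> \<le> (2 / c0 + 2 / c) * E / (\<delta> * h)"
    using M d h pos by (intro divide_right_mono) (auto simp: distrib_right)
  finally show ?thesis unfolding M_def h_def E_def .
qed

lemma ip_norm_square:
  "w \<in> Yh m \<Longrightarrow> (ip_norm ipS w)\<^sup>2 = ipS w w" "r \<in> Bh m \<Longrightarrow> (ip_norm ipD r)\<^sup>2 = ipD r r"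
  unfolding ip_norm_def
  using inner_product_on_form(3)[OF Yh_subspace ipS] inner_product_on_form(3)[OF Bh_subspace ipD] by simp_all

lemma L2_square_le:
  assumes "L2_norm m f \<le> a * x" "pc f"
  shows "(L2_norm m f)\<^sup>2 \<le> a\<^sup>2 * x\<^sup>2"
  using power_mono[OF assms(1), of 2] L2_inner_nonneg[OF assms(2)]
  by (simp add: L2_norm_def power_mult_distrib)

text \<open>Each step is tested with its own increment, which is admissible since increments lie in
  the test space.\<close>

lemma energy_step:
  assumes y: "y \<in> Yh m" and b: "b \<in> Bh m" and Y: "Y_update y b y'" and B: "B_update y y' b b'"
    and e: "energy' y b \<le> e"
  shows "energy' y' b' + (1 - ced e * \<tau> * (1 / \<delta>) * (1 / mesh_size m)) * \<tau> *
      ((ip_norm ipS (quot y y'))\<^sup>2 + (ip_norm ipD (quot b b'))\<^sup>2) \<le> energy' y b"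
proof -
  define d r where "d = quot y y'" and "r = quot b b'"
  define S where "S = (ip_norm ipS d)\<^sup>2 + (ip_norm ipD r)\<^sup>2"
  define E where "E = energy' y b"
  define h where "h = mesh_size m"
  define K where "K = (3 * K1 + 5 * K2) * ((2 / c0 + 2 / c) * E / (\<delta> * h))"
  have h: "h > 0" unfolding h_def by (rule mesh_size_pos)
  have E: "0 < E" unfolding E_def by (rule energy_bounds(3)[OF y b])
  have y': "y' \<in> Yh m" and dT: "d \<in> TY y" and d_eq: "ipS d d + form_Y b y' d = rhs_Y y b d"
    using Y unfolding Y_update_def d_def by auto
  have b': "b' \<in> Bh m" and rT: "r \<in> TB b" and r_eq: "ipD r r + form_B y' b' r = rhs_B y b r"
    using B unfolding B_update_def r_def by auto
  have dY: "d \<in> Yh m" and rB: "r \<in> Bh m" using dT rT TY_subset TB_subset by auto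
  have y'_eq: "y' = (\<lambda>s. y s + \<tau> *\<^sub>R d s)" and b'_eq: "b' = (\<lambda>s. b s + \<tau> *\<^sub>R r s)"
    unfolding d_def r_def using tau by auto
  define P p Q q where "P = slope (D m y)" and "p = slope (D m d)" and "Q = slope b" and "q = slope r"
  define R where "R j = (norm (P j))\<^sup>2" for j
  define T where "T j = (norm (Q j))\<^sup>2" for j
  have P': "slope (D m y') j = P j + \<tau> *\<^sub>R p j" if "j \<in> {1..N}" for j
    unfolding y'_eq P_def p_def by (rule slope_D_lincomb[OF y dY that])
  have Q': "slope b' j = Q j + \<tau> *\<^sub>R q j" for j
    unfolding b'_eq Q_def q_def by (rule slope_lincomb)
  have K0: "0 \<le> K" unfolding K_def using K_nonneg E pos c h by simp
  \<comment> \<open>The right-hand sides carry a minus sign, so adding them subtracts the linear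
    Taylor terms; \<open>psi_remainder\<close> then applies on every element with a common factor
    \<open>K\<close>.\<close>
  have psi: "1 / 2 * psi_part \<phi> y' b' - 1 / 2 * psi_part \<phi> y b + \<tau> * rhs_Y y b d + \<tau> * rhs_B y b r
      \<le> K * \<tau>\<^sup>2 * (\<Sum>j = 1..N. l j * ((norm (p j))\<^sup>2 + (norm (q j))\<^sup>2))"
  proof -
    have "1 / 2 * psi_part \<phi> y' b' - 1 / 2 * psi_part \<phi> y b + \<tau> * rhs_Y y b d + \<tau> * rhs_B y b r =
        (\<Sum>j = 1..N. l j * (1/2 * psi \<phi> ((norm (P j + \<tau> *\<^sub>R p j))\<^sup>2) ((norm (Q j + \<tau> *\<^sub>R q j))\<^sup>2) - 1/2 * psi \<phi> (R j) (T j)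
          - psi_1 \<phi> (R j) (T j) * (P j \<bullet> \<tau> *\<^sub>R p j) - psi_2 \<phi> (R j) (T j) * (Q j \<bullet> \<tau> *\<^sub>R q j)))"
      unfolding psi_part_def rhs_Y_def rhs_B_def R_def T_def Q' P_def[symmetric] Q_def[symmetric] p_def[symmetric] q_def[symmetric]
      using P' by (simp add: algebra_simps sum.distrib sum_subtractf sum_distrib_left sum_divide_distrib)
    also have "\<dots> \<le> (\<Sum>j = 1..N. l j * (K * ((norm (\<tau> *\<^sub>R p j))\<^sup>2 + (norm (\<tau> *\<^sub>R q j))\<^sup>2)))"
    proof (intro sum_mono mult_left_mono)
      fix j assume j: "j \<in> {1..N}"
      show "0 \<le> l j" using elem_length_pos[OF j] by simp
      have "(3 * K1 + 5 * K2) * (1 + (R j + T j) / \<delta>) \<le> K"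
        unfolding K_def R_def T_def P_def Q_def E_def h_def
        by (rule mult_left_mono[OF hessian_factor[OF y b j] K_nonneg])
      then have "(3 * K1 + 5 * K2) * (1 + (R j + T j) / \<delta>) * ((norm (\<tau> *\<^sub>R p j))\<^sup>2 + (norm (\<tau> *\<^sub>R q j))\<^sup>2)
          \<le> K * ((norm (\<tau> *\<^sub>R p j))\<^sup>2 + (norm (\<tau> *\<^sub>R q j))\<^sup>2)"
        by (rule mult_right_mono) simp
      then show "1/2 * psi \<phi> ((norm (P j + \<tau> *\<^sub>R p j))\<^sup>2) ((norm (Q j + \<tau> *\<^sub>R q j))\<^sup>2) - 1/2 * psi \<phi> (R j) (T j)
          - psi_1 \<phi> (R j) (T j) * (P j \<bullet> \<tau> *\<^sub>R p j) - psi_2 \<phi> (R j) (T j) * (Q j \<bullet> \<tau> *\<^sub>R q j)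
          \<le> K * ((norm (\<tau> *\<^sub>R p j))\<^sup>2 + (norm (\<tau> *\<^sub>R q j))\<^sup>2)"
        using psi_remainder[of "P j" "\<tau> *\<^sub>R p j" "Q j" "\<tau> *\<^sub>R q j"] unfolding R_def T_def
        by (rule order_trans[rotated])
    qed
    also have "\<dots> = K * \<tau>\<^sup>2 * (\<Sum>j = 1..N. l j * ((norm (p j))\<^sup>2 + (norm (q j))\<^sup>2))"
      by (simp add: power_mult_distrib sum_distrib_left algebra_simps)
    finally show ?thesis .
  qed
  have "(\<Sum>j = 1..N. l j * ((norm (p j))\<^sup>2 + (norm (q j))\<^sup>2)) \<le> (cstar\<^sup>2 + cdag\<^sup>2) * S"
  proof -
    have "(\<Sum>j = 1..N. l j * ((norm (p j))\<^sup>2 + (norm (q j))\<^sup>2))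
        = (\<Sum>j = 1..N. l j * (norm (p j))\<^sup>2) + (\<Sum>j = 1..N. l j * (norm (q j))\<^sup>2)"
      by (simp add: distrib_left sum.distrib)
    also have "\<dots> \<le> (L2_norm m (D m (D m d)))\<^sup>2 + (L2_norm m (D m r))\<^sup>2"
      unfolding p_def q_def by (intro add_mono slope_L2 Yh_D_pwp Bh_pwp dY rB)
    also have "\<dots> \<le> cstar\<^sup>2 * (ip_norm ipS d)\<^sup>2 + cdag\<^sup>2 * (ip_norm ipD r)\<^sup>2"
      by (intro add_mono L2_square_le star dagger dY rB pwp_D_pc Yh_D_pwp Bh_pwp)
    also have "\<dots> \<le> (cstar\<^sup>2 + cdag\<^sup>2) * S"
      unfolding S_def by (simp add: algebra_simps)
    finally show ?thesis .
  qed
  then have "K * \<tau>\<^sup>2 * (\<Sum>j = 1..N. l j * ((norm (p j))\<^sup>2 + (norm (q j))\<^sup>2)) \<le> K * \<tau>\<^sup>2 * ((cstar\<^sup>2 + cdag\<^sup>2) * S)"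
    using K0 by (intro mult_left_mono) auto
  also have "\<dots> = (3 * K1 + 5 * K2) * (2 / c0 + 2 / c) * (cstar\<^sup>2 + cdag\<^sup>2) * E * (\<tau>\<^sup>2 * S / (\<delta> * h))"
    unfolding K_def by (simp add: mult_ac)
  also have "\<dots> \<le> ced e * (\<tau>\<^sup>2 * S / (\<delta> * h))"
  proof (rule mult_right_mono)
    have "(3 * K1 + 5 * K2) * (2 / c0 + 2 / c) * (cstar\<^sup>2 + cdag\<^sup>2) * E
        \<le> (3 * K1 + 5 * K2) * (2 / c0 + 2 / c) * (cstar\<^sup>2 + cdag\<^sup>2) * max e 0"
      using e K_nonneg pos c unfolding E_def[symmetric] by (intro mult_left_mono) auto
    then show "(3 * K1 + 5 * K2) * (2 / c0 + 2 / c) * (cstar\<^sup>2 + cdag\<^sup>2) * E \<le> ced e"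
      unfolding ced_bound_def by simp
    show "0 \<le> \<tau>\<^sup>2 * S / (\<delta> * h)" unfolding S_def using pos h by simp
  qed
  finally have rem: "K * \<tau>\<^sup>2 * (\<Sum>j = 1..N. l j * ((norm (p j))\<^sup>2 + (norm (q j))\<^sup>2)) \<le> ced e * (\<tau>\<^sup>2 * S / (\<delta> * h))" .
  have FY: "1 / 2 * form_Y b y' y' - 1 / 2 * form_Y b y y \<le> \<tau> * form_Y b y' d"
    by (rule sym_form_increment_le[OF Yh_subspace sym_form_Y form_Y_nonneg y dY y'_eq])
  have FB: "1 / 2 * form_B y' b' b' - 1 / 2 * form_B y' b b \<le> \<tau> * form_B y' b' r"
    by (rule sym_form_increment_le[OF Bh_subspace sym_form_B form_B_nonneg b rB b'_eq])
  \<comment> \<open>\<open>form_Y b y' y'\<close> and \<open>form_B y' b b\<close> contain the same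
    penalty value at \<open>(y', b)\<close>, which cancels.\<close>
  have "energy' y' b' - energy' y b = (1 / 2 * form_Y b y' y' - 1 / 2 * form_Y b y y) +
      (1 / 2 * form_B y' b' b' - 1 / 2 * form_B y' b b) + (1 / 2 * psi_part \<phi> y' b' - 1 / 2 * psi_part \<phi> y b)"
    unfolding energy_eq[OF y' b'] energy_eq[OF y b] form_Y_def form_B_def by (simp add: field_simps)
  also have "\<dots> \<le> \<tau> * form_Y b y' d + \<tau> * form_B y' b' r + (1 / 2 * psi_part \<phi> y' b' - 1 / 2 * psi_part \<phi> y b)"
    using FY FB by simp
  also have "\<tau> * form_Y b y' d = \<tau> * rhs_Y y b d - \<tau> * ipS d d"
    unfolding d_eq[symmetric] by (simp add: algebra_simps)
  also have "\<tau> * form_B y' b' r = \<tau> * rhs_B y b r - \<tau> * ipD r r"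
    unfolding r_eq[symmetric] by (simp add: algebra_simps)
  finally have "energy' y' b' - energy' y b \<le> - (\<tau> * S) + ced e * (\<tau>\<^sup>2 * S / (\<delta> * h))"
    using psi rem unfolding S_def ip_norm_square(1)[OF dY] ip_norm_square(2)[OF rB] by (simp add: distrib_left)
  then have "energy' y' b' + (1 - ced e * \<tau> * (1 / \<delta>) * (1 / h)) * \<tau> * S \<le> energy' y b"
    by (simp add: algebra_simps power2_eq_square)
  then show ?thesis unfolding S_def d_def r_def h_def .
qed

section \<open>Estimates along a sequence of iterates\<close>

context
  fixes y0 b0 y b
  assumes it: "iterates m \<phi> \<epsilon>1 \<epsilon>2 ipS ipD \<Lambda>1 \<Lambda>2 \<tau> y0 b0 y b" and y0: "y0 \<in> Yh m" and b0: "b0 \<in> Bh m"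
begin

definition "S k = (ip_norm ipS (dt \<tau> y k))\<^sup>2 + (ip_norm ipD (dt \<tau> b k))\<^sup>2"

lemma S_nonneg: "0 \<le> S k" unfolding S_def by simp

lemma dt_Suc: "dt \<tau> y (Suc k) = quot (y k) (y (Suc k))" "dt \<tau> b (Suc k) = quot (b k) (b (Suc k))"
  unfolding dt_def by (rule ext, simp)+

lemma dt_mem: "dt \<tau> y (Suc k) \<in> TY (y k)" "dt \<tau> b (Suc k) \<in> TB (b k)"
  using iterates_update[OF it y0 b0, of k] unfolding dt_Suc Y_update_def B_update_def by auto

lemma iterates_energy_step:
  assumes "energy' (y k) (b k) \<le> e"
  shows "energy' (y (Suc k)) (b (Suc k)) + (1 - ced e * \<tau> * (1 / \<delta>) * (1 / mesh_size m)) * \<tau> * S (Suc k)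
    \<le> energy' (y k) (b k)"
  unfolding S_def dt_Suc
  using energy_step[OF iterates_mem[OF it y0 b0] iterates_update[OF it y0 b0] assms] .

text \<open>Telescoping. The energy bound is asked only for \<open>k < K\<close>, as each step uses
  the constant at its old iterate.\<close>

lemma energy_estimate_bounded:
  assumes "\<And>k. k < K \<Longrightarrow> energy' (y k) (b k) \<le> e"
  shows "energy_estimate m \<phi> \<epsilon>1 \<epsilon>2 ipS ipD \<delta> \<tau> (ced e) y b K"
proof -
  have "n \<le> K \<Longrightarrow> energy' (y n) (b n) + (1 - ced e * \<tau> * (1 / \<delta>) * (1 / mesh_size m)) * \<tau> * (\<Sum>k = 1..n. S k)
      \<le> energy' (y 0) (b 0)" for n
  proof (induction n)
    case (Suc n)
    then show ?case using iterates_energy_step[of n e] assms[of n] by (simp add: distrib_left)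
  qed simp
  then show ?thesis unfolding energy_estimate_def S_def by blast
qed

text \<open>Bootstrap: if the energy is still at most the initial one, the constant at the initial
  energy governs the next step, whose dissipation coefficient is then nonnegative.\<close>

lemma energy_decreasing:
  assumes "ced (energy' y0 b0) * \<tau> \<le> \<delta> * mesh_size m"
  shows "energy' (y k) (b k) \<le> energy' y0 b0"
proof (induction k)
  case 0
  then show ?case using it unfolding iterates_def by simp
next
  case (Suc k)
  have "ced (energy' y0 b0) * \<tau> * (1 / \<delta>) * (1 / mesh_size m) \<le> 1"
    using assms pos mesh_size_pos by (simp add: field_simps)
  then have "0 \<le> (1 - ced (energy' y0 b0) * \<tau> * (1 / \<delta>) * (1 / mesh_size m)) * \<tau> * S (Suc k)"
    using tau S_nonneg by simp
  then show ?case using iterates_energy_step[OF Suc] Suc by linarith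
qed

lemma sum_S_le:
  assumes "2 * ced (energy' y0 b0) * \<tau> \<le> \<delta> * mesh_size m"
  shows "\<tau> * (\<Sum>k = 1..K. S k) \<le> 2 * energy' y0 b0"
proof -
  have "ced (energy' y0 b0) * \<tau> \<le> \<delta> * mesh_size m"
    using assms mult_pos_pos[OF ced_bound_mono_pos(2)[OF c pos(1-3)] tau, of cstar cdag "energy' y0 b0"] by linarith
  note dec = energy_decreasing[OF this]
  have "ced (energy' y0 b0) * \<tau> * (1 / \<delta>) * (1 / mesh_size m) \<le> 1 / 2"
    using assms pos mesh_size_pos by (simp add: field_simps)
  then have "1 / 2 * (\<tau> * (\<Sum>k = 1..K. S k)) \<le>
      (1 - ced (energy' y0 b0) * \<tau> * (1 / \<delta>) * (1 / mesh_size m)) * (\<tau> * (\<Sum>k = 1..K. S k))"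
    using tau S_nonneg by (intro mult_right_mono mult_nonneg_nonneg sum_nonneg) auto
  moreover have "energy' (y K) (b K) + (1 - ced (energy' y0 b0) * \<tau> * (1 / \<delta>) * (1 / mesh_size m)) * \<tau> *
      (\<Sum>k = 1..K. S k) \<le> energy' (y 0) (b 0)"
    using energy_estimate_bounded[of K, OF dec] unfolding energy_estimate_def S_def .
  moreover have "0 < energy' (y K) (b K)"
    by (rule energy_bounds(3)[OF iterates_mem[OF it y0 b0]])
  moreover have "energy' (y 0) (b 0) = energy' y0 b0" using it unfolding iterates_def by simp
  ultimately show ?thesis by (simp only: mult.assoc)
qed

text \<open>Since the increments are orthogonal to the previous iterate at the nodes, Pythagoras gives
  \<open>|b\<^sub>k|\<^sup>2 = |b\<^sub>k\<^sub>-\<^sub>1|\<^sup>2 + \<tau>\<^sup>2 |d\<^sub>t b\<^sub>k|\<^sup>2\<close> there, and likewise for \<open>y'\<close>.\<close>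

lemma node_norms:
  assumes "j \<le> N"
  shows "(norm (D m (y k) (X j)))\<^sup>2 = (norm (D m (y 0) (X j)))\<^sup>2 + \<tau>\<^sup>2 * (\<Sum>i = 1..k. (norm (D m (dt \<tau> y i) (X j)))\<^sup>2)"
    "(norm (b k (X j)))\<^sup>2 = (norm (b 0 (X j)))\<^sup>2 + \<tau>\<^sup>2 * (\<Sum>i = 1..k. (norm (dt \<tau> b i (X j)))\<^sup>2)"
proof -
  have pyth: "(norm (u + \<tau> *\<^sub>R v))\<^sup>2 = (norm u)\<^sup>2 + \<tau>\<^sup>2 * (norm v)\<^sup>2" if "v \<bullet> u = 0" for u v :: vec3
    unfolding power2_norm_eq_inner using that
    by (simp add: inner_add inner_commute power2_eq_square)
  have "(norm (D m (y (Suc n)) (X j)))\<^sup>2 = (norm (D m (y n) (X j)))\<^sup>2 + \<tau>\<^sup>2 * (norm (D m (dt \<tau> y (Suc n)) (X j)))\<^sup>2" for n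
  proof -
    have eq: "y (Suc n) = (\<lambda>s. y n s + \<tau> *\<^sub>R dt \<tau> y (Suc n) s)" unfolding dt_Suc using tau by auto
    have mem: "dt \<tau> y (Suc n) \<in> Yh m" using dt_mem(1)[of n] TY_subset by blast
    have "D m (y (Suc n)) (X j) = D m (y n) (X j) + \<tau> *\<^sub>R D m (dt \<tau> y (Suc n)) (X j)"
      by (subst eq) (rule Yh_D_lincomb[OF iterates_mem(1)[OF it y0 b0] mem node_in_dom[OF assms]])
    then show ?thesis using pyth dt_mem(1)[of n] assms unfolding tangent_Y_def by simp
  qed
  then show "(norm (D m (y k) (X j)))\<^sup>2 = (norm (D m (y 0) (X j)))\<^sup>2 + \<tau>\<^sup>2 * (\<Sum>i = 1..k. (norm (D m (dt \<tau> y i) (X j)))\<^sup>2)"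
    by (induction k) (simp_all add: distrib_left)
  have "(norm (b (Suc n) (X j)))\<^sup>2 = (norm (b n (X j)))\<^sup>2 + \<tau>\<^sup>2 * (norm (dt \<tau> b (Suc n) (X j)))\<^sup>2" for n
  proof -
    have "b (Suc n) (X j) = b n (X j) + \<tau> *\<^sub>R dt \<tau> b (Suc n) (X j)" unfolding dt_Suc using tau by simp
    then show ?thesis using pyth dt_mem(2)[of n] assms unfolding tangent_B_def by simp
  qed
  then show "(norm (b k (X j)))\<^sup>2 = (norm (b 0 (X j)))\<^sup>2 + \<tau>\<^sup>2 * (\<Sum>i = 1..k. (norm (dt \<tau> b i (X j)))\<^sup>2)"
    by (induction k) (simp_all add: distrib_left)
qed

text \<open>Sobolev's inequality, with \<open>C\<close> for the \<open>L^2\<close> part and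
  \<open>cstar\<close> or \<open>cdag\<close> for the derivative. The homogeneous boundary
  conditions of increments make \<open>low_order_control\<close> applicable.\<close>

lemma increment_sup_bounds:
  assumes C: "low_order_control m ipS ipD \<Lambda>1 \<Lambda>2 C" and u: "u \<in> dom m" and i: "i \<ge> 1"
  shows "(norm (D m (dt \<tau> y i) u))\<^sup>2 \<le> (2 / L * C\<^sup>2 + 2 * L * (cstar\<^sup>2 + cdag\<^sup>2)) * S i"
    "(norm (dt \<tau> b i u))\<^sup>2 \<le> (2 / L * C\<^sup>2 + 2 * L * (cstar\<^sup>2 + cdag\<^sup>2)) * S i"
proof -
  define A where "A = 2 / L * C\<^sup>2 + 2 * L * (cstar\<^sup>2 + cdag\<^sup>2)"
  have mono: "2 / L * (C\<^sup>2 * x) + 2 * L * (a\<^sup>2 * x) \<le> A * S i"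
    if "0 \<le> x" "x \<le> S i" "a\<^sup>2 \<le> cstar\<^sup>2 + cdag\<^sup>2" for x a
  proof -
    have "2 / L * (C\<^sup>2 * x) + 2 * L * (a\<^sup>2 * x) = (2 / L * C\<^sup>2 + 2 * L * a\<^sup>2) * x"
      by (simp add: algebra_simps)
    also have "\<dots> \<le> A * S i"
      unfolding A_def using that L_pos by (intro mult_mono add_mono mult_left_mono) auto
    finally show ?thesis .
  qed
  obtain n where n: "i = Suc n" using i by (cases i) auto
  have dY: "dt \<tau> y i \<in> Yh m" "bc1 m \<Lambda>1 (dt \<tau> y i) = 0" and dB: "dt \<tau> b i \<in> Bh m" "bc2 m \<Lambda>2 (dt \<tau> b i) = 0"
    using dt_mem[of n] unfolding n tangent_Y_def tangent_B_def by auto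
  note pY = Yh_D_pwp[OF dY(1)] and pB = Bh_pwp[OF dB(1)]
  have "(norm (D m (dt \<tau> y i) u))\<^sup>2 \<le> 2 / L * (L2_norm m (D m (dt \<tau> y i)))\<^sup>2 + 2 * L * (L2_norm m (D m (D m (dt \<tau> y i))))\<^sup>2"
    by (rule pwp_sup_bound[OF pY u])
  also have "\<dots> \<le> 2 / L * (C\<^sup>2 * (ip_norm ipS (dt \<tau> y i))\<^sup>2) + 2 * L * (cstar\<^sup>2 * (ip_norm ipS (dt \<tau> y i))\<^sup>2)"
    using C dY L_pos unfolding low_order_control_def
    by (intro add_mono mult_left_mono L2_square_le star pwp_pc pwp_D_pc pY) auto
  also have "\<dots> \<le> A * S i" by (rule mono) (auto simp: S_def)
  finally show "(norm (D m (dt \<tau> y i) u))\<^sup>2 \<le> A * S i" .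
  have "(norm (dt \<tau> b i u))\<^sup>2 \<le> 2 / L * (L2_norm m (dt \<tau> b i))\<^sup>2 + 2 * L * (L2_norm m (D m (dt \<tau> b i)))\<^sup>2"
    by (rule pwp_sup_bound[OF pB u])
  also have "\<dots> \<le> 2 / L * (C\<^sup>2 * (ip_norm ipD (dt \<tau> b i))\<^sup>2) + 2 * L * (cdag\<^sup>2 * (ip_norm ipD (dt \<tau> b i))\<^sup>2)"
    using C dB L_pos unfolding low_order_control_def
    by (intro add_mono mult_left_mono L2_square_le dagger pwp_pc pwp_D_pc pB) auto
  also have "\<dots> \<le> A * S i" by (rule mono) (auto simp: S_def)
  finally show "(norm (dt \<tau> b i u))\<^sup>2 \<le> A * S i" .
qed

text \<open>The violation is \<open>\<tau>^2\<close> times a sum of squared increments; one factor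
  \<open>\<tau>\<close> goes into the dissipation bound, the other remains. The 4 is 2 from
  \<open>sum_S_le\<close> times two norms.\<close>

lemma constraint_violation:
  assumes C: "low_order_control m ipS ipD \<Lambda>1 \<Lambda>2 C"
    and step: "2 * ced (energy' y0 b0) * \<tau> \<le> \<delta> * mesh_size m"
    and unit: "\<forall>j\<le>N. norm (D m y0 (X j)) = 1 \<and> norm (b0 (X j)) = 1"
  shows "Linf_norm m (\<lambda>u. interp m (\<lambda>v. (norm (b k v))\<^sup>2) u - 1) +
      Linf_norm m (\<lambda>u. interp m (\<lambda>v. (norm (D m (y k) v))\<^sup>2) u - 1)
    \<le> 4 * (2 / L * C\<^sup>2 + 2 * L * (cstar\<^sup>2 + cdag\<^sup>2)) * \<tau> * energy' y0 b0"
proof -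
  define A where "A = 2 / L * C\<^sup>2 + 2 * L * (cstar\<^sup>2 + cdag\<^sup>2)"
  have A: "0 \<le> A" unfolding A_def using L_pos by simp
  have init: "y 0 = y0" "b 0 = b0" using it unfolding iterates_def by auto
  have bound: "\<tau>\<^sup>2 * (\<Sum>i = 1..k. g i) \<le> 2 * A * \<tau> * energy' y0 b0"
    if "\<And>i. i \<in> {1..k} \<Longrightarrow> g i \<le> A * S i" for g
  proof -
    have "\<tau>\<^sup>2 * (\<Sum>i = 1..k. g i) \<le> \<tau>\<^sup>2 * (\<Sum>i = 1..k. A * S i)"
      using that by (intro mult_left_mono sum_mono) auto
    also have "\<dots> = (\<tau> * A) * (\<tau> * (\<Sum>i = 1..k. S i))"
      by (simp add: power2_eq_square sum_distrib_left mult_ac)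
    also have "\<dots> \<le> (\<tau> * A) * (2 * energy' y0 b0)"
      using sum_S_le[OF step] tau A by (intro mult_left_mono) auto
    finally show ?thesis by (simp add: mult_ac)
  qed
  have "Linf_norm m (\<lambda>u. interp m (\<lambda>v. (norm (b k v))\<^sup>2) u - 1) \<le> 2 * A * \<tau> * energy' y0 b0"
  proof (rule Linf_interp_le)
    fix j assume j: "j \<le> N"
    have "\<tau>\<^sup>2 * (\<Sum>i = 1..k. (norm (dt \<tau> b i (X j)))\<^sup>2) \<le> 2 * A * \<tau> * energy' y0 b0"
      unfolding A_def by (rule bound[unfolded A_def], rule increment_sup_bounds(2)[OF C node_in_dom[OF j]]) auto
    moreover have "0 \<le> \<tau>\<^sup>2 * (\<Sum>i = 1..k. (norm (dt \<tau> b i (X j)))\<^sup>2)" by (simp add: sum_nonneg)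
    ultimately show "\<bar>(norm (b k (X j)))\<^sup>2 - 1\<bar> \<le> 2 * A * \<tau> * energy' y0 b0"
      unfolding node_norms(2)[OF j, of k] using unit j init by simp
  qed
  moreover have "Linf_norm m (\<lambda>u. interp m (\<lambda>v. (norm (D m (y k) v))\<^sup>2) u - 1) \<le> 2 * A * \<tau> * energy' y0 b0"
  proof (rule Linf_interp_le)
    fix j assume j: "j \<le> N"
    have "\<tau>\<^sup>2 * (\<Sum>i = 1..k. (norm (D m (dt \<tau> y i) (X j)))\<^sup>2) \<le> 2 * A * \<tau> * energy' y0 b0"
      unfolding A_def by (rule bound[unfolded A_def], rule increment_sup_bounds(1)[OF C node_in_dom[OF j]]) auto
    moreover have "0 \<le> \<tau>\<^sup>2 * (\<Sum>i = 1..k. (norm (D m (dt \<tau> y i) (X j)))\<^sup>2)" by (simp add: sum_nonneg)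
    ultimately show "\<bar>(norm (D m (y k) (X j)))\<^sup>2 - 1\<bar> \<le> 2 * A * \<tau> * energy' y0 b0"
      unfolding node_norms(1)[OF j, of k] using unit j init by simp
  qed
  ultimately have "Linf_norm m (\<lambda>u. interp m (\<lambda>v. (norm (b k v))\<^sup>2) u - 1) +
      Linf_norm m (\<lambda>u. interp m (\<lambda>v. (norm (D m (y k) v))\<^sup>2) u - 1) \<le> 4 * A * \<tau> * energy' y0 b0"
    by linarith
  then show ?thesis unfolding A_def .
qed

end

end

text \<open>Choosing the constants before the partition, the inner products,
  \<open>\<delta>\<close>, \<open>\<epsilon>1\<close>, \<open>\<epsilon>2\<close> and
  \<open>\<tau>\<close> expresses their independence of these. The argument of \<open>ced\<close> is
  an energy bound: the initial energy under the step size condition, otherwise the largest energy of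
  the iterates before step \<open>K\<close>. The argument of \<open>cul\<close> is a constant of
  \<open>low_order_control\<close>, whose existence is asserted separately. For \<open>K = 0\<close>
  the set \<open>{..K - 1}\<close> is \<open>{0}\<close>, so the maximum is still over a nonempty
  set.\<close>

theorem proposition5p4:
  fixes L c c0 c1 c2 cuni cstar cdag :: real
  assumes "L > 0" "c > 0" "c0 > 0" "c1 > 0" "c2 > 0" "cuni > 0" "cstar > 0" "cdag > 0"
  shows "\<exists>(ced :: real \<Rightarrow> real) (cul :: real \<Rightarrow> real).
    (\<forall>e. ced e > 0) \<and> mono ced \<and> (\<forall>C. cul C > 0) \<and>
    (\<forall>(m :: mesh) (ipS :: (real \<Rightarrow> vec3) \<Rightarrow> (real \<Rightarrow> vec3) \<Rightarrow> real)
        (ipD :: (real \<Rightarrow> vec3) \<Rightarrow> (real \<Rightarrow> vec3) \<Rightarrow> real)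
        (\<Lambda>1 :: vec3 \<times> vec3 \<times> vec3 \<times> vec3 \<Rightarrow> 'm::real_normed_vector) (l1 :: 'm)
        (\<Lambda>2 :: vec3 \<times> vec3 \<Rightarrow> 'n::real_normed_vector) (l2 :: 'n)
        (\<delta> :: real) (\<phi> :: real \<Rightarrow> real) (\<epsilon>1 :: real) (\<epsilon>2 :: real) (\<tau> :: real)
        (y0 :: real \<Rightarrow> vec3) (b0 :: real \<Rightarrow> vec3).
        is_partition L m \<and> quasiuniform c m \<and>
        inner_product_on (Yh m) ipS \<and> inner_product_on (Bh m) ipD \<and>
        (\<forall>w\<in>Yh m. L2_norm m (D m (D m w)) \<le> cstar * ip_norm ipS w) \<and>
        (\<forall>r\<in>Bh m. L2_norm m (D m r) \<le> cdag * ip_norm ipD r) \<and>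
        bounded_linear \<Lambda>1 \<and> bounded_linear \<Lambda>2 \<and>
        \<delta> > 0 \<and> regularized_abs c0 c1 c2 cuni \<delta> \<phi> \<and> \<epsilon>1 > 0 \<and> \<epsilon>2 > 0 \<and> \<tau> > 0 \<and>
        admissible_init m \<Lambda>1 l1 \<Lambda>2 l2 y0 b0
        \<longrightarrow>
        (\<exists>!(y, b). iterates m \<phi> \<epsilon>1 \<epsilon>2 ipS ipD \<Lambda>1 \<Lambda>2 \<tau> y0 b0 y b) \<and>
        (\<exists>C. low_order_control m ipS ipD \<Lambda>1 \<Lambda>2 C) \<and>
        (\<forall>y b. iterates m \<phi> \<epsilon>1 \<epsilon>2 ipS ipD \<Lambda>1 \<Lambda>2 \<tau> y0 b0 y b \<longrightarrow>
          (let e0 = energy m \<phi> \<epsilon>1 \<epsilon>2 y0 b0; h = mesh_size m in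
            (\<forall>K. energy_estimate m \<phi> \<epsilon>1 \<epsilon>2 ipS ipD \<delta> \<tau>
                   (ced (Max ((\<lambda>k. energy m \<phi> \<epsilon>1 \<epsilon>2 (y k) (b k)) ` {..K - 1}))) y b K) \<and>
            (ced e0 * \<tau> \<le> \<delta> * h \<longrightarrow>
              (\<forall>K. energy_estimate m \<phi> \<epsilon>1 \<epsilon>2 ipS ipD \<delta> \<tau> (ced e0) y b K)) \<and>
            (2 * ced e0 * \<tau> \<le> \<delta> * h \<longrightarrow>
              (\<forall>C k. low_order_control m ipS ipD \<Lambda>1 \<Lambda>2 C \<longrightarrow>
                 Linf_norm m (\<lambda>u. interp m (\<lambda>v. (norm (b k v))\<^sup>2) u - 1) +
                 Linf_norm m (\<lambda>u. interp m (\<lambda>v. (norm (D m (y k) v))\<^sup>2) u - 1)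
                 \<le> cul C * \<tau> * e0)))))"
proof -
  have cul: "4 * (2 / L * C\<^sup>2 + 2 * L * (cstar\<^sup>2 + cdag\<^sup>2)) > 0" for C
  proof -
    have "0 \<le> 2 / L * C\<^sup>2" "0 < 2 * L * (cstar\<^sup>2 + cdag\<^sup>2)"
      using assms by (auto intro!: mult_pos_pos add_pos_pos)
    then have "0 < 2 / L * C\<^sup>2 + 2 * L * (cstar\<^sup>2 + cdag\<^sup>2)" by (rule add_nonneg_pos)
    then show ?thesis by (rule mult_pos_pos[rotated]) simp
  qed
  show ?thesis
    unfolding Let_def
  proof (rule exI[of _ "ced_bound c c0 c1 c2 cstar cdag"],
      rule exI[of _ "\<lambda>C. 4 * (2 / L * C\<^sup>2 + 2 * L * (cstar\<^sup>2 + cdag\<^sup>2))"],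
      intro conjI allI, goal_cases)
    case (1 e)
    show ?case by (rule ced_bound_mono_pos(2)[OF assms(2-5)])
  next
    case 2
    show ?case by (rule ced_bound_mono_pos(1)[OF assms(2-5)])
  next
    case (3 C)
    show ?case by (rule cul)
  next
    case (4 m ipS ipD \<Lambda>1 l1 \<Lambda>2 l2 \<delta> \<phi> \<epsilon>1 \<epsilon>2 \<tau> y0 b0)
    show ?case
    proof (rule impI, elim conjE, goal_cases)
      case 1
      have h: "is_partition L m" "quasiuniform c m"
        "inner_product_on (Yh m) ipS" "inner_product_on (Bh m) ipD"
        "\<forall>w\<in>Yh m. L2_norm m (D m (D m w)) \<le> cstar * ip_norm ipS w"
        "\<forall>r\<in>Bh m. L2_norm m (D m r) \<le> cdag * ip_norm ipD r"
        "bounded_linear \<Lambda>1" "bounded_linear \<Lambda>2" "\<delta> > 0" "\<epsilon>1 > 0" "\<epsilon>2 > 0" "\<tau> > 0"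
        and reg: "regularized_abs c0 c1 c2 cuni \<delta> \<phi>" and init: "admissible_init m \<Lambda>1 l1 \<Lambda>2 l2 y0 b0"
        by (fact 1)+
      \<comment> \<open>The derivatives are hidden behind an existential quantifier; the locale
        needs them as fixed functions.\<close>
      obtain \<phi>' \<phi>'' where \<phi>: "\<And>x. (\<phi> has_real_derivative \<phi>' x) (at x)"
        "\<And>x. (\<phi>' has_real_derivative \<phi>'' x) (at x)"
        "\<And>x. c0 * \<delta> \<le> \<phi> x \<and> \<bar>\<phi>' x\<bar> \<le> c1 \<and> \<bar>\<phi>'' x\<bar> \<le> c2 / \<delta>"
        using reg unfolding regularized_abs_def by blast
      interpret scheme m L \<phi> \<phi>' \<phi>'' c0 c1 c2 \<delta> c cstar cdag \<epsilon>1 \<epsilon>2 \<tau> ipS ipD \<Lambda>1 \<Lambda>2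
        proof (intro scheme.intro mesh_partition.intro regularized.intro scheme_axioms.intro)
        show "\<And>x. \<bar>\<phi>' x\<bar> \<le> c1" "\<And>x. \<bar>\<phi>'' x\<bar> \<le> c2 / \<delta>" "\<And>x. c0 * \<delta> \<le> \<phi> x"
          using \<phi>(3) by blast+
        show "\<And>w. w \<in> Yh m \<Longrightarrow> L2_norm m (D m (D m w)) \<le> cstar * ip_norm ipS w"
          "\<And>r. r \<in> Bh m \<Longrightarrow> L2_norm m (D m r) \<le> cdag * ip_norm ipD r"
          using h(5,6) by blast+
      qed (fact \<phi> h assms)+
      have y0: "y0 \<in> Yh m" and b0: "b0 \<in> Bh m"
        and unit: "\<forall>j\<le>nel m. norm (D m y0 (node m j)) = 1 \<and> norm (b0 (node m j)) = 1"
        using init unfolding admissible_init_def by auto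
      show ?case
      proof (intro conjI allI impI)
        show "\<exists>!(y, b). iterates m \<phi> \<epsilon>1 \<epsilon>2 ipS ipD \<Lambda>1 \<Lambda>2 \<tau> y0 b0 y b"
          by (rule ex1_iterates[OF y0 b0])
        show "\<exists>C. low_order_control m ipS ipD \<Lambda>1 \<Lambda>2 C"
          by (rule ex_low_order_control[OF h(3,4)])
      next
        fix y b K
        assume it: "iterates m \<phi> \<epsilon>1 \<epsilon>2 ipS ipD \<Lambda>1 \<Lambda>2 \<tau> y0 b0 y b"
        show "energy_estimate m \<phi> \<epsilon>1 \<epsilon>2 ipS ipD \<delta> \<tau>
            (ced (Max ((\<lambda>k. energy' (y k) (b k)) ` {..K - 1}))) y b K"
          by (rule energy_estimate_bounded[OF it y0 b0]) (rule Max_ge, auto)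
        show "energy_estimate m \<phi> \<epsilon>1 \<epsilon>2 ipS ipD \<delta> \<tau> (ced (energy' y0 b0)) y b K"
          if "ced (energy' y0 b0) * \<tau> \<le> \<delta> * mesh_size m"
          by (rule energy_estimate_bounded[OF it y0 b0 energy_decreasing[OF it y0 b0 that]])
      next
        fix y b C k
        assume "iterates m \<phi> \<epsilon>1 \<epsilon>2 ipS ipD \<Lambda>1 \<Lambda>2 \<tau> y0 b0 y b"
          "2 * ced (energy' y0 b0) * \<tau> \<le> \<delta> * mesh_size m"
          "low_order_control m ipS ipD \<Lambda>1 \<Lambda>2 C"
        then show "Linf_norm m (\<lambda>u. interp m (\<lambda>v. (norm (b k v))\<^sup>2) u - 1) +
            Linf_norm m (\<lambda>u. interp m (\<lambda>v. (norm (D m (y k) v))\<^sup>2) u - 1)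
          \<le> 4 * (2 / L * C\<^sup>2 + 2 * L * (cstar\<^sup>2 + cdag\<^sup>2)) * \<tau> * energy' y0 b0"
          by (intro constraint_violation y0 b0 unit)
      qed
    qed
  qed
qed

end
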